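(* Let $n\ge2$ and let $F:\mathcal M_1\times\cdots\times\mathcal M_n\to\mathcal M_0$ be an $n$-variable left adjoint between abelian model categories, with right adjoints $G^j$. Write $\mathcal D_i$ and $\mathcal E_i$ for the classes of cofibrant and fibrant objects in $\mathcal M_i$, respectively. Suppose that: 1. for every $j\in\{1,\ldots,n\}$ and all $D_i\in\mathcal D_i$ ($i\neq j$), the class $\mathcal D_j$ is right split for the functor $F(D_1,\ldots,D_{j-1},-,D_{j+1},\ldots,D_n):\mathcal M_j\to\mathcal M_0$; 2. if $D_i\in\mathcal D_i$ for all $i>0$, then $F(D_1,\ldots,D_n)\in\mathcal D_0$; 3. if additionally at least one of the $D_i$ is acyclic, then so is $F(D_1,\ldots,D_n)$. Then $F$ is an $n$-variable left Quillen functor.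
   Context: Abelian model category: a category $\mathcal M=\mathrm{Ch}(\mathcal A)$ of unbounded cochain complexes over an abelian category $\mathcal A$ (with all $\mathrm{Ext}^n(A,B)$ sets), with a model structure whose weak equivalences are the quasi-isomorphisms, whose cofibrations are precisely the monomorphisms with cofibrant cokernel, and whose fibrations are precisely the epimorphisms with fibrant kernel. Right split: for a right exact functor $H$ between abelian categories, a class $\mathcal S$ of objects of its source is $H$-right split if for every short exact sequence $0\to X\to Y\to S\to 0$ with $S\in\mathcal S$ the sequence $0\to HX\to HY\to HS\to 0$ is exact. $n$-variable left adjoint: a functor $F:\mathcal M_1\times\cdots\times\mathcal M_n\to\mathcal M_0$ together with functors $G^j:\mathcal M_1^{op}\times\cdots\times\widehat{\mathcal M_j^{op}}\times\cdots\times\mathcal M_n^{op}\times\mathcal M_0\to\mathcal M_j$ (factor $j$ omitted), $1\le j\le n$, and isomorphisms $\mathrm{Mor}(F(a_1,\ldots,a_n),a_0)\cong\mathrm{Mor}(a_j,G^j(a_1,\ldots,\widehat{a_j},\ldots,a_n,a_0))$ natural in all variables. Pushout product: let $\Delta_1=\{0<1\}$. Given morphisms $f_i:A_i\to B_i$ in $\mathcal M_i$, viewed as functors on $\Delta_1$, one gets a diagram $F(f_1,\ldots,f_n):\Delta_1^n\to\mathcal M_0$, and $\square_F(f_1,\ldots,f_n):\mathrm{colim}_{\Delta_1^n\setminus\{(1,\ldots,1)\}}F(f_1,\ldots,f_n)\to F(B_1,\ldots,B_n)$ is the canonical map. $F$ is an $n$-variable left Quillen functor if for all cofibrations $f_i$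 in $\mathcal M_i$ ($i=1,\ldots,n$), $\square_F(f_1,\ldots,f_n)$ is a cofibration in $\mathcal M_0$, which is trivial whenever at least one $f_i$ is trivial. *)

theory Defs
  imports "HOL-Algebra.Group"
begin

record ('o, 'm) cat =
  Obj  :: "'o set"
  Arr  :: "'m set"
  Dom  :: "'m \<Rightarrow> 'o"
  Cod  :: "'m \<Rightarrow> 'o"
  Ide  :: "'o \<Rightarrow> 'm"
  Comp :: "'m \<Rightarrow> 'm \<Rightarrow> 'm"  (infixr "\<cdot>\<index>" 70)

definition Hom :: "('o, 'm, 'z) cat_scheme \<Rightarrow> 'o \<Rightarrow> 'o \<Rightarrow> 'm set" where
  "Hom C X Y = {f \<in> Arr C. Dom C f = X \<and> Cod C f = Y}"

locale category =
  fixes C :: "('o, 'm, 'z) cat_scheme" (structure)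
  assumes Dom_in_Obj: "f \<in> Arr C \<Longrightarrow> Dom C f \<in> Obj C"
    and Cod_in_Obj: "f \<in> Arr C \<Longrightarrow> Cod C f \<in> Obj C"
    and Ide_in_Hom: "X \<in> Obj C \<Longrightarrow> Ide C X \<in> Hom C X X"
    and Comp_in_Hom: "\<lbrakk>f \<in> Hom C X Y; g \<in> Hom C Y Z\<rbrakk> \<Longrightarrow> g \<cdot> f \<in> Hom C X Z"
    and Comp_Ide: "f \<in> Hom C X Y \<Longrightarrow> f \<cdot> Ide C X = f"
    and Ide_Comp: "f \<in> Hom C X Y \<Longrightarrow> Ide C Y \<cdot> f = f"
    and Comp_assoc: "\<lbrakk>f \<in> Hom C W X; g \<in> Hom C X Y; h \<in> Hom C Y Z\<rbrakk>
                       \<Longrightarrow> (h \<cdot> g) \<cdot> f = h \<cdot> (g \<cdot> f)"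

definition is_mono :: "('o, 'm, 'z) cat_scheme \<Rightarrow> 'm \<Rightarrow> bool" where
  "is_mono C f \<longleftrightarrow> f \<in> Arr C \<and>
     (\<forall>g\<in>Arr C. \<forall>h\<in>Arr C. Dom C g = Dom C h \<and> Cod C g = Dom C f \<and> Cod C h = Dom C f \<and>
        f \<cdot>\<^bsub>C\<^esub> g = f \<cdot>\<^bsub>C\<^esub> h \<longrightarrow> g = h)"

definition is_epi :: "('o, 'm, 'z) cat_scheme \<Rightarrow> 'm \<Rightarrow> bool" where
  "is_epi C f \<longleftrightarrow> f \<in> Arr C \<and>
     (\<forall>g\<in>Arr C. \<forall>h\<in>Arr C. Cod C g = Cod C h \<and> Dom C g = Cod C f \<and> Dom C h = Cod C f \<and>
        g \<cdot>\<^bsub>C\<^esub> f = h \<cdot>\<^bsub>C\<^esub> f \<longrightarrow> g = h)"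

definition is_iso :: "('o, 'm, 'z) cat_scheme \<Rightarrow> 'm \<Rightarrow> bool" where
  "is_iso C f \<longleftrightarrow> f \<in> Arr C \<and>
     (\<exists>g\<in>Hom C (Cod C f) (Dom C f). g \<cdot>\<^bsub>C\<^esub> f = Ide C (Dom C f) \<and> f \<cdot>\<^bsub>C\<^esub> g = Ide C (Cod C f))"

definition is_initial :: "('o, 'm, 'z) cat_scheme \<Rightarrow> 'o \<Rightarrow> bool" where
  "is_initial C Z \<longleftrightarrow> Z \<in> Obj C \<and> (\<forall>X\<in>Obj C. \<exists>!f. f \<in> Hom C Z X)"

definition is_terminal :: "('o, 'm, 'z) cat_scheme \<Rightarrow> 'o \<Rightarrow> bool" where
  "is_terminal C Z \<longleftrightarrow> Z \<in> Obj C \<and> (\<forall>X\<in>Obj C. \<exists>!f. f \<in> Hom C X Z)"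

definition is_zero_object :: "('o, 'm, 'z) cat_scheme \<Rightarrow> 'o \<Rightarrow> bool" where
  "is_zero_object C Z \<longleftrightarrow> is_initial C Z \<and> is_terminal C Z"

definition op_cat :: "('o, 'm, 'z) cat_scheme \<Rightarrow> ('o, 'm) cat" where
  "op_cat C = \<lparr>Obj = Obj C, Arr = Arr C, Dom = Cod C, Cod = Dom C, Ide = Ide C,
               Comp = (\<lambda>g f. f \<cdot>\<^bsub>C\<^esub> g)\<rparr>"

definition full_subcat :: "('o, 'm, 'z) cat_scheme \<Rightarrow> 'o set \<Rightarrow> ('o, 'm) cat" where
  "full_subcat C S = \<lparr>Obj = S, Arr = {f \<in> Arr C. Dom C f \<in> S \<and> Cod C f \<in> S},
                      Dom = Dom C, Cod = Cod C, Ide = Ide C, Comp = Comp C\<rparr>"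

text \<open>Objects and arrows of a product category are extensional families indexed by \<open>I\<close>.\<close>

definition prod_cat :: "'i set \<Rightarrow> ('i \<Rightarrow> ('o, 'm, 'z) cat_scheme) \<Rightarrow> ('i \<Rightarrow> 'o, 'i \<Rightarrow> 'm) cat" where
  "prod_cat I M = \<lparr>Obj = (\<Pi>\<^sub>E i\<in>I. Obj (M i)), Arr = (\<Pi>\<^sub>E i\<in>I. Arr (M i)),
                   Dom = (\<lambda>u. \<lambda>i\<in>I. Dom (M i) (u i)), Cod = (\<lambda>u. \<lambda>i\<in>I. Cod (M i) (u i)),
                   Ide = (\<lambda>a. \<lambda>i\<in>I. Ide (M i) (a i)),
                   Comp = (\<lambda>v u. \<lambda>i\<in>I. v i \<cdot>\<^bsub>M i\<^esub> u i)\<rparr>"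

record ('o, 'm, 'p, 'q) func =
  OMap :: "'o \<Rightarrow> 'p"
  AMap :: "'m \<Rightarrow> 'q"

definition is_functor ::
  "('o, 'm, 'y) cat_scheme \<Rightarrow> ('p, 'q, 'z) cat_scheme \<Rightarrow> ('o, 'm, 'p, 'q) func \<Rightarrow> bool" where
  "is_functor C D H \<longleftrightarrow> category C \<and> category D \<and>
     (\<forall>X\<in>Obj C. OMap H X \<in> Obj D \<and> AMap H (Ide C X) = Ide D (OMap H X)) \<and>
     (\<forall>f\<in>Arr C. AMap H f \<in> Hom D (OMap H (Dom C f)) (OMap H (Cod C f))) \<and>
     (\<forall>f\<in>Arr C. \<forall>g\<in>Arr C. Cod C f = Dom C g \<longrightarrow>
        AMap H (g \<cdot>\<^bsub>C\<^esub> f) = AMap H g \<cdot>\<^bsub>D\<^esub> AMap H f)"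

definition comp_func ::
  "('p, 'q, 'r, 's) func \<Rightarrow> ('o, 'm, 'p, 'q) func \<Rightarrow> ('o, 'm, 'r, 's) func" where
  "comp_func K H = \<lparr>OMap = OMap K \<circ> OMap H, AMap = AMap K \<circ> AMap H\<rparr>"

definition prod_func ::
  "'i set \<Rightarrow> ('i \<Rightarrow> ('o, 'm, 'p, 'q) func) \<Rightarrow> ('i \<Rightarrow> 'o, 'i \<Rightarrow> 'm, 'i \<Rightarrow> 'p, 'i \<Rightarrow> 'q) func" where
  "prod_func I H = \<lparr>OMap = (\<lambda>a. \<lambda>i\<in>I. OMap (H i) (a i)), AMap = (\<lambda>u. \<lambda>i\<in>I. AMap (H i) (u i))\<rparr>"

definition is_cocone ::
  "('o, 'm, 'y) cat_scheme \<Rightarrow> ('p, 'q, 'z) cat_scheme \<Rightarrow> ('o, 'm, 'p, 'q) func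
     \<Rightarrow> 'p \<Rightarrow> ('o \<Rightarrow> 'q) \<Rightarrow> bool" where
  "is_cocone J C D L \<iota> \<longleftrightarrow> L \<in> Obj C \<and> (\<forall>e\<in>Obj J. \<iota> e \<in> Hom C (OMap D e) L) \<and>
     (\<forall>u\<in>Arr J. \<iota> (Cod J u) \<cdot>\<^bsub>C\<^esub> AMap D u = \<iota> (Dom J u))"

definition is_mediating ::
  "('o, 'm, 'y) cat_scheme \<Rightarrow> ('p, 'q, 'z) cat_scheme
     \<Rightarrow> 'p \<Rightarrow> ('o \<Rightarrow> 'q) \<Rightarrow> 'p \<Rightarrow> ('o \<Rightarrow> 'q) \<Rightarrow> 'q \<Rightarrow> bool" where
  "is_mediating J C L \<iota> L' \<iota>' m \<longleftrightarrow> m \<in> Hom C L L' \<and> (\<forall>e\<in>Obj J. m \<cdot>\<^bsub>C\<^esub> \<iota> e = \<iota>' e)"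

definition is_colimit ::
  "('o, 'm, 'y) cat_scheme \<Rightarrow> ('p, 'q, 'z) cat_scheme \<Rightarrow> ('o, 'm, 'p, 'q) func
     \<Rightarrow> 'p \<Rightarrow> ('o \<Rightarrow> 'q) \<Rightarrow> bool" where
  "is_colimit J C D L \<iota> \<longleftrightarrow> is_cocone J C D L \<iota> \<and>
     (\<forall>L' \<iota>'. is_cocone J C D L' \<iota>' \<longrightarrow> (\<exists>!m. is_mediating J C L \<iota> L' \<iota>' m))"

record ('o, 'm) abcat = "('o, 'm) cat" +
  Plus :: "'m \<Rightarrow> 'm \<Rightarrow> 'm"  (infixl "\<oplus>\<^sub>a\<index>" 65)
  Zero :: "'o \<Rightarrow> 'o \<Rightarrow> 'm"

definition is_kernel :: "('o, 'm, 'z) abcat_scheme \<Rightarrow> 'm \<Rightarrow> 'm \<Rightarrow> bool" where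
  "is_kernel C f k \<longleftrightarrow> f \<in> Arr C \<and> k \<in> Arr C \<and> Cod C k = Dom C f \<and>
     f \<cdot>\<^bsub>C\<^esub> k = Zero C (Dom C k) (Cod C f) \<and>
     (\<forall>h\<in>Arr C. Cod C h = Dom C f \<and> f \<cdot>\<^bsub>C\<^esub> h = Zero C (Dom C h) (Cod C f) \<longrightarrow>
        (\<exists>!u. u \<in> Hom C (Dom C h) (Dom C k) \<and> k \<cdot>\<^bsub>C\<^esub> u = h))"

definition is_cokernel :: "('o, 'm, 'z) abcat_scheme \<Rightarrow> 'm \<Rightarrow> 'm \<Rightarrow> bool" where
  "is_cokernel C f q \<longleftrightarrow> f \<in> Arr C \<and> q \<in> Arr C \<and> Dom C q = Cod C f \<and>
     q \<cdot>\<^bsub>C\<^esub> f = Zero C (Dom C f) (Cod C q) \<and>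
     (\<forall>h\<in>Arr C. Dom C h = Cod C f \<and> h \<cdot>\<^bsub>C\<^esub> f = Zero C (Dom C f) (Cod C h) \<longrightarrow>
        (\<exists>!u. u \<in> Hom C (Cod C q) (Cod C h) \<and> u \<cdot>\<^bsub>C\<^esub> q = h))"

definition is_biproduct ::
  "('o, 'm, 'z) abcat_scheme \<Rightarrow> 'o \<Rightarrow> 'o \<Rightarrow> 'o \<Rightarrow> 'm \<Rightarrow> 'm \<Rightarrow> 'm \<Rightarrow> 'm \<Rightarrow> bool" where
  "is_biproduct C X Y P i j p q \<longleftrightarrow>
     i \<in> Hom C X P \<and> j \<in> Hom C Y P \<and> p \<in> Hom C P X \<and> q \<in> Hom C P Y \<and>
     p \<cdot>\<^bsub>C\<^esub> i = Ide C X \<and> q \<cdot>\<^bsub>C\<^esub> j = Ide C Y \<and>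
     q \<cdot>\<^bsub>C\<^esub> i = Zero C X Y \<and> p \<cdot>\<^bsub>C\<^esub> j = Zero C Y X \<and>
     (i \<cdot>\<^bsub>C\<^esub> p) \<oplus>\<^sub>a\<^bsub>C\<^esub> (j \<cdot>\<^bsub>C\<^esub> q) = Ide C P"

locale preadditive_category = category C for C :: "('o, 'm, 'z) abcat_scheme" (structure) +
  assumes Hom_comm_group: "\<lbrakk>X \<in> Obj C; Y \<in> Obj C\<rbrakk>
       \<Longrightarrow> comm_group \<lparr>carrier = Hom C X Y, monoid.mult = Plus C, one = Zero C X Y\<rparr>"
    and Comp_Plus: "\<lbrakk>f \<in> Hom C X Y; g \<in> Hom C Y Z; h \<in> Hom C Y Z\<rbrakk>
       \<Longrightarrow> (g \<oplus>\<^sub>a h) \<cdot> f = (g \<cdot> f) \<oplus>\<^sub>a (h \<cdot> f)"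
    and Plus_Comp: "\<lbrakk>f \<in> Hom C X Y; g \<in> Hom C X Y; h \<in> Hom C Y Z\<rbrakk>
       \<Longrightarrow> h \<cdot> (f \<oplus>\<^sub>a g) = (h \<cdot> f) \<oplus>\<^sub>a (h \<cdot> g)"

locale abelian_category = preadditive_category +
  assumes ex_zero_object: "\<exists>Z. is_zero_object C Z"
    and ex_biproduct: "\<lbrakk>X \<in> Obj C; Y \<in> Obj C\<rbrakk> \<Longrightarrow> \<exists>P i j p q. is_biproduct C X Y P i j p q"
    and ex_kernel: "f \<in> Arr C \<Longrightarrow> \<exists>k. is_kernel C f k"
    and ex_cokernel: "f \<in> Arr C \<Longrightarrow> \<exists>q. is_cokernel C f q"
    and mono_is_kernel: "is_mono C f \<Longrightarrow> \<exists>g. is_kernel C g f"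
    and epi_is_cokernel: "is_epi C f \<Longrightarrow> \<exists>g. is_cokernel C g f"

text \<open>In an abelian category \<open>0 \<rightarrow> X \<rightarrow> Y \<rightarrow> Z \<rightarrow> 0\<close> is exact iff it is a kernel-cokernel pair.\<close>

definition short_exact :: "('o, 'm, 'z) abcat_scheme \<Rightarrow> 'm \<Rightarrow> 'm \<Rightarrow> bool" where
  "short_exact C f g \<longleftrightarrow> is_kernel C g f \<and> is_cokernel C f g"

definition right_split ::
  "('o, 'm, 'y) abcat_scheme \<Rightarrow> ('p, 'q, 'z) abcat_scheme \<Rightarrow> ('o, 'm, 'p, 'q) func
     \<Rightarrow> 'o set \<Rightarrow> bool" where
  "right_split C D H \<S> \<longleftrightarrow>
     (\<forall>f g. short_exact C f g \<and> Cod C g \<in> \<S> \<longrightarrow> short_exact D (AMap H f) (AMap H g))"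

record ('o, 'm) cplx =
  cobj :: "int \<Rightarrow> 'o"
  diff :: "int \<Rightarrow> 'm"

record ('o, 'm) cmap =
  src  :: "('o, 'm) cplx"
  tgt  :: "('o, 'm) cplx"
  cmor :: "int \<Rightarrow> 'm"

definition is_complex :: "('o, 'm, 'z) abcat_scheme \<Rightarrow> ('o, 'm) cplx \<Rightarrow> bool" where
  "is_complex A X \<longleftrightarrow> (\<forall>n. cobj X n \<in> Obj A) \<and>
     (\<forall>n. diff X n \<in> Hom A (cobj X n) (cobj X (n + 1))) \<and>
     (\<forall>n. diff X (n + 1) \<cdot>\<^bsub>A\<^esub> diff X n = Zero A (cobj X n) (cobj X (n + 2)))"

definition is_chain_map :: "('o, 'm, 'z) abcat_scheme \<Rightarrow> ('o, 'm) cmap \<Rightarrow> bool" where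
  "is_chain_map A f \<longleftrightarrow> is_complex A (src f) \<and> is_complex A (tgt f) \<and>
     (\<forall>n. cmor f n \<in> Hom A (cobj (src f) n) (cobj (tgt f) n)) \<and>
     (\<forall>n. cmor f (n + 1) \<cdot>\<^bsub>A\<^esub> diff (src f) n = diff (tgt f) n \<cdot>\<^bsub>A\<^esub> cmor f n)"

definition Ch :: "('o, 'm, 'z) abcat_scheme \<Rightarrow> (('o, 'm) cplx, ('o, 'm) cmap) abcat" where
  "Ch A = \<lparr>Obj = {X. is_complex A X}, Arr = {f. is_chain_map A f}, Dom = src, Cod = tgt,
           Ide = (\<lambda>X. \<lparr>src = X, tgt = X, cmor = (\<lambda>n. Ide A (cobj X n))\<rparr>),
           Comp = (\<lambda>g f. \<lparr>src = src f, tgt = tgt g, cmor = (\<lambda>n. cmor g n \<cdot>\<^bsub>A\<^esub> cmor f n)\<rparr>),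
           Plus = (\<lambda>f g. \<lparr>src = src f, tgt = tgt f, cmor = (\<lambda>n. cmor f n \<oplus>\<^sub>a\<^bsub>A\<^esub> cmor g n)\<rparr>),
           Zero = (\<lambda>X Y. \<lparr>src = X, tgt = Y, cmor = (\<lambda>n. Zero A (cobj X n) (cobj Y n))\<rparr>)\<rparr>"

text \<open>
  The cohomology object in degree \<open>n\<close> is the cokernel of the map \<open>X\<^sup>n\<^sup>-\<^sup>1 \<rightarrow> Z\<^sup>n\<close> through which
  the differential factors, where \<open>Z\<^sup>n\<close> is the source of a chosen kernel of \<open>X\<^sup>n \<rightarrow> X\<^sup>n\<^sup>+\<^sup>1\<close>.
\<close>

definition cocycles :: "('o, 'm, 'z) abcat_scheme \<Rightarrow> int \<Rightarrow> ('o, 'm) cplx \<Rightarrow> 'm" where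
  "cocycles A n X = (SOME k. is_kernel A (diff X n) k)"

definition to_cocycles :: "('o, 'm, 'z) abcat_scheme \<Rightarrow> int \<Rightarrow> ('o, 'm) cplx \<Rightarrow> 'm" where
  "to_cocycles A n X =
     (THE b. b \<in> Hom A (cobj X (n - 1)) (Dom A (cocycles A n X)) \<and>
             cocycles A n X \<cdot>\<^bsub>A\<^esub> b = diff X (n - 1))"

definition cohom_class :: "('o, 'm, 'z) abcat_scheme \<Rightarrow> int \<Rightarrow> ('o, 'm) cplx \<Rightarrow> 'm" where
  "cohom_class A n X = (SOME q. is_cokernel A (to_cocycles A n X) q)"

definition cohom :: "('o, 'm, 'z) abcat_scheme \<Rightarrow> int \<Rightarrow> ('o, 'm) cplx \<Rightarrow> 'o" where
  "cohom A n X = Cod A (cohom_class A n X)"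

definition cohom_map :: "('o, 'm, 'z) abcat_scheme \<Rightarrow> int \<Rightarrow> ('o, 'm) cmap \<Rightarrow> 'm" where
  "cohom_map A n f =
     (THE u. u \<in> Hom A (cohom A n (src f)) (cohom A n (tgt f)) \<and>
        (\<exists>z \<in> Hom A (Dom A (cocycles A n (src f))) (Dom A (cocycles A n (tgt f))).
           cocycles A n (tgt f) \<cdot>\<^bsub>A\<^esub> z = cmor f n \<cdot>\<^bsub>A\<^esub> cocycles A n (src f) \<and>
           u \<cdot>\<^bsub>A\<^esub> cohom_class A n (src f) = cohom_class A n (tgt f) \<cdot>\<^bsub>A\<^esub> z))"

definition acyclic_complex :: "('o, 'm, 'z) abcat_scheme \<Rightarrow> ('o, 'm) cplx \<Rightarrow> bool" where
  "acyclic_complex A X \<longleftrightarrow> is_complex A X \<and> (\<forall>n. is_zero_object A (cohom A n X))"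

definition quasi_iso :: "('o, 'm, 'z) abcat_scheme \<Rightarrow> ('o, 'm) cmap \<Rightarrow> bool" where
  "quasi_iso A f \<longleftrightarrow> is_chain_map A f \<and> (\<forall>n. is_iso A (cohom_map A n f))"

record 'm model_classes =
  Cof :: "'m set"
  Fib :: "'m set"
  Weq :: "'m set"

definition has_lifting :: "('o, 'm, 'z) cat_scheme \<Rightarrow> 'm \<Rightarrow> 'm \<Rightarrow> bool" where
  "has_lifting C i p \<longleftrightarrow>
     (\<forall>u \<in> Hom C (Dom C i) (Dom C p). \<forall>v \<in> Hom C (Cod C i) (Cod C p).
        p \<cdot>\<^bsub>C\<^esub> u = v \<cdot>\<^bsub>C\<^esub> i \<longrightarrow>
        (\<exists>h \<in> Hom C (Cod C i) (Dom C p). h \<cdot>\<^bsub>C\<^esub> i = u \<and> p \<cdot>\<^bsub>C\<^esub> h = v))"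

definition is_retract :: "('o, 'm, 'z) cat_scheme \<Rightarrow> 'm \<Rightarrow> 'm \<Rightarrow> bool" where
  "is_retract C f g \<longleftrightarrow> f \<in> Arr C \<and> g \<in> Arr C \<and>
     (\<exists>i \<in> Hom C (Dom C f) (Dom C g). \<exists>r \<in> Hom C (Dom C g) (Dom C f).
      \<exists>j \<in> Hom C (Cod C f) (Cod C g). \<exists>s \<in> Hom C (Cod C g) (Cod C f).
        r \<cdot>\<^bsub>C\<^esub> i = Ide C (Dom C f) \<and> s \<cdot>\<^bsub>C\<^esub> j = Ide C (Cod C f) \<and>
        g \<cdot>\<^bsub>C\<^esub> i = j \<cdot>\<^bsub>C\<^esub> f \<and> f \<cdot>\<^bsub>C\<^esub> r = s \<cdot>\<^bsub>C\<^esub> g)"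

locale model_structure = category C
  for C :: "('o, 'm, 'z) cat_scheme" (structure) +
  fixes W :: "'m model_classes"
  assumes Cof_sub: "Cof W \<subseteq> Arr C"
    and Fib_sub: "Fib W \<subseteq> Arr C"
    and Weq_sub: "Weq W \<subseteq> Arr C"
    and two_of_three_comp: "\<lbrakk>f \<in> Hom C X Y; g \<in> Hom C Y Z; f \<in> Weq W; g \<in> Weq W\<rbrakk>
                              \<Longrightarrow> g \<cdot> f \<in> Weq W"
    and two_of_three_left: "\<lbrakk>f \<in> Hom C X Y; g \<in> Hom C Y Z; f \<in> Weq W; g \<cdot> f \<in> Weq W\<rbrakk>
                              \<Longrightarrow> g \<in> Weq W"
    and two_of_three_right: "\<lbrakk>f \<in> Hom C X Y; g \<in> Hom C Y Z; g \<in> Weq W; g \<cdot> f \<in> Weq W\<rbrakk>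
                              \<Longrightarrow> f \<in> Weq W"
    and Cof_retract: "\<lbrakk>is_retract C f g; g \<in> Cof W\<rbrakk> \<Longrightarrow> f \<in> Cof W"
    and Fib_retract: "\<lbrakk>is_retract C f g; g \<in> Fib W\<rbrakk> \<Longrightarrow> f \<in> Fib W"
    and Weq_retract: "\<lbrakk>is_retract C f g; g \<in> Weq W\<rbrakk> \<Longrightarrow> f \<in> Weq W"
    and lift_trivial_Cof: "\<lbrakk>i \<in> Cof W \<inter> Weq W; p \<in> Fib W\<rbrakk> \<Longrightarrow> has_lifting C i p"
    and lift_trivial_Fib: "\<lbrakk>i \<in> Cof W; p \<in> Fib W \<inter> Weq W\<rbrakk> \<Longrightarrow> has_lifting C i p"
    and factor_trivial_Cof: "f \<in> Hom C X Y
       \<Longrightarrow> \<exists>Z. \<exists>i \<in> Hom C X Z. \<exists>p \<in> Hom C Z Y. i \<in> Cof W \<inter> Weq W \<and> p \<in> Fib W \<and> p \<cdot> i = f"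
    and factor_trivial_Fib: "f \<in> Hom C X Y
       \<Longrightarrow> \<exists>Z. \<exists>i \<in> Hom C X Z. \<exists>p \<in> Hom C Z Y. i \<in> Cof W \<and> p \<in> Fib W \<inter> Weq W \<and> p \<cdot> i = f"

definition cofibrants :: "('o, 'm, 'z) cat_scheme \<Rightarrow> 'm model_classes \<Rightarrow> 'o set" where
  "cofibrants C W = {X \<in> Obj C. \<exists>Z. is_initial C Z \<and> (\<exists>f \<in> Hom C Z X. f \<in> Cof W)}"

definition fibrants :: "('o, 'm, 'z) cat_scheme \<Rightarrow> 'm model_classes \<Rightarrow> 'o set" where
  "fibrants C W = {X \<in> Obj C. \<exists>Z. is_terminal C Z \<and> (\<exists>f \<in> Hom C X Z. f \<in> Fib W)}"

text \<open>
  Completeness of the category of complexes is not assumed: finite limits and colimits exist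
  because \<open>A\<close> is abelian.  The condition that the classes \<open>Ext\<^sup>n(A, B)\<close> be sets is vacuous here,
  since objects and arrows are drawn from types.
\<close>

locale abelian_model_category = abelian_category A + model_structure "Ch A" W
  for A :: "('o, 'm, 'z) abcat_scheme" and W :: "('o, 'm) cmap model_classes" +
  assumes Weq_iff: "f \<in> Weq W \<longleftrightarrow> quasi_iso A f"
    and Cof_iff: "f \<in> Cof W \<longleftrightarrow>
       is_mono (Ch A) f \<and> (\<exists>q. is_cokernel (Ch A) f q \<and> tgt q \<in> cofibrants (Ch A) W)"
    and Fib_iff: "f \<in> Fib W \<longleftrightarrow>
       is_epi (Ch A) f \<and> (\<exists>k. is_kernel (Ch A) f k \<and> src k \<in> fibrants (Ch A) W)"

text \<open>The functor \<open>F(D\<^sub>1, \<dots>, D\<^sub>j\<^sub>-\<^sub>1, -, D\<^sub>j\<^sub>+\<^sub>1, \<dots>, D\<^sub>n)\<close>; the value of \<open>D\<close> at \<open>j\<close> is irrelevant.\<close>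

definition partial_func ::
  "nat \<Rightarrow> (nat \<Rightarrow> ('o, 'm, 'z) cat_scheme) \<Rightarrow> (nat \<Rightarrow> 'o, nat \<Rightarrow> 'm, 'p, 'q) func
     \<Rightarrow> (nat \<Rightarrow> 'o) \<Rightarrow> nat \<Rightarrow> ('o, 'm, 'p, 'q) func" where
  "partial_func n M F D j =
     \<lparr>OMap = (\<lambda>X. OMap F (\<lambda>i\<in>{1..n}. if i = j then X else D i)),
      AMap = (\<lambda>f. AMap F (\<lambda>i\<in>{1..n}. if i = j then f else Ide (M i) (D i)))\<rparr>"

text \<open>
  \<open>F\<close> is a functor \<open>M\<^sub>1 \<times> \<dots> \<times> M\<^sub>n \<rightarrow> M\<^sub>0\<close>, and the source of the right adjoint \<open>G j\<close> is the
  product over \<open>{0..n} - {j}\<close> in which every factor except the one with index \<open>0\<close> is opposite.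
  \<open>\<phi> j a\<close> is the adjunction isomorphism at \<open>a = (a\<^sub>0, \<dots>, a\<^sub>n)\<close>.  For naturality, \<open>u\<close> is a
  family of arrows \<open>u\<^sub>0 : a\<^sub>0 \<rightarrow> b\<^sub>0\<close> and \<open>u\<^sub>i : b\<^sub>i \<rightarrow> a\<^sub>i\<close> for \<open>i \<ge> 1\<close>.
\<close>

definition right_adjoint_source ::
  "nat \<Rightarrow> (nat \<Rightarrow> ('o, 'm, 'z) cat_scheme) \<Rightarrow> nat \<Rightarrow> (nat \<Rightarrow> 'o, nat \<Rightarrow> 'm) cat" where
  "right_adjoint_source n M j =
     prod_cat ({0..n} - {j}) (\<lambda>i. if i = 0 then cat.truncate (M 0) else op_cat (M i))"

definition multivar_adjunction ::
  "nat \<Rightarrow> (nat \<Rightarrow> ('o, 'm, 'z) cat_scheme) \<Rightarrow> (nat \<Rightarrow> 'o, nat \<Rightarrow> 'm, 'o, 'm) func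
     \<Rightarrow> (nat \<Rightarrow> (nat \<Rightarrow> 'o, nat \<Rightarrow> 'm, 'o, 'm) func) \<Rightarrow> (nat \<Rightarrow> (nat \<Rightarrow> 'o) \<Rightarrow> 'm \<Rightarrow> 'm) \<Rightarrow> bool" where
  "multivar_adjunction n M F G \<phi> \<longleftrightarrow>
     is_functor (prod_cat {1..n} M) (M 0) F \<and>
     (\<forall>j\<in>{1..n}. is_functor (right_adjoint_source n M j) (M j) (G j) \<and>
        (\<forall>a \<in> \<Pi>\<^sub>E i\<in>{0..n}. Obj (M i).
           bij_betw (\<phi> j a)
             (Hom (M 0) (OMap F (restrict a {1..n})) (a 0))
             (Hom (M j) (a j) (OMap (G j) (restrict a ({0..n} - {j}))))) \<and>
        (\<forall>a \<in> \<Pi>\<^sub>E i\<in>{0..n}. Obj (M i). \<forall>b \<in> \<Pi>\<^sub>E i\<in>{0..n}. Obj (M i).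
         \<forall>u \<in> \<Pi>\<^sub>E i\<in>{0..n}. if i = 0 then Hom (M 0) (a 0) (b 0) else Hom (M i) (b i) (a i).
         \<forall>g \<in> Hom (M 0) (OMap F (restrict a {1..n})) (a 0).
           \<phi> j b (u 0 \<cdot>\<^bsub>M 0\<^esub> g \<cdot>\<^bsub>M 0\<^esub> AMap F (restrict u {1..n})) =
           AMap (G j) (restrict u ({0..n} - {j})) \<cdot>\<^bsub>M j\<^esub> \<phi> j a g \<cdot>\<^bsub>M j\<^esub> u j))"

text \<open>The poset \<open>\<Delta>\<^sub>1 = {0 < 1}\<close> as a category, with \<open>False\<close> for \<open>0\<close> and \<open>True\<close> for \<open>1\<close>.\<close>

definition delta1 :: "(bool, bool \<times> bool) cat" where
  "delta1 = \<lparr>Obj = UNIV, Arr = {(x, y). x \<le> y}, Dom = fst, Cod = snd,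
             Ide = (\<lambda>x. (x, x)), Comp = (\<lambda>g f. (fst f, snd g))\<rparr>"

definition arrow_func :: "('o, 'm, 'z) cat_scheme \<Rightarrow> 'm \<Rightarrow> (bool, bool \<times> bool, 'o, 'm) func" where
  "arrow_func C f =
     \<lparr>OMap = (\<lambda>x. if x then Cod C f else Dom C f),
      AMap = (\<lambda>(x, y). if x then Ide C (Cod C f) else if y then f else Ide C (Dom C f))\<rparr>"

definition cube :: "nat \<Rightarrow> (nat \<Rightarrow> bool, nat \<Rightarrow> bool \<times> bool) cat" where
  "cube n = prod_cat {1..n} (\<lambda>_. delta1)"

definition cube_top :: "nat \<Rightarrow> nat \<Rightarrow> bool" where
  "cube_top n = (\<lambda>i\<in>{1..n}. True)"

definition punctured_cube :: "nat \<Rightarrow> (nat \<Rightarrow> bool, nat \<Rightarrow> bool \<times> bool) cat" where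
  "punctured_cube n = full_subcat (cube n) (Obj (cube n) - {cube_top n})"

definition cube_diagram ::
  "nat \<Rightarrow> (nat \<Rightarrow> ('o, 'm, 'z) cat_scheme) \<Rightarrow> (nat \<Rightarrow> 'o, nat \<Rightarrow> 'm, 'p, 'q) func \<Rightarrow> (nat \<Rightarrow> 'm)
     \<Rightarrow> (nat \<Rightarrow> bool, nat \<Rightarrow> bool \<times> bool, 'p, 'q) func" where
  "cube_diagram n M F f = comp_func F (prod_func {1..n} (\<lambda>i. arrow_func (M i) (f i)))"

definition pushout_product ::
  "nat \<Rightarrow> (nat \<Rightarrow> ('o, 'm, 'z) cat_scheme) \<Rightarrow> (nat \<Rightarrow> 'o, nat \<Rightarrow> 'm, 'o, 'm) func \<Rightarrow> (nat \<Rightarrow> 'm)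
     \<Rightarrow> 'm" where
  "pushout_product n M F f =
     (let D = cube_diagram n M F f;
          (L, \<iota>) = (SOME (L, \<iota>). is_colimit (punctured_cube n) (M 0) D L \<iota>)
      in THE m. is_mediating (punctured_cube n) (M 0) L \<iota>
                  (OMap D (cube_top n)) (\<lambda>e. AMap D (\<lambda>i\<in>{1..n}. (e i, True))) m)"

definition left_quillen ::
  "nat \<Rightarrow> (nat \<Rightarrow> ('o, 'm, 'z) cat_scheme) \<Rightarrow> (nat \<Rightarrow> 'm model_classes)
     \<Rightarrow> (nat \<Rightarrow> 'o, nat \<Rightarrow> 'm, 'o, 'm) func \<Rightarrow> bool" where
  "left_quillen n M W F \<longleftrightarrow>
     (\<forall>f. (\<forall>i\<in>{1..n}. f i \<in> Cof (W i)) \<longrightarrow>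
        pushout_product n M F f \<in> Cof (W 0) \<and>
        ((\<exists>i\<in>{1..n}. f i \<in> Weq (W i)) \<longrightarrow> pushout_product n M F f \<in> Weq (W 0)))"

end

theory Submission
  imports Defs
begin

text \<open>
  Write \<open>f\<^sub>i : A\<^sub>i \<rightarrow> B\<^sub>i\<close> for the given cofibrations and \<open>C\<^sub>i\<close> for their cofibrant cokernels. The point
  is that the pushout product \<open>L \<rightarrow> F(B\<^sub>1, \<dots>, B\<^sub>n)\<close> is a monomorphism with cokernel
  \<open>F(C\<^sub>1, \<dots>, C\<^sub>n)\<close>, although neither \<open>A\<^sub>i\<close> nor \<open>B\<^sub>i\<close> need be cofibrant. A map out of \<open>L\<close> is a
  family of maps on the faces \<open>F(B\<^sub>1, \<dots>, A\<^sub>i, \<dots>, B\<^sub>n)\<close> that agree on the intersections, and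
  \<open>L \<rightarrow> F(B\<^sub>1, \<dots>, B\<^sub>n)\<close> is mono iff every such family with values in \<open>T\<close> extends to
  \<open>F(B\<^sub>1, \<dots>, B\<^sub>n)\<close> after a monomorphism \<open>T \<rightarrow> T'\<close>. This is shown by induction on the number of
  variables in which \<open>f\<^sub>i\<close> is used, the objects in the remaining variables being cofibrant. In the
  induction step \<open>B\<^sub>j\<close> is covered by a cofibrant object, so that the induction hypothesis applies; the
  error term against the prescribed map on the face \<open>A\<^sub>j\<close> lives on \<open>F(C\<^sub>1, \<dots>, C\<^sub>j\<^sub>-\<^sub>1, -, \<dots>)\<close>, and
  is corrected there by right splitness.

  In an abelian model category the cokernel \<open>C\<close> of a trivial cofibration is acyclic, because
  \<open>0 \<rightarrow> C\<close> is a retract of a trivial cofibration, and conversely a monomorphism with acyclic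
  cofibrant cokernel is a retract of a trivial cofibration. This settles the second half without long exact sequences.
\<close>

section \<open>Preadditive and abelian categories\<close>

text \<open>The obstacle is that right splitness is available only when all other slots hold
  cofibrant objects. Applying F to \<open>f i\<close> with some A or B in another slot need not give
  a monomorphism, so the pushout product cannot be assembled from one-variable pushouts that are
  monic at every stage. The extension property needs no such stages. Applied to the colimit cocone
  itself, with T = L, it gives h on F(B) with h m = t for the pushout product m; since t is monic,
  so is m. Two consequences of the adjunctions carry the rest. F is right exact in each slot, so
  maps descend along covers and F(C) is the joint cokernel of the face maps. F also preserves zero
  objects, hence zero maps, which is proved and not assumed. The extension property is proved for
  families whose slots beyond k are cofibrant. The slot that leaves the induction receives a
  cofibrant cover, which keeps this condition; for k = n it is vacuous, so it applies to B.\<close>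

context category
begin

lemma Hom_Obj:
  assumes "f \<in> Hom C X Y"
  shows "X \<in> Obj C" "Y \<in> Obj C"
  using assms Dom_in_Obj Cod_in_Obj by (auto simp: Hom_def)

lemma monoD:
  assumes "is_mono C f" "g \<in> Hom C X (Dom C f)" "h \<in> Hom C X (Dom C f)" "f \<cdot> g = f \<cdot> h"
  shows "g = h"
  using assms by (auto simp: is_mono_def Hom_def)

lemma epiD:
  assumes "is_epi C f" "g \<in> Hom C (Cod C f) X" "h \<in> Hom C (Cod C f) X" "g \<cdot> f = h \<cdot> f"
  shows "g = h"
  using assms by (auto simp: is_epi_def Hom_def)

lemma is_monoI:
  assumes "f \<in> Hom C X Y"
    and "\<And>W x y. x \<in> Hom C W X \<Longrightarrow> y \<in> Hom C W X \<Longrightarrow> f \<cdot> x = f \<cdot> y \<Longrightarrow> x = y"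
  shows "is_mono C f"
  unfolding is_mono_def
proof (intro conjI ballI impI)
  fix x y assume "x \<in> Arr C" "y \<in> Arr C"
    "Dom C x = Dom C y \<and> Cod C x = Dom C f \<and> Cod C y = Dom C f \<and> f \<cdot> x = f \<cdot> y"
  then show "x = y"
    using assms(1) by (intro assms(2)[of x "Dom C y" y]) (simp_all add: Hom_def)
qed (use assms(1) in \<open>simp add: Hom_def\<close>)

lemma is_epiI:
  assumes "f \<in> Hom C X Y"
    and "\<And>W x y. x \<in> Hom C Y W \<Longrightarrow> y \<in> Hom C Y W \<Longrightarrow> x \<cdot> f = y \<cdot> f \<Longrightarrow> x = y"
  shows "is_epi C f"
  unfolding is_epi_def
proof (intro conjI ballI impI)
  fix x y assume "x \<in> Arr C" "y \<in> Arr C"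
    "Cod C x = Cod C y \<and> Dom C x = Cod C f \<and> Dom C y = Cod C f \<and> x \<cdot> f = y \<cdot> f"
  then show "x = y"
    using assms(1) by (intro assms(2)[of x "Cod C y" y]) (simp_all add: Hom_def)
qed (use assms(1) in \<open>simp add: Hom_def\<close>)

lemma epi_Comp_left:
  assumes "is_epi C (g \<cdot> f)" "f \<in> Hom C X Y" "g \<in> Hom C Y Z"
  shows "is_epi C g"
proof (rule is_epiI[OF assms(3)])
  fix W x y assume xy: "x \<in> Hom C Z W" "y \<in> Hom C Z W" "x \<cdot> g = y \<cdot> g"
  have "x \<cdot> (g \<cdot> f) = y \<cdot> (g \<cdot> f)"
    using xy(3) Comp_assoc[OF assms(2,3) xy(1)] Comp_assoc[OF assms(2,3) xy(2)] by simp
  then show "x = y"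
    using epiD[OF assms(1)] xy(1,2) Comp_in_Hom[OF assms(2,3)] by (simp add: Hom_def)
qed

lemma epi_Comp:
  assumes "is_epi C f" "is_epi C g" "f \<in> Hom C X Y" "g \<in> Hom C Y Z"
  shows "is_epi C (g \<cdot> f)"
proof (rule is_epiI[OF Comp_in_Hom[OF assms(3,4)]])
  fix W x y assume xy: "x \<in> Hom C Z W" "y \<in> Hom C Z W" "x \<cdot> g \<cdot> f = y \<cdot> g \<cdot> f"
  have "(x \<cdot> g) \<cdot> f = (y \<cdot> g) \<cdot> f"
    using xy(3) Comp_assoc[OF assms(3,4) xy(1)] Comp_assoc[OF assms(3,4) xy(2)] by simp
  then have "x \<cdot> g = y \<cdot> g"
    using epiD[OF assms(1)] Comp_in_Hom[OF assms(4) xy(1)] Comp_in_Hom[OF assms(4) xy(2)] assms(3)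
    by (simp add: Hom_def)
  then show "x = y"
    using epiD[OF assms(2)] xy(1,2) assms(4) by (simp add: Hom_def)
qed

lemma mono_Comp:
  assumes "is_mono C f" "is_mono C g" "f \<in> Hom C X Y" "g \<in> Hom C Y Z"
  shows "is_mono C (g \<cdot> f)"
proof (rule is_monoI[OF Comp_in_Hom[OF assms(3,4)]])
  fix W x y assume xy: "x \<in> Hom C W X" "y \<in> Hom C W X" "(g \<cdot> f) \<cdot> x = (g \<cdot> f) \<cdot> y"
  have "g \<cdot> (f \<cdot> x) = g \<cdot> (f \<cdot> y)"
    using xy(3) Comp_assoc[OF xy(1) assms(3,4)] Comp_assoc[OF xy(2) assms(3,4)] by simp
  then have "f \<cdot> x = f \<cdot> y"
    using monoD[OF assms(2)] Comp_in_Hom[OF xy(1) assms(3)] Comp_in_Hom[OF xy(2) assms(3)] assms(4)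
    by (simp add: Hom_def)
  then show "x = y"
    using monoD[OF assms(1)] xy(1,2) assms(3) by (simp add: Hom_def)
qed

lemma mono_Comp_right:
  assumes "is_mono C (g \<cdot> f)" "f \<in> Hom C X Y" "g \<in> Hom C Y Z"
  shows "is_mono C f"
proof (rule is_monoI[OF assms(2)])
  fix W x y assume xy: "x \<in> Hom C W X" "y \<in> Hom C W X" "f \<cdot> x = f \<cdot> y"
  have "(g \<cdot> f) \<cdot> x = (g \<cdot> f) \<cdot> y"
    using xy(3) Comp_assoc[OF xy(1) assms(2,3)] Comp_assoc[OF xy(2) assms(2,3)] by simp
  then show "x = y"
    using monoD[OF assms(1)] xy(1,2) Comp_in_Hom[OF assms(2,3)] by (simp add: Hom_def)
qed

lemma mono_Ide: "X \<in> Obj C \<Longrightarrow> is_mono C (Ide C X)"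
  by (rule is_monoI[OF Ide_in_Hom]) (simp_all add: Ide_Comp)

lemma epi_Ide: "X \<in> Obj C \<Longrightarrow> is_epi C (Ide C X)"
  by (rule is_epiI[OF Ide_in_Hom]) (simp_all add: Comp_Ide)

end

section \<open>Zero maps and differences of parallel arrows\<close>

definition hom_group :: "('o, 'm, 'z) abcat_scheme \<Rightarrow> 'o \<Rightarrow> 'o \<Rightarrow> 'm monoid" where
  "hom_group C X Y = \<lparr>carrier = Hom C X Y, monoid.mult = Plus C, one = Zero C X Y\<rparr>"

text \<open>The record carries no negation, so the inverse is taken in the hom group, whose source
  and target are read off the second argument.\<close>

definition Minus :: "('o, 'm, 'z) abcat_scheme \<Rightarrow> 'm \<Rightarrow> 'm \<Rightarrow> 'm"  (infixl "\<ominus>\<^sub>a\<index>" 65) where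
  "Minus C f g = Plus C f (m_inv (hom_group C (Dom C g) (Cod C g)) g)"

context preadditive_category
begin

lemma comm_group_hom_group: "\<lbrakk>X \<in> Obj C; Y \<in> Obj C\<rbrakk> \<Longrightarrow> comm_group (hom_group C X Y)"
  using Hom_comm_group by (simp add: hom_group_def)

lemma Zero_in_Hom:
  assumes "X \<in> Obj C" "Y \<in> Obj C"
  shows "Zero C X Y \<in> Hom C X Y"
proof -
  interpret comm_group "hom_group C X Y" using comm_group_hom_group assms by blast
  show ?thesis using one_closed by (simp add: hom_group_def)
qed

lemma Zero_Arr: "\<lbrakk>X \<in> Obj C; Y \<in> Obj C\<rbrakk> \<Longrightarrow> Zero C X Y \<in> Arr C"
  and Dom_Zero: "\<lbrakk>X \<in> Obj C; Y \<in> Obj C\<rbrakk> \<Longrightarrow> Dom C (Zero C X Y) = X"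
  and Cod_Zero: "\<lbrakk>X \<in> Obj C; Y \<in> Obj C\<rbrakk> \<Longrightarrow> Cod C (Zero C X Y) = Y"
  using Zero_in_Hom[of X Y] by (auto simp: Hom_def)

lemma Plus_in_Hom:
  assumes "f \<in> Hom C X Y" "g \<in> Hom C X Y"
  shows "f \<oplus>\<^sub>a g \<in> Hom C X Y"
proof -
  interpret comm_group "hom_group C X Y" using comm_group_hom_group Hom_Obj[OF assms(1)] by blast
  show ?thesis using m_closed[of f g] assms by (simp add: hom_group_def)
qed

lemma Plus_Zero:
  assumes "f \<in> Hom C X Y"
  shows "f \<oplus>\<^sub>a Zero C X Y = f" "Zero C X Y \<oplus>\<^sub>a f = f"
proof -
  interpret comm_group "hom_group C X Y" using comm_group_hom_group Hom_Obj[OF assms(1)] by blast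
  show "f \<oplus>\<^sub>a Zero C X Y = f" "Zero C X Y \<oplus>\<^sub>a f = f"
    using r_one[of f] l_one[of f] assms by (simp_all add: hom_group_def)
qed

text \<open>A group has a single idempotent. Composites with zero are idempotent by bilinearity, and
  this is how they are recognised as zero.\<close>

lemma Plus_idem_Zero:
  assumes "f \<in> Hom C X Y" "f \<oplus>\<^sub>a f = f"
  shows "f = Zero C X Y"
proof -
  interpret comm_group "hom_group C X Y" using comm_group_hom_group Hom_Obj[OF assms(1)] by blast
  show ?thesis using l_cancel_one[of f f] assms by (simp add: hom_group_def)
qed

lemma Zero_Comp:
  assumes "f \<in> Hom C X Y" "Z \<in> Obj C"
  shows "Zero C Y Z \<cdot> f = Zero C X Z"
proof (rule Plus_idem_Zero)
  have Y: "Y \<in> Obj C" using Hom_Obj[OF assms(1)] by simp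
  note z = Zero_in_Hom[OF Y assms(2)]
  show "Zero C Y Z \<cdot> f \<in> Hom C X Z" using Comp_in_Hom[OF assms(1) z] .
  show "Zero C Y Z \<cdot> f \<oplus>\<^sub>a Zero C Y Z \<cdot> f = Zero C Y Z \<cdot> f"
    using Comp_Plus[OF assms(1) z z] Plus_Zero(1)[OF z] by simp
qed

lemma Comp_Zero:
  assumes "f \<in> Hom C X Y" "Z \<in> Obj C"
  shows "f \<cdot> Zero C Z X = Zero C Z Y"
proof (rule Plus_idem_Zero)
  have X: "X \<in> Obj C" using Hom_Obj[OF assms(1)] by simp
  note z = Zero_in_Hom[OF assms(2) X]
  show "f \<cdot> Zero C Z X \<in> Hom C Z Y" using Comp_in_Hom[OF z assms(1)] .
  show "f \<cdot> Zero C Z X \<oplus>\<^sub>a f \<cdot> Zero C Z X = f \<cdot> Zero C Z X"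
    using Plus_Comp[OF z z assms(1)] Plus_Zero(1)[OF z] by simp
qed

lemma Zero_Comp_Arr: "\<lbrakk>f \<in> Arr C; Cod C f = Y; Z \<in> Obj C\<rbrakk> \<Longrightarrow> Zero C Y Z \<cdot> f = Zero C (Dom C f) Z"
  and Comp_Zero_Arr: "\<lbrakk>f \<in> Arr C; Dom C f = Y; Z \<in> Obj C\<rbrakk> \<Longrightarrow> f \<cdot> Zero C Z Y = Zero C Z (Cod C f)"
  using Zero_Comp[of f "Dom C f" "Cod C f"] Comp_Zero[of f "Dom C f" "Cod C f"]
  by (auto simp: Hom_def)

lemmas zero_simps = Zero_Arr Dom_Zero Cod_Zero Zero_Comp_Arr Comp_Zero_Arr

lemma Minus_in_Hom:
  assumes "f \<in> Hom C X Y" "g \<in> Hom C X Y"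
  shows "f \<ominus>\<^sub>a g \<in> Hom C X Y"
proof -
  interpret comm_group "hom_group C X Y" using comm_group_hom_group Hom_Obj[OF assms(1)] by blast
  have "inv\<^bsub>hom_group C X Y\<^esub> g \<in> Hom C X Y"
    using inv_closed[of g] assms by (simp add: hom_group_def)
  then show ?thesis using Plus_in_Hom assms by (simp add: Minus_def Hom_def)
qed

lemma Minus_eq_iff:
  assumes "f \<in> Hom C X Y" "g \<in> Hom C X Y" "h \<in> Hom C X Y"
  shows "f \<ominus>\<^sub>a g = h \<longleftrightarrow> f = h \<oplus>\<^sub>a g"
proof -
  interpret comm_group "hom_group C X Y" using comm_group_hom_group Hom_Obj[OF assms(1)] by blast
  have DC: "Dom C g = X" "Cod C g = Y" using assms by (simp_all add: Hom_def)
  have "h = f \<otimes>\<^bsub>hom_group C X Y\<^esub> inv\<^bsub>hom_group C X Y\<^esub> g \<longleftrightarrow> f = h \<otimes>\<^bsub>hom_group C X Y\<^esub> g"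
    using inv_solve_right[of h f g] assms by (auto simp: hom_group_def)
  then show ?thesis by (auto simp: Minus_def DC hom_group_def)
qed

lemma Minus_Plus_cancel:
  assumes "f \<in> Hom C X Y" "g \<in> Hom C X Y"
  shows "(f \<ominus>\<^sub>a g) \<oplus>\<^sub>a g = f"
  using Minus_eq_iff[OF assms Minus_in_Hom[OF assms]] by simp

lemma Minus_self: "f \<in> Hom C X Y \<Longrightarrow> f \<ominus>\<^sub>a f = Zero C X Y"
  using Minus_eq_iff Plus_Zero Zero_in_Hom Hom_Obj by metis

lemma Minus_Zero: "f \<in> Hom C X Y \<Longrightarrow> f \<ominus>\<^sub>a Zero C X Y = f"
  using Minus_eq_iff Plus_Zero Zero_in_Hom Hom_Obj by metis

lemma Minus_eq_Zero_iff:
  assumes "f \<in> Hom C X Y" "g \<in> Hom C X Y"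
  shows "f \<ominus>\<^sub>a g = Zero C X Y \<longleftrightarrow> f = g"
  using Minus_eq_iff Plus_Zero Zero_in_Hom Hom_Obj assms by metis

lemma Minus_Comp:
  assumes "f \<in> Hom C X Y" "g \<in> Hom C Y Z" "h \<in> Hom C Y Z"
  shows "(g \<ominus>\<^sub>a h) \<cdot> f = (g \<cdot> f) \<ominus>\<^sub>a (h \<cdot> f)"
proof -
  have gh: "g \<ominus>\<^sub>a h \<in> Hom C Y Z" using Minus_in_Hom assms by blast
  have "g \<cdot> f = ((g \<ominus>\<^sub>a h) \<cdot> f) \<oplus>\<^sub>a (h \<cdot> f)"
    using Comp_Plus[OF assms(1) gh assms(3)] Minus_Plus_cancel[OF assms(2,3)] by simp
  then show ?thesis
    using Minus_eq_iff[of "g \<cdot> f" X Z "h \<cdot> f" "(g \<ominus>\<^sub>a h) \<cdot> f"] Comp_in_Hom assms gh by metis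
qed

lemma Comp_Minus:
  assumes "f \<in> Hom C X Y" "g \<in> Hom C X Y" "h \<in> Hom C Y Z"
  shows "h \<cdot> (f \<ominus>\<^sub>a g) = (h \<cdot> f) \<ominus>\<^sub>a (h \<cdot> g)"
proof -
  have gh: "f \<ominus>\<^sub>a g \<in> Hom C X Y" using Minus_in_Hom assms by blast
  have "h \<cdot> f = (h \<cdot> (f \<ominus>\<^sub>a g)) \<oplus>\<^sub>a (h \<cdot> g)"
    using Plus_Comp[OF gh assms(2,3)] Minus_Plus_cancel[OF assms(1,2)] by simp
  then show ?thesis
    using Minus_eq_iff[of "h \<cdot> f" X Z "h \<cdot> g" "h \<cdot> (f \<ominus>\<^sub>a g)"] Comp_in_Hom assms gh by metis
qed

lemma Plus_commute:
  assumes "f \<in> Hom C X Y" "g \<in> Hom C X Y"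
  shows "f \<oplus>\<^sub>a g = g \<oplus>\<^sub>a f"
proof -
  interpret comm_group "hom_group C X Y" using comm_group_hom_group Hom_Obj[OF assms(1)] by blast
  show ?thesis using m_comm[of f g] assms by (simp add: hom_group_def)
qed

lemma Minus_Minus_cancel:
  assumes "f \<in> Hom C X Y" "g \<in> Hom C X Y"
  shows "f \<ominus>\<^sub>a (f \<ominus>\<^sub>a g) = g"
  using Minus_eq_iff[of f X Y "f \<ominus>\<^sub>a g" g] Minus_Plus_cancel[OF assms] Plus_commute
    Minus_in_Hom assms by metis

lemma monoI:
  assumes "f \<in> Hom C X Y"
    and "\<And>W x. x \<in> Hom C W X \<Longrightarrow> f \<cdot> x = Zero C W Y \<Longrightarrow> x = Zero C W X"
  shows "is_mono C f"
proof (rule is_monoI[OF assms(1)])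
  fix W x y assume x: "x \<in> Hom C W X" and y: "y \<in> Hom C W X" and eq: "f \<cdot> x = f \<cdot> y"
  have "f \<cdot> (x \<ominus>\<^sub>a y) = Zero C W Y"
    using Comp_Minus[OF x y assms(1)] eq Minus_self[OF Comp_in_Hom[OF y assms(1)]] by simp
  then have "x \<ominus>\<^sub>a y = Zero C W X" using assms(2)[OF Minus_in_Hom[OF x y]] by simp
  then show "x = y" using Minus_eq_Zero_iff[OF x y] by simp
qed

lemma epiI:
  assumes "f \<in> Hom C X Y"
    and "\<And>W x. x \<in> Hom C Y W \<Longrightarrow> x \<cdot> f = Zero C X W \<Longrightarrow> x = Zero C Y W"
  shows "is_epi C f"
proof (rule is_epiI[OF assms(1)])
  fix W x y assume x: "x \<in> Hom C Y W" and y: "y \<in> Hom C Y W" and eq: "x \<cdot> f = y \<cdot> f"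
  have "(x \<ominus>\<^sub>a y) \<cdot> f = Zero C X W"
    using Minus_Comp[OF assms(1) x y] eq Minus_self[OF Comp_in_Hom[OF assms(1) y]] by simp
  then have "x \<ominus>\<^sub>a y = Zero C Y W" using assms(2)[OF Minus_in_Hom[OF x y]] by simp
  then show "x = y" using Minus_eq_Zero_iff[OF x y] by simp
qed

lemma mono_Zero:
  assumes "is_mono C f" "f \<in> Hom C X Y" "x \<in> Hom C W X" "f \<cdot> x = Zero C W Y"
  shows "x = Zero C W X"
  using monoD[OF assms(1), of x W "Zero C W X"] assms Zero_in_Hom[of W X]
    Hom_Obj[OF assms(3)] Comp_Zero[OF assms(2)] by (simp add: Hom_def)

lemma epi_Zero:
  assumes "is_epi C f" "f \<in> Hom C X Y" "x \<in> Hom C Y W" "x \<cdot> f = Zero C X W"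
  shows "x = Zero C Y W"
  using epiD[OF assms(1), of x W "Zero C Y W"] assms Zero_in_Hom[of Y W]
    Hom_Obj[OF assms(3)] Zero_Comp[OF assms(2)] by (simp add: Hom_def)

lemma is_kernelI:
  assumes "f \<in> Hom C X Y" "k \<in> Hom C K X" "f \<cdot> k = Zero C K Y" "is_mono C k"
    and "\<And>W h. h \<in> Hom C W X \<Longrightarrow> f \<cdot> h = Zero C W Y \<Longrightarrow> \<exists>u \<in> Hom C W K. k \<cdot> u = h"
  shows "is_kernel C f k"
  unfolding is_kernel_def
proof (intro conjI ballI impI)
  fix h assume h: "h \<in> Arr C" "Cod C h = Dom C f \<and> f \<cdot> h = Zero C (Dom C h) (Cod C f)"
  then obtain u where u: "u \<in> Hom C (Dom C h) K" "k \<cdot> u = h"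
    using assms(5)[of h "Dom C h"] assms(1) by (auto simp: Hom_def)
  show "\<exists>!u. u \<in> Hom C (Dom C h) (Dom C k) \<and> k \<cdot> u = h"
  proof (rule ex1I)
    have "Dom C k = K" using assms(2) by (simp add: Hom_def)
    then show "u \<in> Hom C (Dom C h) (Dom C k) \<and> k \<cdot> u = h" using u by blast
    fix v assume "v \<in> Hom C (Dom C h) (Dom C k) \<and> k \<cdot> v = h"
    then show "v = u" using monoD[OF assms(4), of v "Dom C h" u] u assms(2) by (simp add: Hom_def)
  qed
qed (use assms in \<open>auto simp: Hom_def\<close>)

lemma is_cokernelI:
  assumes "f \<in> Hom C X Y" "q \<in> Hom C Y Q" "q \<cdot> f = Zero C X Q" "is_epi C q"
    and "\<And>W h. h \<in> Hom C Y W \<Longrightarrow> h \<cdot> f = Zero C X W \<Longrightarrow> \<exists>u \<in> Hom C Q W. u \<cdot> q = h"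
  shows "is_cokernel C f q"
  unfolding is_cokernel_def
proof (intro conjI ballI impI)
  fix h assume h: "h \<in> Arr C" "Dom C h = Cod C f \<and> h \<cdot> f = Zero C (Dom C f) (Cod C h)"
  then obtain u where u: "u \<in> Hom C Q (Cod C h)" "u \<cdot> q = h"
    using assms(5)[of h "Cod C h"] assms(1) by (auto simp: Hom_def)
  show "\<exists>!u. u \<in> Hom C (Cod C q) (Cod C h) \<and> u \<cdot> q = h"
  proof (rule ex1I)
    have "Cod C q = Q" using assms(2) by (simp add: Hom_def)
    then show "u \<in> Hom C (Cod C q) (Cod C h) \<and> u \<cdot> q = h" using u by blast
    fix v assume "v \<in> Hom C (Cod C q) (Cod C h) \<and> v \<cdot> q = h"
    then show "v = u" using epiD[OF assms(4), of v "Cod C h" u] u assms(2) by (simp add: Hom_def)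
  qed
qed (use assms in \<open>auto simp: Hom_def\<close>)

text \<open>The universal property with \<open>Dom\<close> and \<open>Cod\<close> replaced by object
  variables, so that it chains with facts about \<open>Hom\<close>.\<close>

lemma kernel_factor_ex1:
  assumes "is_kernel C f k" "f \<in> Hom C X Y" "k \<in> Hom C K X" "h \<in> Hom C W X" "f \<cdot> h = Zero C W Y"
  shows "\<exists>!u. u \<in> Hom C W K \<and> k \<cdot> u = h"
proof -
  have eq: "Dom C f = X" "Cod C f = Y" "Dom C k = K" "Dom C h = W" "Cod C h = X" and h: "h \<in> Arr C"
    using assms(2-4) by (simp_all add: Hom_def)
  from assms(1) have "\<forall>h\<in>Arr C. Cod C h = Dom C f \<and> f \<cdot> h = Zero C (Dom C h) (Cod C f) \<longrightarrow>
        (\<exists>!u. u \<in> Hom C (Dom C h) (Dom C k) \<and> k \<cdot> u = h)"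
    unfolding is_kernel_def by (elim conjE)
  from this[unfolded eq, THEN bspec, OF h, unfolded eq, THEN mp, OF conjI, OF refl assms(5)]
  show ?thesis .
qed

lemma cokernel_factor_ex1:
  assumes "is_cokernel C f q" "f \<in> Hom C X Y" "q \<in> Hom C Y Q" "h \<in> Hom C Y W" "h \<cdot> f = Zero C X W"
  shows "\<exists>!u. u \<in> Hom C Q W \<and> u \<cdot> q = h"
proof -
  have eq: "Dom C f = X" "Cod C f = Y" "Cod C q = Q" "Dom C h = Y" "Cod C h = W" and h: "h \<in> Arr C"
    using assms(2-4) by (simp_all add: Hom_def)
  from assms(1) have "\<forall>h\<in>Arr C. Dom C h = Cod C f \<and> h \<cdot> f = Zero C (Dom C f) (Cod C h) \<longrightarrow>
        (\<exists>!u. u \<in> Hom C (Cod C q) (Cod C h) \<and> u \<cdot> q = h)"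
    unfolding is_cokernel_def by (elim conjE)
  from this[unfolded eq, THEN bspec, OF h, unfolded eq, THEN mp, OF conjI, OF refl assms(5)]
  show ?thesis .
qed

lemma kernel_factor:
  assumes "is_kernel C f k" "f \<in> Hom C X Y" "k \<in> Hom C K X" "h \<in> Hom C W X" "f \<cdot> h = Zero C W Y"
  obtains u where "u \<in> Hom C W K" "k \<cdot> u = h"
  using kernel_factor_ex1[OF assms] by blast

lemma cokernel_factor:
  assumes "is_cokernel C f q" "f \<in> Hom C X Y" "q \<in> Hom C Y Q" "h \<in> Hom C Y W" "h \<cdot> f = Zero C X W"
  obtains u where "u \<in> Hom C Q W" "u \<cdot> q = h"
  using cokernel_factor_ex1[OF assms] by blast

lemma kernelE:
  assumes "is_kernel C f k" "f \<in> Hom C X Y"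
  obtains K where "k \<in> Hom C K X" "f \<cdot> k = Zero C K Y"
    "\<And>W h. h \<in> Hom C W X \<Longrightarrow> f \<cdot> h = Zero C W Y \<Longrightarrow> \<exists>u \<in> Hom C W K. k \<cdot> u = h"
proof
  show k: "k \<in> Hom C (Dom C k) X" "f \<cdot> k = Zero C (Dom C k) Y"
    using assms(2) assms(1)[unfolded is_kernel_def] by (simp_all add: Hom_def)
  fix W h assume "h \<in> Hom C W X" "f \<cdot> h = Zero C W Y"
  from kernel_factor[OF assms k(1) this]
  show "\<exists>u \<in> Hom C W (Dom C k). k \<cdot> u = h" by blast
qed

lemma cokernelE:
  assumes "is_cokernel C f q" "f \<in> Hom C X Y"
  obtains Q where "q \<in> Hom C Y Q" "q \<cdot> f = Zero C X Q"
    "\<And>W h. h \<in> Hom C Y W \<Longrightarrow> h \<cdot> f = Zero C X W \<Longrightarrow> \<exists>u \<in> Hom C Q W. u \<cdot> q = h"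
proof
  show q: "q \<in> Hom C Y (Cod C q)" "q \<cdot> f = Zero C X (Cod C q)"
    using assms(2) assms(1)[unfolded is_cokernel_def] by (simp_all add: Hom_def)
  fix W h assume "h \<in> Hom C Y W" "h \<cdot> f = Zero C X W"
  from cokernel_factor[OF assms q(1) this]
  show "\<exists>u \<in> Hom C (Cod C q) W. u \<cdot> q = h" by blast
qed

text \<open>If k x = 0, then x and 0 both factor the zero map through k, and the factorisation is
  unique.\<close>

lemma kernel_mono:
  assumes "is_kernel C f k"
  shows "is_mono C k"
proof -
  have "f \<in> Arr C" using assms unfolding is_kernel_def by (elim conjE)
  then have f: "f \<in> Hom C (Dom C f) (Cod C f)" by (simp add: Hom_def)
  obtain K where k: "k \<in> Hom C K (Dom C f)" by (rule kernelE[OF assms f])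
  show ?thesis
  proof (rule monoI[OF k])
    fix W x assume x: "x \<in> Hom C W K" "k \<cdot> x = Zero C W (Dom C f)"
    have W: "W \<in> Obj C" "K \<in> Obj C" "Dom C f \<in> Obj C" using Hom_Obj[OF x(1)] Hom_Obj[OF k] by auto
    have "\<exists>!u. u \<in> Hom C W K \<and> k \<cdot> u = Zero C W (Dom C f)"
      by (rule kernel_factor_ex1[OF assms f k Zero_in_Hom[OF W(1,3)] Comp_Zero[OF f W(1)]])
    then show "x = Zero C W K" using x Zero_in_Hom[OF W(1,2)] Comp_Zero[OF k W(1)] by metis
  qed
qed

lemma cokernel_epi:
  assumes "is_cokernel C f q"
  shows "is_epi C q"
proof -
  have "f \<in> Arr C" using assms unfolding is_cokernel_def by (elim conjE)
  then have f: "f \<in> Hom C (Dom C f) (Cod C f)" by (simp add: Hom_def)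
  obtain Q where q: "q \<in> Hom C (Cod C f) Q" by (rule cokernelE[OF assms f])
  show ?thesis
  proof (rule epiI[OF q])
    fix W x assume x: "x \<in> Hom C Q W" "x \<cdot> q = Zero C (Cod C f) W"
    have W: "W \<in> Obj C" "Q \<in> Obj C" "Cod C f \<in> Obj C" using Hom_Obj[OF x(1)] Hom_Obj[OF q] by auto
    have "\<exists>!u. u \<in> Hom C Q W \<and> u \<cdot> q = Zero C (Cod C f) W"
      by (rule cokernel_factor_ex1[OF assms f q Zero_in_Hom[OF W(3,1)] Zero_Comp[OF f W(1)]])
    then show "x = Zero C Q W" using x Zero_in_Hom[OF W(2,1)] Zero_Comp[OF q W(1)] by metis
  qed
qed

lemma Plus_assoc:
  assumes "f \<in> Hom C X Y" "g \<in> Hom C X Y" "h \<in> Hom C X Y"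
  shows "(f \<oplus>\<^sub>a g) \<oplus>\<^sub>a h = f \<oplus>\<^sub>a (g \<oplus>\<^sub>a h)"
proof -
  interpret comm_group "hom_group C X Y" using comm_group_hom_group Hom_Obj[OF assms(1)] by blast
  show ?thesis using m_assoc[of f g h] assms by (simp add: hom_group_def)
qed

lemma is_kernel_Comp: "\<lbrakk>is_kernel C f k; f \<in> Hom C X Y; k \<in> Hom C K X\<rbrakk> \<Longrightarrow> f \<cdot> k = Zero C K Y"
  unfolding is_kernel_def by (elim conjE) (simp add: Hom_def)

lemma is_cokernel_Comp: "\<lbrakk>is_cokernel C f q; f \<in> Hom C X Y; q \<in> Hom C Y Q\<rbrakk> \<Longrightarrow> q \<cdot> f = Zero C X Q"
  unfolding is_cokernel_def by (elim conjE) (simp add: Hom_def)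

lemma zero_object_Hom:
  assumes "is_zero_object C Z" "X \<in> Obj C"
  shows "f \<in> Hom C Z X \<longleftrightarrow> f = Zero C Z X" "f \<in> Hom C X Z \<longleftrightarrow> f = Zero C X Z"
proof -
  have Z: "Z \<in> Obj C" using assms by (simp add: is_zero_object_def is_initial_def)
  have "\<exists>!f. f \<in> Hom C Z X" "\<exists>!f. f \<in> Hom C X Z"
    using assms by (simp_all add: is_zero_object_def is_initial_def is_terminal_def)
  then show "f \<in> Hom C Z X \<longleftrightarrow> f = Zero C Z X" "f \<in> Hom C X Z \<longleftrightarrow> f = Zero C X Z"
    using Zero_in_Hom[OF Z assms(2)] Zero_in_Hom[OF assms(2) Z] by blast+
qed

lemma zero_objectI:
  assumes "Z \<in> Obj C" "Ide C Z = Zero C Z Z"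
  shows "is_zero_object C Z"
proof -
  have "f = Zero C Z X" if "f \<in> Hom C Z X" for f X
    using Comp_Ide[OF that] Comp_Zero[OF that assms(1)] assms by simp
  moreover have "f = Zero C X Z" if "f \<in> Hom C X Z" for f X
    using Ide_Comp[OF that] Zero_Comp[OF that assms(1)] assms by simp
  ultimately show ?thesis
    unfolding is_zero_object_def is_initial_def is_terminal_def
    using Zero_in_Hom assms by blast
qed

text \<open>An initial object has one endomorphism, so its identity is zero. This links
  \<open>cofibrants\<close>, which speaks of initial objects, with the arguments on zero
  objects.\<close>

lemma initial_is_zero_object:
  assumes "is_initial C Z"
  shows "is_zero_object C Z"
proof (rule zero_objectI)
  show Z: "Z \<in> Obj C" using assms by (simp add: is_initial_def)
  then have "\<exists>!f. f \<in> Hom C Z Z" using assms by (simp add: is_initial_def)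
  then show "Ide C Z = Zero C Z Z" using Ide_in_Hom[OF Z] Zero_in_Hom[OF Z Z] by blast
qed

lemma zero_object_mono:
  assumes "is_zero_object C Z" "is_mono C f" "f \<in> Hom C X Z"
  shows "is_zero_object C X"
proof (rule zero_objectI)
  show X: "X \<in> Obj C" using Hom_Obj[OF assms(3)] by simp
  have "f \<cdot> Ide C X = Zero C X Z" using assms(3) Comp_Ide[OF assms(3)] zero_object_Hom(2)[OF assms(1) X] by metis
  then show "Ide C X = Zero C X X" using mono_Zero[OF assms(2,3) Ide_in_Hom[OF X]] by simp
qed

lemma zero_object_epi:
  assumes "is_zero_object C Z" "is_epi C f" "f \<in> Hom C Z X"
  shows "is_zero_object C X"
proof (rule zero_objectI)
  show X: "X \<in> Obj C" using Hom_Obj[OF assms(3)] by simp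
  have "Ide C X \<cdot> f = Zero C Z X" using assms(3) Ide_Comp[OF assms(3)] zero_object_Hom(1)[OF assms(1) X] by metis
  then show "Ide C X = Zero C X X" using epi_Zero[OF assms(2,3) Ide_in_Hom[OF X]] by simp
qed

end

section \<open>Normality, pullbacks of epimorphisms and pushouts of monomorphisms\<close>

context abelian_category
begin

text \<open>The monomorphism f is the kernel of some g, and g factors through the cokernel q. Hence
  q h = 0 forces g h = 0, and h factors through f.\<close>

lemma mono_kernel_of_cokernel:
  assumes "is_mono C f" "is_cokernel C f q"
  shows "is_kernel C q f"
proof -
  let ?A = "Dom C f" and ?B = "Cod C f"
  have f: "f \<in> Hom C ?A ?B" using assms(1) by (simp add: is_mono_def Hom_def)
  obtain Q where q: "q \<in> Hom C ?B Q" "q \<cdot> f = Zero C ?A Q"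
    and qu: "\<And>W h. h \<in> Hom C ?B W \<Longrightarrow> h \<cdot> f = Zero C ?A W \<Longrightarrow> \<exists>u \<in> Hom C Q W. u \<cdot> q = h"
    by (rule cokernelE[OF assms(2) f]) blast
  obtain g where g: "is_kernel C g f" using mono_is_kernel assms by blast
  let ?D = "Cod C g"
  have gh: "g \<in> Hom C ?B ?D" and gf: "g \<cdot> f = Zero C ?A ?D"
    using g unfolding is_kernel_def by (elim conjE, simp add: Hom_def)+
  obtain g' where g': "g' \<in> Hom C Q ?D" "g' \<cdot> q = g" using qu[OF gh gf] by blast
  show ?thesis
  proof (rule is_kernelI[OF q(1) f q(2) assms(1)])
    fix W h assume h: "h \<in> Hom C W ?B" "q \<cdot> h = Zero C W Q"
    have "g \<cdot> h = g' \<cdot> (q \<cdot> h)" using Comp_assoc[OF h(1) q(1) g'(1)] g'(2) by simp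
    also have "\<dots> = Zero C W ?D" using h Comp_Zero[OF g'(1)] Hom_Obj[OF h(1)] by simp
    finally show "\<exists>u\<in>Hom C W ?A. f \<cdot> u = h"
      by (rule kernel_factor[OF g gh f h(1)]) blast
  qed
qed

lemma epi_cokernel_of_kernel:
  assumes "is_epi C f" "is_kernel C f k"
  shows "is_cokernel C k f"
proof -
  let ?A = "Dom C f" and ?B = "Cod C f"
  have f: "f \<in> Hom C ?A ?B" using assms(1) by (simp add: is_epi_def Hom_def)
  obtain K where k: "k \<in> Hom C K ?A" "f \<cdot> k = Zero C K ?B"
    and ku: "\<And>W h. h \<in> Hom C W ?A \<Longrightarrow> f \<cdot> h = Zero C W ?B \<Longrightarrow> \<exists>u \<in> Hom C W K. k \<cdot> u = h"
    by (rule kernelE[OF assms(2) f]) blast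
  obtain g where g: "is_cokernel C g f" using epi_is_cokernel assms by blast
  let ?D = "Dom C g"
  have gh: "g \<in> Hom C ?D ?A" and gf: "f \<cdot> g = Zero C ?D ?B"
    using g unfolding is_cokernel_def by (elim conjE, simp add: Hom_def)+
  obtain g' where g': "g' \<in> Hom C ?D K" "k \<cdot> g' = g" using ku[OF gh gf] by blast
  show ?thesis
  proof (rule is_cokernelI[OF k(1) f k(2) assms(1)])
    fix W h assume h: "h \<in> Hom C ?A W" "h \<cdot> k = Zero C K W"
    have "h \<cdot> g = (h \<cdot> k) \<cdot> g'" using Comp_assoc[OF g'(1) k(1) h(1)] g'(2) by simp
    also have "\<dots> = Zero C ?D W" using h Zero_Comp[OF g'(1)] Hom_Obj[OF h(1)] by simp
    finally show "\<exists>u\<in>Hom C ?B W. u \<cdot> f = h"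
      by (rule cokernel_factor[OF g gh f h(1)]) blast
  qed
qed

lemma short_exact_of_epi:
  assumes "is_epi C f" "is_kernel C f k"
  shows "short_exact C k f"
  using assms epi_cokernel_of_kernel by (simp add: short_exact_def)

text \<open>The pullback is the kernel k of m = p \<rho> - f \<pi> on the biproduct. As m j = p is
  epic, m is the cokernel of k. If x kills \<pi> k, then x \<pi> = y m, and restricting along j
  gives y p = 0. Hence y = 0, and then x = 0.\<close>

lemma pullback_of_epi:
  assumes f: "f \<in> Hom C A B" and p: "p \<in> Hom C Q B" and "is_epi C p"
  obtains K r s where "r \<in> Hom C K Q" "s \<in> Hom C K A" "f \<cdot> s = p \<cdot> r" "is_epi C s"
proof -
  have obj: "A \<in> Obj C" "B \<in> Obj C" "Q \<in> Obj C" using Hom_Obj[OF f] Hom_Obj[OF p] by auto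
  obtain P i j \<pi> \<rho> where "is_biproduct C A Q P i j \<pi> \<rho>" using ex_biproduct obj by metis
  then have i: "i \<in> Hom C A P" and j: "j \<in> Hom C Q P" and \<pi>: "\<pi> \<in> Hom C P A" and \<rho>: "\<rho> \<in> Hom C P Q"
    and \<pi>i: "\<pi> \<cdot> i = Ide C A" and \<rho>j: "\<rho> \<cdot> j = Ide C Q" and \<pi>j: "\<pi> \<cdot> j = Zero C Q A"
    by (auto simp: is_biproduct_def)
  define m where "m = (p \<cdot> \<rho>) \<ominus>\<^sub>a (f \<cdot> \<pi>)"
  have p\<rho>: "p \<cdot> \<rho> \<in> Hom C P B" and f\<pi>: "f \<cdot> \<pi> \<in> Hom C P B"
    using Comp_in_Hom[OF \<rho> p] Comp_in_Hom[OF \<pi> f] by auto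
  have m: "m \<in> Hom C P B" unfolding m_def using Minus_in_Hom[OF p\<rho> f\<pi>] .
  have "(f \<cdot> \<pi>) \<cdot> j = Zero C Q B" using Comp_assoc[OF j \<pi> f] Comp_Zero[OF f obj(3)] \<pi>j by simp
  moreover have "(p \<cdot> \<rho>) \<cdot> j = p" using Comp_assoc[OF j \<rho> p] \<rho>j Comp_Ide[OF p] by simp
  ultimately have mj: "m \<cdot> j = p"
    using Minus_Comp[OF j p\<rho> f\<pi>] Minus_Zero[OF p] by (simp add: m_def)
  have mepi: "is_epi C m" by (rule epi_Comp_left[OF _ j m]) (simp add: mj assms)
  obtain k where k: "is_kernel C m k" using ex_kernel m by (auto simp: Hom_def)
  obtain K where kh: "k \<in> Hom C K P" "m \<cdot> k = Zero C K B" by (rule kernelE[OF k m])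
  have cok: "is_cokernel C k m" using epi_cokernel_of_kernel[OF mepi k] .
  note r = Comp_in_Hom[OF kh(1) \<rho>] and s = Comp_in_Hom[OF kh(1) \<pi>]
  have "(p \<cdot> \<rho>) \<cdot> k \<ominus>\<^sub>a (f \<cdot> \<pi>) \<cdot> k = Zero C K B"
    using kh Minus_Comp[OF kh(1) p\<rho> f\<pi>] by (simp add: m_def)
  then have "(p \<cdot> \<rho>) \<cdot> k = (f \<cdot> \<pi>) \<cdot> k"
    using Minus_eq_Zero_iff Comp_in_Hom[OF kh(1)] p\<rho> f\<pi> by metis
  then have comm: "f \<cdot> (\<pi> \<cdot> k) = p \<cdot> (\<rho> \<cdot> k)"
    using Comp_assoc[OF kh(1) \<rho> p] Comp_assoc[OF kh(1) \<pi> f] by simp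
  have "is_epi C (\<pi> \<cdot> k)"
  proof (rule epiI[OF s])
    fix W x assume x: "x \<in> Hom C A W" "x \<cdot> \<pi> \<cdot> k = Zero C K W"
    note x\<pi> = Comp_in_Hom[OF \<pi> x(1)]
    have W: "W \<in> Obj C" using Hom_Obj[OF x(1)] by simp
    have "(x \<cdot> \<pi>) \<cdot> k = Zero C K W" using x(2) Comp_assoc[OF kh(1) \<pi> x(1)] by simp
    then obtain y where y: "y \<in> Hom C B W" "y \<cdot> m = x \<cdot> \<pi>"
      by (rule cokernel_factor[OF cok kh(1) m x\<pi>])
    have "y \<cdot> p = (x \<cdot> \<pi>) \<cdot> j" using Comp_assoc[OF j m y(1)] y(2) mj by simp
    also have "\<dots> = Zero C Q W" using Comp_assoc[OF j \<pi> x(1)] \<pi>j Comp_Zero[OF x(1) obj(3)] by simp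
    finally have "y = Zero C B W" using epi_Zero[OF assms(3) p y(1)] by simp
    then have x\<pi>0: "x \<cdot> \<pi> = Zero C P W" using y(2) Zero_Comp[OF m W] by simp
    have "x = (x \<cdot> \<pi>) \<cdot> i" using Comp_assoc[OF i \<pi> x(1)] \<pi>i Comp_Ide[OF x(1)] by simp
    then show "x = Zero C A W" using x\<pi>0 Zero_Comp[OF i W] by simp
  qed
  then show thesis using that[OF r s comm] by simp
qed

text \<open>Dual to \<open>pullback_of_epi\<close>: the pushout is the cokernel of the monomorphism
  \<mu> = j m - i e. It serves to extend e along m after enlarging the target by a
  monomorphism.\<close>

lemma pushout_of_mono:
  assumes m: "m \<in> Hom C A B" and e: "e \<in> Hom C A T" and "is_mono C m"
  obtains T' t e' where "t \<in> Hom C T T'" "e' \<in> Hom C B T'" "e' \<cdot> m = t \<cdot> e" "is_mono C t"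
proof -
  have obj: "A \<in> Obj C" "B \<in> Obj C" "T \<in> Obj C" using Hom_Obj[OF m] Hom_Obj[OF e] by auto
  obtain P i j \<pi> \<rho> where "is_biproduct C T B P i j \<pi> \<rho>" using ex_biproduct obj by metis
  then have i: "i \<in> Hom C T P" and j: "j \<in> Hom C B P" and \<pi>: "\<pi> \<in> Hom C P T" and \<rho>: "\<rho> \<in> Hom C P B"
    and \<pi>i: "\<pi> \<cdot> i = Ide C T" and \<rho>j: "\<rho> \<cdot> j = Ide C B" and \<rho>i: "\<rho> \<cdot> i = Zero C T B"
    by (auto simp: is_biproduct_def)
  define \<mu> where "\<mu> = (j \<cdot> m) \<ominus>\<^sub>a (i \<cdot> e)"
  have jm: "j \<cdot> m \<in> Hom C A P" and ie: "i \<cdot> e \<in> Hom C A P"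
    using Comp_in_Hom[OF m j] Comp_in_Hom[OF e i] by auto
  have \<mu>: "\<mu> \<in> Hom C A P" unfolding \<mu>_def using Minus_in_Hom[OF jm ie] .
  have "\<rho> \<cdot> (i \<cdot> e) = Zero C A B" using Comp_assoc[OF e i \<rho>] Zero_Comp[OF e obj(2)] \<rho>i by simp
  moreover have "\<rho> \<cdot> (j \<cdot> m) = m" using Comp_assoc[OF m j \<rho>] \<rho>j Ide_Comp[OF m] by simp
  ultimately have \<rho>\<mu>: "\<rho> \<cdot> \<mu> = m"
    using Comp_Minus[OF jm ie \<rho>] Minus_Zero[OF m] by (simp add: \<mu>_def)
  have \<mu>mono: "is_mono C \<mu>" by (rule mono_Comp_right[OF _ \<mu> \<rho>]) (simp add: \<rho>\<mu> assms)
  obtain q where q: "is_cokernel C \<mu> q" using ex_cokernel \<mu> by (auto simp: Hom_def)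
  obtain T' where qh: "q \<in> Hom C P T'" "q \<cdot> \<mu> = Zero C A T'" by (rule cokernelE[OF q \<mu>])
  have ker: "is_kernel C q \<mu>" using mono_kernel_of_cokernel[OF \<mu>mono q] .
  note t = Comp_in_Hom[OF i qh(1)] and e' = Comp_in_Hom[OF j qh(1)]
  have "q \<cdot> (j \<cdot> m) \<ominus>\<^sub>a q \<cdot> (i \<cdot> e) = Zero C A T'"
    using qh Comp_Minus[OF jm ie qh(1)] by (simp add: \<mu>_def)
  then have "q \<cdot> (j \<cdot> m) = q \<cdot> (i \<cdot> e)"
    using Minus_eq_Zero_iff Comp_in_Hom[OF _ qh(1)] jm ie by metis
  then have comm: "(q \<cdot> j) \<cdot> m = (q \<cdot> i) \<cdot> e"
    using Comp_assoc[OF m j qh(1)] Comp_assoc[OF e i qh(1)] by simp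
  have "is_mono C (q \<cdot> i)"
  proof (rule monoI[OF t])
    fix W x assume x: "x \<in> Hom C W T" "(q \<cdot> i) \<cdot> x = Zero C W T'"
    note ix = Comp_in_Hom[OF x(1) i]
    have W: "W \<in> Obj C" using Hom_Obj[OF x(1)] by simp
    have "q \<cdot> (i \<cdot> x) = Zero C W T'" using x(2) Comp_assoc[OF x(1) i qh(1)] by simp
    then obtain y where y: "y \<in> Hom C W A" "\<mu> \<cdot> y = i \<cdot> x"
      by (rule kernel_factor[OF ker qh(1) \<mu> ix])
    have "m \<cdot> y = \<rho> \<cdot> (i \<cdot> x)" using Comp_assoc[OF y(1) \<mu> \<rho>] y(2) \<rho>\<mu> by simp
    also have "\<dots> = Zero C W B" using Comp_assoc[OF x(1) i \<rho>] \<rho>i Zero_Comp[OF x(1) obj(2)] by simp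
    finally have "y = Zero C W A" using mono_Zero[OF assms(3) m y(1)] by simp
    then have ix0: "i \<cdot> x = Zero C W P" using y(2) Comp_Zero[OF \<mu> W] by simp
    have "x = \<pi> \<cdot> (i \<cdot> x)" using Comp_assoc[OF x(1) i \<pi>] \<pi>i Ide_Comp[OF x(1)] by simp
    then show "x = Zero C W T" using ix0 Comp_Zero[OF \<pi> W] by simp
  qed
  then show thesis using that[OF t e' comm] by simp
qed

end

section \<open>Complexes over an abelian category\<close>

lemma Ch_simps:
  "Obj (Ch A) = {X. is_complex A X}" "Arr (Ch A) = {f. is_chain_map A f}"
  "Dom (Ch A) = src" "Cod (Ch A) = tgt"
  "Ide (Ch A) X = \<lparr>src = X, tgt = X, cmor = (\<lambda>n. Ide A (cobj X n))\<rparr>"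
  "g \<cdot>\<^bsub>Ch A\<^esub> f = \<lparr>src = src f, tgt = tgt g, cmor = (\<lambda>n. cmor g n \<cdot>\<^bsub>A\<^esub> cmor f n)\<rparr>"
  "f \<oplus>\<^sub>a\<^bsub>Ch A\<^esub> g = \<lparr>src = src f, tgt = tgt f, cmor = (\<lambda>n. cmor f n \<oplus>\<^sub>a\<^bsub>A\<^esub> cmor g n)\<rparr>"
  "Zero (Ch A) X Y = \<lparr>src = X, tgt = Y, cmor = (\<lambda>n. Zero A (cobj X n) (cobj Y n))\<rparr>"
  by (simp_all add: Ch_def)

lemma Hom_Ch_iff: "f \<in> Hom (Ch A) X Y \<longleftrightarrow> is_chain_map A f \<and> src f = X \<and> tgt f = Y"
  by (simp add: Hom_def Ch_simps)

lemma Hom_ChD: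
  assumes "f \<in> Hom (Ch A) X Y"
  shows "cmor f n \<in> Hom A (cobj X n) (cobj Y n)"
    "cmor f (n + 1) \<cdot>\<^bsub>A\<^esub> diff X n = diff Y n \<cdot>\<^bsub>A\<^esub> cmor f n"
    "is_complex A X" "is_complex A Y" "src f = X" "tgt f = Y"
  using assms by (auto simp: Hom_Ch_iff is_chain_map_def)

lemma Hom_ChI:
  assumes "is_complex A X" "is_complex A Y"
    and "\<And>n. c n \<in> Hom A (cobj X n) (cobj Y n)"
    and "\<And>n. c (n + 1) \<cdot>\<^bsub>A\<^esub> diff X n = diff Y n \<cdot>\<^bsub>A\<^esub> c n"
  shows "\<lparr>src = X, tgt = Y, cmor = c\<rparr> \<in> Hom (Ch A) X Y"
  using assms by (simp add: Hom_Ch_iff is_chain_map_def)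

lemma Hom_Ch_eqI:
  assumes "f \<in> Hom (Ch A) X Y" "g \<in> Hom (Ch A) X Y" "\<And>n. cmor f n = cmor g n"
  shows "f = g"
proof -
  have "cmor f = cmor g" using assms(3) by blast
  then show ?thesis using assms(1,2) by (cases f, cases g) (simp add: Hom_Ch_iff)
qed

lemma is_complexD:
  assumes "is_complex A X"
  shows "cobj X n \<in> Obj A" "diff X n \<in> Hom A (cobj X n) (cobj X (n + 1))"
    "diff X (n + 1) \<cdot>\<^bsub>A\<^esub> diff X n = Zero A (cobj X n) (cobj X (n + 1 + 1))"
proof -
  have "n + 1 + 1 = n + 2" by simp
  then show "diff X (n + 1) \<cdot>\<^bsub>A\<^esub> diff X n = Zero A (cobj X n) (cobj X (n + 1 + 1))"
    using assms by (simp only: is_complex_def)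
qed (use assms in \<open>simp_all add: is_complex_def\<close>)

lemma is_complexI:
  assumes "\<And>n. cobj X n \<in> Obj A" "\<And>n. diff X n \<in> Hom A (cobj X n) (cobj X (n + 1))"
    "\<And>n. diff X (n + 1) \<cdot>\<^bsub>A\<^esub> diff X n = Zero A (cobj X n) (cobj X (n + 1 + 1))"
  shows "is_complex A X"
proof -
  have "n + 1 + 1 = n + 2" for n :: int by simp
  then show ?thesis using assms by (simp only: is_complex_def) metis
qed

lemma (in preadditive_category) preadditive_category_Ch: "preadditive_category (Ch C)"
proof -
  have comp: "g \<cdot>\<^bsub>Ch C\<^esub> f \<in> Hom (Ch C) X Z"
    if f: "f \<in> Hom (Ch C) X Y" and g: "g \<in> Hom (Ch C) Y Z" for f g X Y Z
  proof -
    have "cmor g (n + 1) \<cdot> cmor f (n + 1) \<cdot> diff X n = diff Z n \<cdot> cmor g n \<cdot> cmor f n" for n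
      using Comp_assoc[OF Hom_ChD(1)[OF f] is_complexD(2)[OF Hom_ChD(4)[OF f]] Hom_ChD(1)[OF g], of n]
        Comp_assoc[OF Hom_ChD(1)[OF f] Hom_ChD(1)[OF g] is_complexD(2)[OF Hom_ChD(4)[OF g]], of n]
        Hom_ChD(2)[OF f, of n] Hom_ChD(2)[OF g, of n] by simp
    then have "(cmor g (n + 1) \<cdot> cmor f (n + 1)) \<cdot> diff X n = diff Z n \<cdot> (cmor g n \<cdot> cmor f n)" for n
      using Comp_assoc[OF is_complexD(2)[OF Hom_ChD(3)[OF f]] Hom_ChD(1)[OF f] Hom_ChD(1)[OF g], of n]
      by simp
    then show ?thesis
      using Hom_ChI[OF Hom_ChD(3)[OF f] Hom_ChD(4)[OF g], of "\<lambda>n. cmor g n \<cdot> cmor f n"]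
        Comp_in_Hom[OF Hom_ChD(1)[OF f] Hom_ChD(1)[OF g]] Hom_ChD(5)[OF f] Hom_ChD(6)[OF g]
      by (simp add: Ch_simps)
  qed
  have ide: "Ide (Ch C) X \<in> Hom (Ch C) X X" if "X \<in> Obj (Ch C)" for X
  proof -
    have X: "is_complex C X" using that by (simp add: Ch_simps)
    show ?thesis
      using Hom_ChI[OF X X, of "\<lambda>n. Ide C (cobj X n)"] Ide_in_Hom is_complexD[OF X]
        Comp_Ide[OF is_complexD(2)[OF X]] Ide_Comp[OF is_complexD(2)[OF X]]
      by (simp add: Ch_simps)
  qed
  have zero: "Zero (Ch C) X Y \<in> Hom (Ch C) X Y" if X: "is_complex C X" and Y: "is_complex C Y" for X Y
    using Hom_ChI[OF X Y, of "\<lambda>n. Zero C (cobj X n) (cobj Y n)"] Zero_in_Hom is_complexD[OF X] is_complexD[OF Y]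
        Zero_Comp[OF is_complexD(2)[OF X]] Comp_Zero[OF is_complexD(2)[OF Y]]
    by (simp add: Ch_simps)
  have plus: "f \<oplus>\<^sub>a\<^bsub>Ch C\<^esub> g \<in> Hom (Ch C) X Y"
    if f: "f \<in> Hom (Ch C) X Y" and g: "g \<in> Hom (Ch C) X Y" for f g X Y
  proof -
    note X = Hom_ChD(3)[OF f] and Y = Hom_ChD(4)[OF f]
    have "(cmor f (n + 1) \<oplus>\<^sub>a cmor g (n + 1)) \<cdot> diff X n = diff Y n \<cdot> (cmor f n \<oplus>\<^sub>a cmor g n)" for n
      using Comp_Plus[OF is_complexD(2)[OF X] Hom_ChD(1)[OF f] Hom_ChD(1)[OF g], of n]
        Plus_Comp[OF Hom_ChD(1)[OF f] Hom_ChD(1)[OF g] is_complexD(2)[OF Y], of n]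
        Hom_ChD(2)[OF f, of n] Hom_ChD(2)[OF g, of n] by simp
    then show ?thesis
      using Hom_ChI[OF X Y, of "\<lambda>n. cmor f n \<oplus>\<^sub>a cmor g n"] Plus_in_Hom[OF Hom_ChD(1)[OF f] Hom_ChD(1)[OF g]]
        Hom_ChD(5,6)[OF f]
      by (simp add: Ch_simps)
  qed
  \<comment> \<open>Inverses are taken degreewise as 0 - f; that these commute with the
    differentials is again bilinearity.\<close>
  have uminus: "\<exists>g \<in> Hom (Ch C) X Y. g \<oplus>\<^sub>a\<^bsub>Ch C\<^esub> f = Zero (Ch C) X Y" if f: "f \<in> Hom (Ch C) X Y" for f X Y
  proof
    let ?z = "\<lambda>n. Zero C (cobj X n) (cobj Y n)"
    let ?g = "\<lparr>src = X, tgt = Y, cmor = (\<lambda>n. ?z n \<ominus>\<^sub>a cmor f n)\<rparr>"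
    note X = Hom_ChD(3)[OF f] and Y = Hom_ChD(4)[OF f]
    have z: "?z n \<in> Hom C (cobj X n) (cobj Y n)" for n using Zero_in_Hom is_complexD[OF X] is_complexD[OF Y] by simp
    have "(?z (n + 1) \<ominus>\<^sub>a cmor f (n + 1)) \<cdot> diff X n = diff Y n \<cdot> (?z n \<ominus>\<^sub>a cmor f n)" for n
      using Minus_Comp[OF is_complexD(2)[OF X] z Hom_ChD(1)[OF f], of n]
        Comp_Minus[OF z Hom_ChD(1)[OF f] is_complexD(2)[OF Y], of n] Hom_ChD(2)[OF f, of n]
        Zero_Comp[OF is_complexD(2)[OF X]] Comp_Zero[OF is_complexD(2)[OF Y]]
        is_complexD(1)[OF X] is_complexD(1)[OF Y] by simp
    then show g: "?g \<in> Hom (Ch C) X Y"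
      using Hom_ChI[OF X Y, of "\<lambda>n. ?z n \<ominus>\<^sub>a cmor f n"] Minus_in_Hom[OF z Hom_ChD(1)[OF f]] by blast
    show "?g \<oplus>\<^sub>a\<^bsub>Ch C\<^esub> f = Zero (Ch C) X Y"
      by (rule Hom_Ch_eqI[OF plus[OF g f] zero[OF X Y]])
        (use Minus_Plus_cancel[OF z Hom_ChD(1)[OF f]] in \<open>simp add: Ch_simps\<close>)
  qed
  show ?thesis
  proof (intro preadditive_category.intro category.intro preadditive_category_axioms.intro)
    fix f assume "f \<in> Arr (Ch C)"
    then show "Dom (Ch C) f \<in> Obj (Ch C)" "Cod (Ch C) f \<in> Obj (Ch C)"
      by (simp_all add: Ch_simps is_chain_map_def)
  next
    fix f X Y assume f: "f \<in> Hom (Ch C) X Y"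
    then have XY: "X \<in> Obj (Ch C)" "Y \<in> Obj (Ch C)" using Hom_ChD[OF f] by (simp_all add: Ch_simps)
    show "f \<cdot>\<^bsub>Ch C\<^esub> Ide (Ch C) X = f"
      by (rule Hom_Ch_eqI[OF comp[OF ide[OF XY(1)] f] f])
        (use Comp_Ide[OF Hom_ChD(1)[OF f]] in \<open>simp add: Ch_simps\<close>)
    show "Ide (Ch C) Y \<cdot>\<^bsub>Ch C\<^esub> f = f"
      by (rule Hom_Ch_eqI[OF comp[OF f ide[OF XY(2)]] f])
        (use Ide_Comp[OF Hom_ChD(1)[OF f]] in \<open>simp add: Ch_simps\<close>)
  next
    fix f g h W X Y Z
    assume f: "f \<in> Hom (Ch C) W X" and g: "g \<in> Hom (Ch C) X Y" and h: "h \<in> Hom (Ch C) Y Z"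
    show "(h \<cdot>\<^bsub>Ch C\<^esub> g) \<cdot>\<^bsub>Ch C\<^esub> f = h \<cdot>\<^bsub>Ch C\<^esub> g \<cdot>\<^bsub>Ch C\<^esub> f"
      using Comp_assoc[OF Hom_ChD(1)[OF f] Hom_ChD(1)[OF g] Hom_ChD(1)[OF h]]
      by (simp add: Ch_simps)
  next
    fix X Y assume "X \<in> Obj (Ch C)" "Y \<in> Obj (Ch C)"
    then have X: "is_complex C X" and Y: "is_complex C Y" by (simp_all add: Ch_simps)
    show "comm_group \<lparr>carrier = Hom (Ch C) X Y, monoid.mult = Plus (Ch C), one = Zero (Ch C) X Y\<rparr>"
    proof (rule comm_groupI, unfold monoid.simps partial_object.simps)
      show "Zero (Ch C) X Y \<in> Hom (Ch C) X Y" using zero[OF X Y] .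
      fix f assume f: "f \<in> Hom (Ch C) X Y"
      show "Zero (Ch C) X Y \<oplus>\<^sub>a\<^bsub>Ch C\<^esub> f = f"
        by (rule Hom_Ch_eqI[OF plus[OF zero[OF X Y] f] f])
          (use Plus_Zero[OF Hom_ChD(1)[OF f]] in \<open>simp add: Ch_simps\<close>)
      show "\<exists>g \<in> Hom (Ch C) X Y. g \<oplus>\<^sub>a\<^bsub>Ch C\<^esub> f = Zero (Ch C) X Y" using uminus[OF f] .
      fix g assume g: "g \<in> Hom (Ch C) X Y"
      show "f \<oplus>\<^sub>a\<^bsub>Ch C\<^esub> g \<in> Hom (Ch C) X Y" using plus[OF f g] .
      show "f \<oplus>\<^sub>a\<^bsub>Ch C\<^esub> g = g \<oplus>\<^sub>a\<^bsub>Ch C\<^esub> f"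
        by (rule Hom_Ch_eqI[OF plus[OF f g] plus[OF g f]])
          (use Plus_commute[OF Hom_ChD(1)[OF f] Hom_ChD(1)[OF g]] Hom_ChD(5,6)[OF f] Hom_ChD(5,6)[OF g] in \<open>simp add: Ch_simps\<close>)
      fix h assume h: "h \<in> Hom (Ch C) X Y"
      show "f \<oplus>\<^sub>a\<^bsub>Ch C\<^esub> g \<oplus>\<^sub>a\<^bsub>Ch C\<^esub> h = f \<oplus>\<^sub>a\<^bsub>Ch C\<^esub> (g \<oplus>\<^sub>a\<^bsub>Ch C\<^esub> h)"
        by (rule Hom_Ch_eqI[OF plus[OF plus[OF f g] h] plus[OF f plus[OF g h]]])
          (use Plus_assoc[OF Hom_ChD(1)[OF f] Hom_ChD(1)[OF g] Hom_ChD(1)[OF h]] in \<open>simp add: Ch_simps\<close>)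
    qed
  next
    fix f g h X Y Z assume f: "f \<in> Hom (Ch C) X Y" and g: "g \<in> Hom (Ch C) Y Z" and h: "h \<in> Hom (Ch C) Y Z"
    show "(g \<oplus>\<^sub>a\<^bsub>Ch C\<^esub> h) \<cdot>\<^bsub>Ch C\<^esub> f = g \<cdot>\<^bsub>Ch C\<^esub> f \<oplus>\<^sub>a\<^bsub>Ch C\<^esub> h \<cdot>\<^bsub>Ch C\<^esub> f"
      by (rule Hom_Ch_eqI[OF comp[OF f plus[OF g h]] plus[OF comp[OF f g] comp[OF f h]]])
        (use Comp_Plus[OF Hom_ChD(1)[OF f] Hom_ChD(1)[OF g] Hom_ChD(1)[OF h]] in \<open>simp add: Ch_simps\<close>)
  next
    fix f g h X Y Z assume f: "f \<in> Hom (Ch C) X Y" and g: "g \<in> Hom (Ch C) X Y" and h: "h \<in> Hom (Ch C) Y Z"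
    show "h \<cdot>\<^bsub>Ch C\<^esub> (f \<oplus>\<^sub>a\<^bsub>Ch C\<^esub> g) = h \<cdot>\<^bsub>Ch C\<^esub> f \<oplus>\<^sub>a\<^bsub>Ch C\<^esub> h \<cdot>\<^bsub>Ch C\<^esub> g"
      by (rule Hom_Ch_eqI[OF comp[OF plus[OF f g] h] plus[OF comp[OF f h] comp[OF g h]]])
        (use Plus_Comp[OF Hom_ChD(1)[OF f] Hom_ChD(1)[OF g] Hom_ChD(1)[OF h]] in \<open>simp add: Ch_simps\<close>)
  next
    fix X assume "X \<in> Obj (Ch C)"
    then show "Ide (Ch C) X \<in> Hom (Ch C) X X" by (rule ide)
  next
    fix f g X Y Z assume "f \<in> Hom (Ch C) X Y" "g \<in> Hom (Ch C) Y Z"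
    then show "g \<cdot>\<^bsub>Ch C\<^esub> f \<in> Hom (Ch C) X Z" by (rule comp)
  qed
qed

context abelian_category
begin

interpretation Ch: preadditive_category "Ch C" by (rule preadditive_category_Ch)

text \<open>Degreewise factorisations u assemble to a chain map because commutation with the
  differentials may be tested after the monomorphism k in degree n + 1.\<close>

lemma is_kernel_ChI:
  assumes f: "f \<in> Hom (Ch C) X Y" and k: "k \<in> Hom (Ch C) K X"
    and ker: "\<And>n. is_kernel C (cmor f n) (cmor k n)"
  shows "is_kernel (Ch C) f k"
proof -
  note fn = Hom_ChD(1)[OF f] and kn = Hom_ChD(1)[OF k]
  note dX = is_complexD(2)[OF Hom_ChD(3)[OF f]] and dK = is_complexD(2)[OF Hom_ChD(3)[OF k]]
  have mono: "is_mono C (cmor k n)" for n using kernel_mono ker by blast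
  have 0: "cmor f n \<cdot> cmor k n = Zero C (cobj K n) (cobj Y n)" for n
    using ker[of n] kn[of n] fn[of n] unfolding is_kernel_def by (elim conjE) (simp add: Hom_def)
  show ?thesis
  proof (rule Ch.is_kernelI[OF f k])
    show "f \<cdot>\<^bsub>Ch C\<^esub> k = Zero (Ch C) K Y"
      using 0 f k by (simp add: Ch_simps Hom_Ch_iff)
    show "is_mono (Ch C) k"
    proof (rule Ch.is_monoI[OF k])
      fix W x y assume x: "x \<in> Hom (Ch C) W K" and y: "y \<in> Hom (Ch C) W K" and "k \<cdot>\<^bsub>Ch C\<^esub> x = k \<cdot>\<^bsub>Ch C\<^esub> y"
      then have "cmor k n \<cdot> cmor x n = cmor k n \<cdot> cmor y n" for n
        by (simp add: Ch_simps) meson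
      then have "cmor x n = cmor y n" for n
        using monoD[OF mono[of n], of "cmor x n" "cobj W n" "cmor y n"] Hom_ChD(1)[OF x, of n] Hom_ChD(1)[OF y, of n] kn[of n]
        by (simp add: Hom_def)
      then show "x = y" by (rule Hom_Ch_eqI[OF x y])
    qed
    fix W h assume h: "h \<in> Hom (Ch C) W X" and fh: "f \<cdot>\<^bsub>Ch C\<^esub> h = Zero (Ch C) W Y"
    note hn = Hom_ChD(1)[OF h] and dW = is_complexD(2)[OF Hom_ChD(3)[OF h]]
    have "cmor f n \<cdot> cmor h n = Zero C (cobj W n) (cobj Y n)" for n
      using arg_cong[OF fh, of "\<lambda>x. cmor x n"] by (simp add: Ch_simps)
    then have "\<exists>u. u \<in> Hom C (cobj W n) (cobj K n) \<and> cmor k n \<cdot> u = cmor h n" for n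
      using kernel_factor[OF ker fn kn hn] by metis
    then obtain u where u: "\<And>n. u n \<in> Hom C (cobj W n) (cobj K n)" "\<And>n. cmor k n \<cdot> u n = cmor h n"
      by metis
    have "u (n + 1) \<cdot> diff W n = diff K n \<cdot> u n" for n
    proof (rule monoD[OF mono[of "n + 1"]])
      show "u (n + 1) \<cdot> diff W n \<in> Hom C (cobj W n) (Dom C (cmor k (n + 1)))"
        "diff K n \<cdot> u n \<in> Hom C (cobj W n) (Dom C (cmor k (n + 1)))"
        using Comp_in_Hom[OF dW u(1)] Comp_in_Hom[OF u(1) dK] kn[of "n + 1"] by (simp_all add: Hom_def)
      have "cmor k (n + 1) \<cdot> u (n + 1) \<cdot> diff W n = cmor h (n + 1) \<cdot> diff W n"
        using Comp_assoc[OF dW u(1) kn] u(2) by simp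
      also have "\<dots> = diff X n \<cdot> (cmor k n \<cdot> u n)" using Hom_ChD(2)[OF h] u(2) by simp
      also have "\<dots> = (cmor k (n + 1) \<cdot> diff K n) \<cdot> u n"
        using Comp_assoc[OF u(1) kn dX] Hom_ChD(2)[OF k] by simp
      finally show "cmor k (n + 1) \<cdot> u (n + 1) \<cdot> diff W n = cmor k (n + 1) \<cdot> diff K n \<cdot> u n"
        using Comp_assoc[OF u(1) dK kn] by simp
    qed
    then have "\<lparr>src = W, tgt = K, cmor = u\<rparr> \<in> Hom (Ch C) W K"
      using u(1) by (intro Hom_ChI Hom_ChD(3)[OF h] Hom_ChD(3)[OF k])
    moreover have "k \<cdot>\<^bsub>Ch C\<^esub> \<lparr>src = W, tgt = K, cmor = u\<rparr> = h"
      by (rule Hom_Ch_eqI[OF Ch.Comp_in_Hom[OF calculation k] h]) (simp add: Ch_simps u)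
    ultimately show "\<exists>u\<in>Hom (Ch C) W K. k \<cdot>\<^bsub>Ch C\<^esub> u = h" by blast
  qed
qed

lemma is_cokernel_ChI:
  assumes f: "f \<in> Hom (Ch C) X Y" and q: "q \<in> Hom (Ch C) Y Q"
    and cok: "\<And>n. is_cokernel C (cmor f n) (cmor q n)"
  shows "is_cokernel (Ch C) f q"
proof -
  note fn = Hom_ChD(1)[OF f] and qn = Hom_ChD(1)[OF q]
  note dY = is_complexD(2)[OF Hom_ChD(4)[OF f]] and dQ = is_complexD(2)[OF Hom_ChD(4)[OF q]]
  have epi: "is_epi C (cmor q n)" for n using cokernel_epi cok by blast
  have 0: "cmor q n \<cdot> cmor f n = Zero C (cobj X n) (cobj Q n)" for n
    using cok[of n] qn[of n] fn[of n] unfolding is_cokernel_def by (elim conjE) (simp add: Hom_def)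
  show ?thesis
  proof (rule Ch.is_cokernelI[OF f q])
    show "q \<cdot>\<^bsub>Ch C\<^esub> f = Zero (Ch C) X Q"
      using 0 f q by (simp add: Ch_simps Hom_Ch_iff)
    show "is_epi (Ch C) q"
    proof (rule Ch.is_epiI[OF q])
      fix W x y assume x: "x \<in> Hom (Ch C) Q W" and y: "y \<in> Hom (Ch C) Q W" and "x \<cdot>\<^bsub>Ch C\<^esub> q = y \<cdot>\<^bsub>Ch C\<^esub> q"
      then have "cmor x n \<cdot> cmor q n = cmor y n \<cdot> cmor q n" for n
        by (simp add: Ch_simps) meson
      then have "cmor x n = cmor y n" for n
        using epiD[OF epi[of n], of "cmor x n" "cobj W n" "cmor y n"] Hom_ChD(1)[OF x, of n] Hom_ChD(1)[OF y, of n] qn[of n]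
        by (simp add: Hom_def)
      then show "x = y" by (rule Hom_Ch_eqI[OF x y])
    qed
    fix W h assume h: "h \<in> Hom (Ch C) Y W" and fh: "h \<cdot>\<^bsub>Ch C\<^esub> f = Zero (Ch C) X W"
    note hn = Hom_ChD(1)[OF h] and dW = is_complexD(2)[OF Hom_ChD(4)[OF h]]
    have "cmor h n \<cdot> cmor f n = Zero C (cobj X n) (cobj W n)" for n
      using arg_cong[OF fh, of "\<lambda>x. cmor x n"] by (simp add: Ch_simps)
    then have "\<exists>u. u \<in> Hom C (cobj Q n) (cobj W n) \<and> u \<cdot> cmor q n = cmor h n" for n
      using cokernel_factor[OF cok fn qn hn] by metis
    then obtain u where u: "\<And>n. u n \<in> Hom C (cobj Q n) (cobj W n)" "\<And>n. u n \<cdot> cmor q n = cmor h n"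
      by metis
    have "u (n + 1) \<cdot> diff Q n = diff W n \<cdot> u n" for n
    proof (rule epiD[OF epi[of "n"]])
      show "u (n + 1) \<cdot> diff Q n \<in> Hom C (Cod C (cmor q n)) (cobj W (n + 1))"
        "diff W n \<cdot> u n \<in> Hom C (Cod C (cmor q n)) (cobj W (n + 1))"
        using Comp_in_Hom[OF dQ u(1)] Comp_in_Hom[OF u(1) dW] qn[of n] by (simp_all add: Hom_def)
      have "(diff W n \<cdot> u n) \<cdot> cmor q n = diff W n \<cdot> cmor h n"
        using Comp_assoc[OF qn u(1) dW] u(2) by simp
      also have "\<dots> = (u (n + 1) \<cdot> cmor q (n + 1)) \<cdot> diff Y n" using Hom_ChD(2)[OF h] u(2) by simp
      also have "\<dots> = u (n + 1) \<cdot> diff Q n \<cdot> cmor q n"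
        using Comp_assoc[OF dY qn u(1)] Hom_ChD(2)[OF q] by simp
      finally show "(u (n + 1) \<cdot> diff Q n) \<cdot> cmor q n = (diff W n \<cdot> u n) \<cdot> cmor q n"
        using Comp_assoc[OF qn dQ u(1)] by simp
    qed
    then have "\<lparr>src = Q, tgt = W, cmor = u\<rparr> \<in> Hom (Ch C) Q W"
      using u(1) by (intro Hom_ChI Hom_ChD(4)[OF h] Hom_ChD(4)[OF q])
    moreover have "\<lparr>src = Q, tgt = W, cmor = u\<rparr> \<cdot>\<^bsub>Ch C\<^esub> q = h"
      by (rule Hom_Ch_eqI[OF Ch.Comp_in_Hom[OF q calculation] h]) (simp add: Ch_simps u)
    ultimately show "\<exists>u\<in>Hom (Ch C) Q W. u \<cdot>\<^bsub>Ch C\<^esub> q = h" by blast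
  qed
qed

text \<open>The differential of X restricts to the chosen kernels, and the restriction squares to
  zero because k is monic in each degree.\<close>

lemma ex_degreewise_kernel:
  assumes f: "f \<in> Hom (Ch C) X Y"
  obtains K k where "k \<in> Hom (Ch C) K X" "\<And>n. is_kernel C (cmor f n) (cmor k n)"
proof -
  note fn = Hom_ChD(1)[OF f] and X = Hom_ChD(3)[OF f]
  note dX = is_complexD(2)[OF X] and dY = is_complexD(2)[OF Hom_ChD(4)[OF f]]
  have "\<exists>k. is_kernel C (cmor f n) k" for n using ex_kernel fn[of n] by (simp add: Hom_def)
  then obtain k where ker: "\<And>n. is_kernel C (cmor f n) (k n)" by metis
  define K where "K = (\<lambda>n. Dom C (k n))"
  have k: "k n \<in> Hom C (K n) (cobj X n)" and 0: "cmor f n \<cdot> k n = Zero C (K n) (cobj Y n)" for n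
    by (rule kernelE[OF ker fn, of n], simp add: Hom_def K_def)+
  have mono: "is_mono C (k n)" for n using kernel_mono ker by blast
  have obj: "K n \<in> Obj C" "cobj X n \<in> Obj C" "cobj Y n \<in> Obj C" for n
    using Hom_Obj[OF k] Hom_Obj[OF fn] by auto
  have "\<exists>d. d \<in> Hom C (K n) (K (n + 1)) \<and> k (n + 1) \<cdot> d = diff X n \<cdot> k n" for n
  proof -
    have "cmor f (n + 1) \<cdot> (diff X n \<cdot> k n) = diff Y n \<cdot> (cmor f n \<cdot> k n)"
      using Comp_assoc[OF k dX fn] Comp_assoc[OF k fn dY] Hom_ChD(2)[OF f] by simp
    also have "\<dots> = Zero C (K n) (cobj Y (n + 1))" using 0 Comp_Zero[OF dY] obj by simp
    finally show ?thesis using kernel_factor[OF ker fn k Comp_in_Hom[OF k dX]] by metis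
  qed
  then obtain d where d: "\<And>n. d n \<in> Hom C (K n) (K (n + 1))" and kd: "\<And>n. k (n + 1) \<cdot> d n = diff X n \<cdot> k n"
    by metis
  have "d (n + 1) \<cdot> d n = Zero C (K n) (K (n + 1 + 1))" for n
  proof (rule mono_Zero[OF mono k Comp_in_Hom[OF d d]])
    have "k (n + 1 + 1) \<cdot> d (n + 1) \<cdot> d n = diff X (n + 1) \<cdot> diff X n \<cdot> k n"
      using Comp_assoc[OF d d k, of n] Comp_assoc[OF d k dX, of n] kd[of n] kd[of "n + 1"] by simp
    also have "\<dots> = Zero C (K n) (cobj X (n + 1 + 1))"
      using Comp_assoc[OF k dX dX, of n] is_complexD(3)[OF X, of n] Zero_Comp[OF k obj(2)] by simp
    finally show "k (n + 1 + 1) \<cdot> d (n + 1) \<cdot> d n = Zero C (K n) (cobj X (n + 1 + 1))" .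
  qed
  then have KK: "is_complex C \<lparr>cobj = K, diff = d\<rparr>"
    using obj d by (intro is_complexI) simp_all
  have "\<lparr>src = \<lparr>cobj = K, diff = d\<rparr>, tgt = X, cmor = k\<rparr> \<in> Hom (Ch C) \<lparr>cobj = K, diff = d\<rparr> X"
    by (rule Hom_ChI[OF KK X]) (simp_all add: k kd)
  then show thesis using that ker by force
qed

lemma ex_degreewise_cokernel:
  assumes f: "f \<in> Hom (Ch C) X Y"
  obtains Q q where "q \<in> Hom (Ch C) Y Q" "\<And>n. is_cokernel C (cmor f n) (cmor q n)"
proof -
  note fn = Hom_ChD(1)[OF f] and Y = Hom_ChD(4)[OF f]
  note dX = is_complexD(2)[OF Hom_ChD(3)[OF f]] and dY = is_complexD(2)[OF Y]
  have "\<exists>q. is_cokernel C (cmor f n) q" for n using ex_cokernel fn[of n] by (simp add: Hom_def)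
  then obtain q where cok: "\<And>n. is_cokernel C (cmor f n) (q n)" by metis
  define Q where "Q = (\<lambda>n. Cod C (q n))"
  have q: "q n \<in> Hom C (cobj Y n) (Q n)" and 0: "q n \<cdot> cmor f n = Zero C (cobj X n) (Q n)" for n
    by (rule cokernelE[OF cok fn, of n], simp add: Hom_def Q_def)+
  have epi: "is_epi C (q n)" for n using cokernel_epi cok by blast
  have obj: "Q n \<in> Obj C" "cobj X n \<in> Obj C" "cobj Y n \<in> Obj C" for n
    using Hom_Obj[OF q] Hom_Obj[OF fn] by auto
  have "\<exists>d. d \<in> Hom C (Q n) (Q (n + 1)) \<and> d \<cdot> q n = q (n + 1) \<cdot> diff Y n" for n
  proof -
    have "(q (n + 1) \<cdot> diff Y n) \<cdot> cmor f n = (q (n + 1) \<cdot> cmor f (n + 1)) \<cdot> diff X n"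
      using Comp_assoc[OF fn dY q] Comp_assoc[OF dX fn q] Hom_ChD(2)[OF f] by simp
    also have "\<dots> = Zero C (cobj X n) (Q (n + 1))" using 0 Zero_Comp[OF dX] obj by simp
    finally show ?thesis using cokernel_factor[OF cok fn q Comp_in_Hom[OF dY q]] by metis
  qed
  then obtain d where d: "\<And>n. d n \<in> Hom C (Q n) (Q (n + 1))" and kd: "\<And>n. d n \<cdot> q n = q (n + 1) \<cdot> diff Y n"
    by metis
  have "d (n + 1) \<cdot> d n = Zero C (Q n) (Q (n + 1 + 1))" for n
  proof (rule epi_Zero[OF epi q Comp_in_Hom[OF d d]])
    have "(d (n + 1) \<cdot> d n) \<cdot> q n = q (n + 1 + 1) \<cdot> diff Y (n + 1) \<cdot> diff Y n"
      using Comp_assoc[OF q d d, of n] Comp_assoc[OF dY q d, of n, symmetric] Comp_assoc[OF dY dY q, of n] kd[of n] kd[of "n + 1"] by simp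
    also have "\<dots> = Zero C (cobj Y n) (Q (n + 1 + 1))"
      using is_complexD(3)[OF Y, of n] Comp_Zero[OF q obj(3)] by simp
    finally show "(d (n + 1) \<cdot> d n) \<cdot> q n = Zero C (cobj Y n) (Q (n + 1 + 1))" .
  qed
  then have QQ: "is_complex C \<lparr>cobj = Q, diff = d\<rparr>"
    using obj d by (intro is_complexI) simp_all
  have "\<lparr>src = Y, tgt = \<lparr>cobj = Q, diff = d\<rparr>, cmor = q\<rparr> \<in> Hom (Ch C) Y \<lparr>cobj = Q, diff = d\<rparr>"
    by (rule Hom_ChI[OF Y QQ]) (simp_all add: q kd)
  then show thesis using that cok by force
qed

text \<open>The degreewise kernels form a complex whose inclusion is killed by f, hence zero. So in
  each degree everything killed by f factors through a zero map.\<close>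

lemma mono_Ch_degreewise:
  assumes f: "f \<in> Hom (Ch C) X Y" and "is_mono (Ch C) f"
  shows "is_mono C (cmor f n)"
proof -
  obtain K k where k: "k \<in> Hom (Ch C) K X" and ker: "\<And>n. is_kernel C (cmor f n) (cmor k n)"
    using ex_degreewise_kernel[OF f] by blast
  have "f \<cdot>\<^bsub>Ch C\<^esub> k = Zero (Ch C) K Y"
    using is_kernel_ChI[OF f k ker] f k unfolding is_kernel_def by (elim conjE) (simp add: Hom_def)
  then have "k = Zero (Ch C) K X" using Ch.mono_Zero[OF assms(2) f k] by simp
  then have k0: "cmor k n = Zero C (cobj K n) (cobj X n)" by (simp add: Ch_simps)
  show ?thesis
  proof (rule monoI[OF Hom_ChD(1)[OF f]])
    fix W x assume x: "x \<in> Hom C W (cobj X n)" "cmor f n \<cdot> x = Zero C W (cobj Y n)"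
    obtain u where u: "u \<in> Hom C W (cobj K n)" "cmor k n \<cdot> u = x"
      by (rule kernel_factor[OF ker Hom_ChD(1)[OF f] Hom_ChD(1)[OF k] x])
    then show "x = Zero C W (cobj X n)" using k0 Zero_Comp[OF u(1)] Hom_Obj[OF x(1)] by simp
  qed
qed

lemma epi_Ch_degreewise:
  assumes f: "f \<in> Hom (Ch C) X Y" and "is_epi (Ch C) f"
  shows "is_epi C (cmor f n)"
proof -
  obtain Q q where q: "q \<in> Hom (Ch C) Y Q" and cok: "\<And>n. is_cokernel C (cmor f n) (cmor q n)"
    using ex_degreewise_cokernel[OF f] by blast
  have "q \<cdot>\<^bsub>Ch C\<^esub> f = Zero (Ch C) X Q"
    using is_cokernel_ChI[OF f q cok] f q unfolding is_cokernel_def by (elim conjE) (simp add: Hom_def)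
  then have "q = Zero (Ch C) Y Q" using Ch.epi_Zero[OF assms(2) f q] by simp
  then have q0: "cmor q n = Zero C (cobj Y n) (cobj Q n)" by (simp add: Ch_simps)
  show ?thesis
  proof (rule epiI[OF Hom_ChD(1)[OF f]])
    fix W x assume x: "x \<in> Hom C (cobj Y n) W" "x \<cdot> cmor f n = Zero C (cobj X n) W"
    obtain u where u: "u \<in> Hom C (cobj Q n) W" "u \<cdot> cmor q n = x"
      by (rule cokernel_factor[OF cok Hom_ChD(1)[OF f] Hom_ChD(1)[OF q] x])
    then show "x = Zero C (cobj Y n) W" using q0 Comp_Zero[OF u(1)] Hom_Obj[OF x(1)] by simp
  qed
qed

text \<open>The block diagonal map of f and g. With differentials for f and g it is the differential
  of a biproduct of complexes, and the four equations are the chain map conditions for the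
  injections and projections.\<close>

lemma biproduct_map:
  assumes bi: "is_biproduct C X Y P i j p q" and bi': "is_biproduct C X' Y' P' i' j' p' q'"
    and f: "f \<in> Hom C X X'" and g: "g \<in> Hom C Y Y'"
    and s: "s = (i' \<cdot> f \<cdot> p) \<oplus>\<^sub>a (j' \<cdot> g \<cdot> q)"
  shows "s \<in> Hom C P P'" "s \<cdot> i = i' \<cdot> f" "s \<cdot> j = j' \<cdot> g" "p' \<cdot> s = f \<cdot> p" "q' \<cdot> s = g \<cdot> q"
proof -
  have i: "i \<in> Hom C X P" and j: "j \<in> Hom C Y P" and p: "p \<in> Hom C P X" and q: "q \<in> Hom C P Y"
    and pi: "p \<cdot> i = Ide C X" and qj: "q \<cdot> j = Ide C Y" and qi: "q \<cdot> i = Zero C X Y" and pj: "p \<cdot> j = Zero C Y X"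
    using bi by (auto simp: is_biproduct_def)
  have i': "i' \<in> Hom C X' P'" and j': "j' \<in> Hom C Y' P'" and p': "p' \<in> Hom C P' X'" and q': "q' \<in> Hom C P' Y'"
    and pi': "p' \<cdot> i' = Ide C X'" and qj': "q' \<cdot> j' = Ide C Y'" and qi': "q' \<cdot> i' = Zero C X' Y'" and pj': "p' \<cdot> j' = Zero C Y' X'"
    using bi' by (auto simp: is_biproduct_def)
  have obj: "X \<in> Obj C" "Y \<in> Obj C" "X' \<in> Obj C" "Y' \<in> Obj C" "P \<in> Obj C" "P' \<in> Obj C"
    using Hom_Obj[OF i] Hom_Obj[OF j] Hom_Obj[OF i'] Hom_Obj[OF j'] by auto
  note fp = Comp_in_Hom[OF p f] and gq = Comp_in_Hom[OF q g]
  note a = Comp_in_Hom[OF fp i'] and b = Comp_in_Hom[OF gq j']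
  show "s \<in> Hom C P P'" using Plus_in_Hom[OF a b] by (simp add: s)
  have "(i' \<cdot> f \<cdot> p) \<cdot> i = i' \<cdot> f" "(j' \<cdot> g \<cdot> q) \<cdot> i = Zero C X P'"
    "(i' \<cdot> f \<cdot> p) \<cdot> j = Zero C Y P'" "(j' \<cdot> g \<cdot> q) \<cdot> j = j' \<cdot> g"
    using Comp_assoc[OF i fp i'] Comp_assoc[OF i p f] Comp_assoc[OF i gq j'] Comp_assoc[OF i q g]
      Comp_assoc[OF j fp i'] Comp_assoc[OF j p f] Comp_assoc[OF j gq j'] Comp_assoc[OF j q g]
      Comp_Ide[OF f] Comp_Ide[OF g] Comp_Zero[OF f] Comp_Zero[OF g] Comp_Zero[OF i'] Comp_Zero[OF j'] obj
      pi qi pj qj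
    by simp_all
  then show "s \<cdot> i = i' \<cdot> f" "s \<cdot> j = j' \<cdot> g"
    using Comp_Plus[OF i a b] Comp_Plus[OF j a b] Plus_Zero[OF Comp_in_Hom[OF f i']] Plus_Zero[OF Comp_in_Hom[OF g j']]
    by (simp_all add: s)
  have "p' \<cdot> (i' \<cdot> f \<cdot> p) = f \<cdot> p" "p' \<cdot> (j' \<cdot> g \<cdot> q) = Zero C P X'"
    "q' \<cdot> (i' \<cdot> f \<cdot> p) = Zero C P Y'" "q' \<cdot> (j' \<cdot> g \<cdot> q) = g \<cdot> q"
    using Comp_assoc[OF fp i' p'] Comp_assoc[OF gq j' p'] Comp_assoc[OF fp i' q'] Comp_assoc[OF gq j' q']
      Ide_Comp[OF fp] Ide_Comp[OF gq] Zero_Comp[OF fp] Zero_Comp[OF gq] obj pi' qi' pj' qj'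
    by simp_all
  then show "p' \<cdot> s = f \<cdot> p" "q' \<cdot> s = g \<cdot> q"
    using Plus_Comp[OF a b p'] Plus_Comp[OF a b q'] Plus_Zero[OF fp] Plus_Zero[OF gq]
    by (simp_all add: s)
qed

lemma ex_biproduct_Ch:
  assumes X: "is_complex C X" and Y: "is_complex C Y"
  shows "\<exists>P i j p q. is_biproduct (Ch C) X Y P i j p q"
proof -
  note dX = is_complexD(2)[OF X] and dY = is_complexD(2)[OF Y]
  have "\<exists>P i j p q. is_biproduct C (cobj X n) (cobj Y n) P i j p q" for n
    using ex_biproduct is_complexD(1) X Y by blast
  then obtain P i j p q where bi: "\<And>n. is_biproduct C (cobj X n) (cobj Y n) (P n) (i n) (j n) (p n) (q n)" by metis
  have i: "i n \<in> Hom C (cobj X n) (P n)" and j: "j n \<in> Hom C (cobj Y n) (P n)"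
    and p: "p n \<in> Hom C (P n) (cobj X n)" and q: "q n \<in> Hom C (P n) (cobj Y n)" for n
    using bi by (auto simp: is_biproduct_def)
  have obj: "cobj X n \<in> Obj C" "cobj Y n \<in> Obj C" "P n \<in> Obj C" for n
    using Hom_Obj[OF i] Hom_Obj[OF j] by auto
  define s where "s = (\<lambda>n. (i (n + 1) \<cdot> diff X n \<cdot> p n) \<oplus>\<^sub>a (j (n + 1) \<cdot> diff Y n \<cdot> q n))"
  have s_eq: "s n = (i (n + 1) \<cdot> diff X n \<cdot> p n) \<oplus>\<^sub>a (j (n + 1) \<cdot> diff Y n \<cdot> q n)" for n
    by (simp add: s_def)
  note s = biproduct_map(1)[OF bi bi dX dY s_eq] and si = biproduct_map(2)[OF bi bi dX dY s_eq]
    and sj = biproduct_map(3)[OF bi bi dX dY s_eq] and ps = biproduct_map(4)[OF bi bi dX dY s_eq]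
    and qs = biproduct_map(5)[OF bi bi dX dY s_eq]
  have "s (n + 1) \<cdot> s n = Zero C (P n) (P (n + 1 + 1))" for n
  proof -
    note a = Comp_in_Hom[OF p dX, of n] and b = Comp_in_Hom[OF q dY, of n]
    have "s (n + 1) \<cdot> i (n + 1) \<cdot> diff X n \<cdot> p n = i (n + 1 + 1) \<cdot> diff X (n + 1) \<cdot> diff X n \<cdot> p n"
      using Comp_assoc[OF a i s] si[of "n + 1"] Comp_assoc[OF a dX i] by simp
    also have "\<dots> = Zero C (P n) (P (n + 1 + 1))"
      using Comp_assoc[OF p dX dX, of n, symmetric] is_complexD(3)[OF X, of n] Zero_Comp[OF p] Comp_Zero[OF i] obj by simp
    finally have 1: "s (n + 1) \<cdot> i (n + 1) \<cdot> diff X n \<cdot> p n = Zero C (P n) (P (n + 1 + 1))" .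
    have "s (n + 1) \<cdot> j (n + 1) \<cdot> diff Y n \<cdot> q n = j (n + 1 + 1) \<cdot> diff Y (n + 1) \<cdot> diff Y n \<cdot> q n"
      using Comp_assoc[OF b j s] sj[of "n + 1"] Comp_assoc[OF b dY j] by simp
    also have "\<dots> = Zero C (P n) (P (n + 1 + 1))"
      using Comp_assoc[OF q dY dY, of n, symmetric] is_complexD(3)[OF Y, of n] Zero_Comp[OF q] Comp_Zero[OF j] obj by simp
    finally have 2: "s (n + 1) \<cdot> j (n + 1) \<cdot> diff Y n \<cdot> q n = Zero C (P n) (P (n + 1 + 1))" .
    show ?thesis
      using Plus_Comp[OF Comp_in_Hom[OF a i] Comp_in_Hom[OF b j] s] 1 2 s_eq[of n]
        Plus_Zero(1)[OF Zero_in_Hom[OF obj(3)[of n] obj(3)[of "n + 1 + 1"]]] by simp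
  qed
  then have PP: "is_complex C \<lparr>cobj = P, diff = s\<rparr>" (is "is_complex C ?P")
    using obj s by (intro is_complexI) simp_all
  have I: "\<lparr>src = X, tgt = ?P, cmor = i\<rparr> \<in> Hom (Ch C) X ?P"
    by (rule Hom_ChI[OF X PP]) (simp_all add: i si)
  have J: "\<lparr>src = Y, tgt = ?P, cmor = j\<rparr> \<in> Hom (Ch C) Y ?P"
    by (rule Hom_ChI[OF Y PP]) (simp_all add: j sj)
  have P: "\<lparr>src = ?P, tgt = X, cmor = p\<rparr> \<in> Hom (Ch C) ?P X"
    by (rule Hom_ChI[OF PP X]) (simp_all add: p ps)
  have Q: "\<lparr>src = ?P, tgt = Y, cmor = q\<rparr> \<in> Hom (Ch C) ?P Y"
    by (rule Hom_ChI[OF PP Y]) (simp_all add: q qs)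
  have "is_biproduct (Ch C) X Y ?P \<lparr>src = X, tgt = ?P, cmor = i\<rparr> \<lparr>src = Y, tgt = ?P, cmor = j\<rparr>
     \<lparr>src = ?P, tgt = X, cmor = p\<rparr> \<lparr>src = ?P, tgt = Y, cmor = q\<rparr>"
    using I J P Q bi unfolding is_biproduct_def by (simp add: Ch_simps)
  then show ?thesis by blast
qed

text \<open>Normality is inherited because monomorphisms and epimorphisms of complexes are so in
  each degree, where they are kernels and cokernels of the degreewise cokernels and kernels. All
  later diagram chases take place in categories of complexes viewed as abstract abelian
  categories.\<close>

lemma abelian_category_Ch: "abelian_category (Ch C)"
proof (intro abelian_category.intro abelian_category_axioms.intro preadditive_category_Ch)
  obtain z where z: "is_zero_object C z" using ex_zero_object by blast
  have zo: "z \<in> Obj C" using z by (simp add: is_zero_object_def is_initial_def)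
  have Iz: "Ide C z = Zero C z z" using zero_object_Hom(1)[OF z zo] Ide_in_Hom[OF zo] by blast
  let ?Z = "\<lparr>cobj = \<lambda>_. z, diff = \<lambda>_. Zero C z z\<rparr>"
  have "is_complex C ?Z"
    using zo Zero_in_Hom[OF zo zo] Comp_Zero[OF Zero_in_Hom[OF zo zo] zo] by (intro is_complexI) simp_all
  then have "is_zero_object (Ch C) ?Z"
    by (intro Ch.zero_objectI) (simp_all add: Ch_simps Iz)
  then show "\<exists>Z. is_zero_object (Ch C) Z" ..
next
  fix X Y assume "X \<in> Obj (Ch C)" "Y \<in> Obj (Ch C)"
  then show "\<exists>P i j p q. is_biproduct (Ch C) X Y P i j p q"
    using ex_biproduct_Ch by (simp add: Ch_simps)
next
  fix f assume "f \<in> Arr (Ch C)"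
  then have f: "f \<in> Hom (Ch C) (src f) (tgt f)" by (simp add: Hom_Ch_iff Ch_simps)
  show "\<exists>k. is_kernel (Ch C) f k"
    using ex_degreewise_kernel[OF f] is_kernel_ChI[OF f] by metis
  show "\<exists>q. is_cokernel (Ch C) f q"
    using ex_degreewise_cokernel[OF f] is_cokernel_ChI[OF f] by metis
next
  fix f assume m: "is_mono (Ch C) f"
  then have f: "f \<in> Hom (Ch C) (src f) (tgt f)" by (simp add: Hom_Ch_iff Ch_simps is_mono_def)
  obtain Q q where q: "q \<in> Hom (Ch C) (tgt f) Q" and cok: "\<And>n. is_cokernel C (cmor f n) (cmor q n)"
    using ex_degreewise_cokernel[OF f] by blast
  have "is_kernel (Ch C) q f"
    by (rule is_kernel_ChI[OF q f]) (rule mono_kernel_of_cokernel[OF mono_Ch_degreewise[OF f m] cok])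
  then show "\<exists>g. is_kernel (Ch C) g f" ..
next
  fix f assume m: "is_epi (Ch C) f"
  then have f: "f \<in> Hom (Ch C) (src f) (tgt f)" by (simp add: Hom_Ch_iff Ch_simps is_epi_def)
  obtain K k where k: "k \<in> Hom (Ch C) K (src f)" and ker: "\<And>n. is_kernel C (cmor f n) (cmor k n)"
    using ex_degreewise_kernel[OF f] by blast
  have "is_cokernel (Ch C) k f"
    by (rule is_cokernel_ChI[OF k f]) (rule epi_cokernel_of_kernel[OF epi_Ch_degreewise[OF f m] ker])
  then show "\<exists>g. is_cokernel (Ch C) g f" ..
qed

end

text \<open>Replaces B by a cover Q without changing the cokernel Z, so right splitness still
  applies to the new sequence. Here r is defined as the kernel of c p, which makes exactness
  immediate, and s exists because f is the kernel of c.\<close>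

lemma (in abelian_category) pullback_short_exact:
  assumes f: "f \<in> Hom C A B" "is_mono C f" and c: "c \<in> Hom C B Z" "is_cokernel C f c"
    and p: "p \<in> Hom C Q B" "is_epi C p"
  obtains K r s where "r \<in> Hom C K Q" "s \<in> Hom C K A" "f \<cdot> s = p \<cdot> r" "is_epi C s" "short_exact C r (c \<cdot> p)"
proof -
  note cp = Comp_in_Hom[OF p(1) c(1)]
  have obj: "Z \<in> Obj C" using Hom_Obj[OF c(1)] by simp
  have cf: "c \<cdot> f = Zero C A Z" by (rule cokernelE[OF c(2) f(1)]) (use c(1) in \<open>simp add: Hom_def\<close>)
  have fker: "is_kernel C c f" using mono_kernel_of_cokernel[OF f(2) c(2)] .
  obtain r where r: "is_kernel C (c \<cdot> p) r" using ex_kernel cp by (auto simp: Hom_def)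
  obtain K where rh: "r \<in> Hom C K Q" and cpr: "(c \<cdot> p) \<cdot> r = Zero C K Z" by (rule kernelE[OF r cp])
  note pr = Comp_in_Hom[OF rh p(1)]
  have "c \<cdot> p \<cdot> r = Zero C K Z" using cpr Comp_assoc[OF rh p(1) c(1)] by simp
  then obtain s where s: "s \<in> Hom C K A" "f \<cdot> s = p \<cdot> r" by (rule kernel_factor[OF fker c(1) f(1) pr])
  obtain K' r' s' where K': "r' \<in> Hom C K' Q" "s' \<in> Hom C K' A" "f \<cdot> s' = p \<cdot> r'" "is_epi C s'"
    by (rule pullback_of_epi[OF f(1) p])
  have "(c \<cdot> p) \<cdot> r' = (c \<cdot> f) \<cdot> s'"
    using Comp_assoc[OF K'(1) p(1) c(1)] Comp_assoc[OF K'(2) f(1) c(1)] K'(3) by simp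
  also have "\<dots> = Zero C K' Z" using cf Zero_Comp[OF K'(2) obj] by simp
  finally obtain w where w: "w \<in> Hom C K' K" "r \<cdot> w = r'" by (rule kernel_factor[OF r cp rh K'(1)])
  have fA: "Dom C f = A" using f(1) by (simp add: Hom_def)
  have "s \<cdot> w = s'"
  proof (rule monoD[OF f(2), unfolded fA])
    show "f \<cdot> s \<cdot> w = f \<cdot> s'"
      using Comp_assoc[OF w(1) s(1) f(1)] Comp_assoc[OF w(1) rh p(1)] s(2) w(2) K'(3) by simp
  qed (use K'(2) Comp_in_Hom[OF w(1) s(1)] in auto)
  then have "is_epi C s" using epi_Comp_left[OF _ w(1) s(1)] K'(4) by simp
  moreover have "is_epi C (c \<cdot> p)" by (rule epi_Comp[OF p(2) cokernel_epi[OF c(2)] p(1) c(1)])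
  ultimately show thesis using that[OF rh s] short_exact_of_epi r by blast
qed

section \<open>Extending compatible families up to a monomorphism\<close>

definition obj_family :: "nat \<Rightarrow> (nat \<Rightarrow> ('o, 'm, 'z) cat_scheme) \<Rightarrow> (nat \<Rightarrow> 'o) \<Rightarrow> bool" where
  "obj_family n M a \<longleftrightarrow> (\<forall>i\<in>{1..n}. a i \<in> Obj (M i))"

lemma obj_familyD: "\<lbrakk>obj_family n M a; i \<in> {1..n}\<rbrakk> \<Longrightarrow> a i \<in> Obj (M i)"
  by (simp add: obj_family_def)

lemma obj_family_upd: "\<lbrakk>obj_family n M a; X \<in> Obj (M j)\<rbrakk> \<Longrightarrow> obj_family n M (a(j := X))"
  by (simp add: obj_family_def)

text \<open>Here \<open>ar a j u\<close> stands for F with u in slot j and identities of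
  \<open>a\<close> elsewhere, so the argument uses only one-variable arrows and their interchange.
  \<open>ar_upd\<close> records that slot j of \<open>a\<close> is ignored, and
  \<open>ar_cokernel\<close> is right exactness in each slot.\<close>

locale multi_right_exact = D: abelian_category D
  for D :: "('p, 'q, 'y) abcat_scheme" +
  fixes n :: nat and M :: "nat \<Rightarrow> ('o, 'm, 'z) abcat_scheme"
    and ob :: "(nat \<Rightarrow> 'o) \<Rightarrow> 'p" and ar :: "(nat \<Rightarrow> 'o) \<Rightarrow> nat \<Rightarrow> 'm \<Rightarrow> 'q"
  assumes M_abelian: "i \<in> {1..n} \<Longrightarrow> abelian_category (M i)"
    and ar_in_Hom: "\<lbrakk>obj_family n M a; j \<in> {1..n}; u \<in> Hom (M j) X Y\<rbrakk>
      \<Longrightarrow> ar a j u \<in> Hom D (ob (a(j := X))) (ob (a(j := Y)))"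
    and ar_Comp: "\<lbrakk>obj_family n M a; j \<in> {1..n}; u \<in> Hom (M j) X Y; v \<in> Hom (M j) Y Z\<rbrakk>
      \<Longrightarrow> ar a j (v \<cdot>\<^bsub>M j\<^esub> u) = ar a j v \<cdot>\<^bsub>D\<^esub> ar a j u"
    and ar_upd: "ar (a(j := X)) j u = ar a j u"
    and ar_interchange: "\<lbrakk>obj_family n M a; i \<in> {1..n}; j \<in> {1..n}; i \<noteq> j;
        u \<in> Hom (M i) X X'; v \<in> Hom (M j) Y Y'\<rbrakk>
      \<Longrightarrow> ar (a(i := X')) j v \<cdot>\<^bsub>D\<^esub> ar (a(j := Y)) i u = ar (a(j := Y')) i u \<cdot>\<^bsub>D\<^esub> ar (a(i := X)) j v"
    and ar_cokernel: "\<lbrakk>obj_family n M a; j \<in> {1..n}; is_cokernel (M j) u q\<rbrakk>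
      \<Longrightarrow> is_cokernel D (ar a j u) (ar a j q)"
    and ar_Zero: "\<lbrakk>obj_family n M a; j \<in> {1..n}; X \<in> Obj (M j); Y \<in> Obj (M j)\<rbrakk>
      \<Longrightarrow> ar a j (Zero (M j) X Y) = Zero D (ob (a(j := X))) (ob (a(j := Y)))"
begin

lemma ar_epi:
  assumes "obj_family n M a" "j \<in> {1..n}" "is_epi (M j) p"
  shows "is_epi D (ar a j p)"
proof -
  interpret Mj: abelian_category "M j" using M_abelian assms by blast
  obtain k where "is_kernel (M j) p k" using Mj.ex_kernel[of p] assms(3) unfolding is_epi_def by blast
  then have "is_cokernel (M j) k p" using Mj.epi_cokernel_of_kernel assms(3) by blast
  then show ?thesis using D.cokernel_epi ar_cokernel assms by blast
qed

end

text \<open>What the extension argument sees of the model structures: classes \<D> with enough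
  covers, monicity from right splitness, and monomorphisms \<open>f i\<close> with cokernels in
  \<D>.\<close>

locale split_cube = multi_right_exact D n M ob ar
  for D :: "('p, 'q, 'y) abcat_scheme" and n :: nat and M :: "nat \<Rightarrow> ('o, 'm, 'z) abcat_scheme" and ob ar +
  fixes \<D> :: "nat \<Rightarrow> 'o set" and A B C :: "nat \<Rightarrow> 'o" and f c :: "nat \<Rightarrow> 'm"
  assumes \<D>_Obj: "i \<in> {1..n} \<Longrightarrow> \<D> i \<subseteq> Obj (M i)"
    and cover: "\<lbrakk>i \<in> {1..n}; X \<in> Obj (M i)\<rbrakk> \<Longrightarrow> \<exists>Q\<in>\<D> i. \<exists>p\<in>Hom (M i) Q X. is_epi (M i) p"
    and split: "\<lbrakk>j \<in> {1..n}; \<forall>i\<in>{1..n} - {j}. a i \<in> \<D> i; short_exact (M j) u v; Cod (M j) v \<in> \<D> j\<rbrakk>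
      \<Longrightarrow> is_mono D (ar a j u)"
    and f_Hom: "i \<in> {1..n} \<Longrightarrow> f i \<in> Hom (M i) (A i) (B i)"
    and f_mono: "i \<in> {1..n} \<Longrightarrow> is_mono (M i) (f i)"
    and c_Hom: "i \<in> {1..n} \<Longrightarrow> c i \<in> Hom (M i) (B i) (C i)"
    and c_cokernel: "i \<in> {1..n} \<Longrightarrow> is_cokernel (M i) (f i) (c i)"
    and C_\<D>: "i \<in> {1..n} \<Longrightarrow> C i \<in> \<D> i"
begin

section \<open>The quotient maps from the B to the C\<close>

definition quot_fam :: "nat \<Rightarrow> (nat \<Rightarrow> 'o) \<Rightarrow> nat \<Rightarrow> 'o" where
  "quot_fam k a = (\<lambda>i. if i \<in> {1..k} then C i else a i)"

text \<open>F(\<open>c 1\<close>, ..., \<open>c k\<close>, identities), composed one slot at a time;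
  its source and target match only for families with B in the slots up to k, which
  \<open>tgt_fam\<close> expresses.\<close>

primrec quot_map :: "nat \<Rightarrow> (nat \<Rightarrow> 'o) \<Rightarrow> 'q" where
  "quot_map 0 a = Ide D (ob a)"
| "quot_map (Suc k) a = ar (quot_fam k a) (Suc k) (c (Suc k)) \<cdot>\<^bsub>D\<^esub> quot_map k a"

definition tgt_fam :: "nat \<Rightarrow> (nat \<Rightarrow> 'o) \<Rightarrow> bool" where
  "tgt_fam k a \<longleftrightarrow> k \<le> n \<and> obj_family n M a \<and> (\<forall>i\<in>{1..k}. a i = B i)"

lemma ABC_Obj:
  assumes "i \<in> {1..n}"
  shows "A i \<in> Obj (M i)" "B i \<in> Obj (M i)" "C i \<in> Obj (M i)"
proof -
  interpret Mi: abelian_category "M i" using M_abelian assms .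
  show "A i \<in> Obj (M i)" "B i \<in> Obj (M i)" "C i \<in> Obj (M i)"
    using Mi.Hom_Obj[OF f_Hom[OF assms]] Mi.Hom_Obj[OF c_Hom[OF assms]] by auto
qed

lemma quot_fam_0 [simp]: "quot_fam 0 a = a"
  by (simp add: quot_fam_def fun_eq_iff)

lemma quot_fam_upd: "k < j \<Longrightarrow> quot_fam k (a(j := X)) = (quot_fam k a)(j := X)"
  by (auto simp: quot_fam_def fun_eq_iff)

lemma quot_fam_Suc: "quot_fam (Suc k) a = (quot_fam k a)(Suc k := C (Suc k))"
  by (auto simp: quot_fam_def fun_eq_iff)

lemma tgt_famD:
  assumes "tgt_fam k a"
  shows "obj_family n M a" "k \<le> n" "\<And>i. i \<in> {1..k} \<Longrightarrow> a i = B i"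
    "\<And>i. i \<in> {1..k} \<Longrightarrow> a(i := B i) = a"
    "obj_family n M (quot_fam k a)"
  using assms ABC_Obj by (auto simp: tgt_fam_def quot_fam_def obj_family_def)

lemma tgt_fam_Suc: "tgt_fam (Suc k) a \<Longrightarrow> tgt_fam k a \<and> a (Suc k) = B (Suc k) \<and> a(Suc k := B (Suc k)) = a"
  by (auto simp: tgt_fam_def)

lemma tgt_fam_upd: "\<lbrakk>tgt_fam k a; k < j; j \<le> n; X \<in> Obj (M j)\<rbrakk> \<Longrightarrow> tgt_fam k (a(j := X))"
  by (auto simp: tgt_fam_def obj_family_upd)

lemma quot_fam_upd_B: "tgt_fam (Suc k) a \<Longrightarrow> (quot_fam k a)(Suc k := B (Suc k)) = quot_fam k a"
  using tgt_fam_Suc[of k a] by (auto simp: quot_fam_def fun_eq_iff)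

lemma step_Hom:
  assumes "tgt_fam (Suc k) a"
  shows "ar (quot_fam k a) (Suc k) (c (Suc k)) \<in> Hom D (ob (quot_fam k a)) (ob (quot_fam (Suc k) a))"
proof -
  have "Suc k \<in> {1..n}" using assms by (simp add: tgt_fam_def)
  then show ?thesis
    using ar_in_Hom[OF tgt_famD(5) _ c_Hom] tgt_fam_Suc[OF assms] quot_fam_upd_B[OF assms] by (metis quot_fam_Suc)
qed

text \<open>The locale types arrows only; the object is recovered from the image of an identity in
  slot 1, which must exist.\<close>

lemma ob_Obj:
  assumes "obj_family n M a" "n \<ge> 1"
  shows "ob a \<in> Obj D"
proof -
  have 1: "1 \<in> {1..n}" using assms by simp
  interpret M1: abelian_category "M 1" using M_abelian 1 by blast
  have "ar a 1 (Ide (M 1) (a 1)) \<in> Hom D (ob (a(1 := a 1))) (ob (a(1 := a 1)))"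
    using ar_in_Hom[OF assms(1) 1] M1.Ide_in_Hom obj_familyD[OF assms(1) 1] by blast
  then show ?thesis using D.Hom_Obj by auto
qed

lemma quot_map_in_Hom:
  assumes "n \<ge> 1" "tgt_fam k a"
  shows "quot_map k a \<in> Hom D (ob a) (ob (quot_fam k a))"
  using assms(2)
proof (induction k)
  case 0
  then show ?case using ob_Obj[OF _ assms(1)] by (auto simp: tgt_fam_def intro: D.Ide_in_Hom)
next
  case (Suc k)
  then show ?case using D.Comp_in_Hom[OF _ step_Hom[OF Suc.prems]] tgt_fam_Suc[OF Suc.prems] by auto
qed

text \<open>The slots up to k, where the quotient map acts, are disjoint from slot j, so
  \<open>u\<close> moves past one \<open>c i\<close> at a time by interchange.\<close>

lemma quot_map_natural:
  assumes "n \<ge> 1" "tgt_fam k a" "k < j" "j \<le> n" and u: "u \<in> Hom (M j) X Y"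
  shows "ar (quot_fam k a) j u \<cdot>\<^bsub>D\<^esub> quot_map k (a(j := X)) = quot_map k (a(j := Y)) \<cdot>\<^bsub>D\<^esub> ar a j u"
  using assms(2,3)
proof (induction k)
  case 0
  have "ar a j u \<in> Hom D (ob (a(j := X))) (ob (a(j := Y)))"
    using ar_in_Hom[OF tgt_famD(1)[OF 0(1)] _ u] assms 0 by simp
  from D.Comp_Ide[OF this] D.Ide_Comp[OF this] show ?case by (simp add: fun_upd_def)
next
  case (Suc k)
  interpret Mj: abelian_category "M j" using M_abelian Suc.prems assms by simp
  let ?m = "Suc k" and ?e = "quot_fam k a"
  have a: "tgt_fam k a" using tgt_fam_Suc[OF Suc.prems(1)] by simp
  have m: "?m \<in> {1..n}" and j: "j \<in> {1..n}" and kj: "k < j" and mj: "?m \<noteq> j" using Suc.prems assms(4) by auto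
  have XY: "X \<in> Obj (M j)" "Y \<in> Obj (M j)" using Mj.Hom_Obj[OF u] by auto
  have aX: "tgt_fam k (a(j := X))" "tgt_fam ?m (a(j := X))" and aY: "tgt_fam k (a(j := Y))" "tgt_fam ?m (a(j := Y))"
    using tgt_fam_upd a Suc.prems kj assms(4) XY by auto
  note eobj = tgt_famD(5)[OF a]
  note qX = quot_map_in_Hom[OF assms(1) aX(1)] and qY = quot_map_in_Hom[OF assms(1) aY(1)]
  have eX: "quot_fam k (a(j := X)) = ?e(j := X)" and eY: "quot_fam k (a(j := Y)) = ?e(j := Y)" using quot_fam_upd kj by auto
  have e'X: "quot_fam ?m (a(j := X)) = (quot_fam ?m a)(j := X)" using quot_fam_upd Suc.prems by auto
  have e'obj: "obj_family n M (quot_fam ?m a)" using tgt_famD(5)[OF Suc.prems(1)] .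
  note u1 = ar_in_Hom[OF eobj j u] and u2 = ar_in_Hom[OF e'obj j u] and u3 = ar_in_Hom[OF tgt_famD(1)[OF a] j u]
  note sX = step_Hom[OF aX(2)] and sY = step_Hom[OF aY(2)]
  have int: "ar (quot_fam ?m a) j u \<cdot>\<^bsub>D\<^esub> ar (?e(j := X)) ?m (c ?m) = ar (?e(j := Y)) ?m (c ?m) \<cdot>\<^bsub>D\<^esub> ar ?e j u"
    using ar_interchange[OF eobj m j mj c_Hom[OF m] u] quot_fam_upd_B[OF Suc.prems(1)] by (simp add: quot_fam_Suc)
  have "ar (quot_fam ?m a) j u \<cdot>\<^bsub>D\<^esub> quot_map ?m (a(j := X))
      = (ar (quot_fam ?m a) j u \<cdot>\<^bsub>D\<^esub> ar (?e(j := X)) ?m (c ?m)) \<cdot>\<^bsub>D\<^esub> quot_map k (a(j := X))"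
    using D.Comp_assoc[OF qX sX, of "ar (quot_fam ?m a) j u"] u2 by (simp add: eX e'X)
  also have "\<dots> = ar (?e(j := Y)) ?m (c ?m) \<cdot>\<^bsub>D\<^esub> ar ?e j u \<cdot>\<^bsub>D\<^esub> quot_map k (a(j := X))"
    using D.Comp_assoc[OF qX[unfolded eX] u1 sY[unfolded eY]] int by simp
  also have "\<dots> = ar (?e(j := Y)) ?m (c ?m) \<cdot>\<^bsub>D\<^esub> quot_map k (a(j := Y)) \<cdot>\<^bsub>D\<^esub> ar a j u"
    by (simp only: Suc.IH[OF a kj])
  also have "\<dots> = quot_map ?m (a(j := Y)) \<cdot>\<^bsub>D\<^esub> ar a j u"
    using D.Comp_assoc[OF u3 qY sY] by (simp add: eY)
  finally show ?case .
qed

lemma quot_map_epi: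
  assumes "n \<ge> 1" "tgt_fam k a"
  shows "is_epi D (quot_map k a)"
  using assms(2)
proof (induction k)
  case 0
  then show ?case using ob_Obj[OF _ assms(1)] by (auto simp: tgt_fam_def intro: D.epi_Ide)
next
  case (Suc k)
  have a: "tgt_fam k a" using tgt_fam_Suc[OF Suc.prems] by simp
  have m: "Suc k \<in> {1..n}" using Suc.prems by (simp add: tgt_fam_def)
  interpret Mj: abelian_category "M (Suc k)" using M_abelian m by blast
  have "is_epi D (ar (quot_fam k a) (Suc k) (c (Suc k)))"
    by (rule ar_epi[OF tgt_famD(5)[OF a] m Mj.cokernel_epi[OF c_cokernel[OF m]]])
  then show ?case
    using D.epi_Comp[OF Suc.IH[OF a] _ quot_map_in_Hom[OF assms(1) a] step_Hom[OF Suc.prems]] by simp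
qed

lemma ar_f_in_Hom:
  assumes "tgt_fam k a" "i \<in> {1..k}"
  shows "ar a i (f i) \<in> Hom D (ob (a(i := A i))) (ob a)"
proof -
  have i: "i \<in> {1..n}" using assms by (auto simp: tgt_fam_def)
  show ?thesis using ar_in_Hom[OF tgt_famD(1)[OF assms(1)] i f_Hom[OF i]] tgt_famD(4)[OF assms] by simp
qed

lemma c_f_Zero:
  assumes "i \<in> {1..n}"
  shows "c i \<cdot>\<^bsub>M i\<^esub> f i = Zero (M i) (A i) (C i)"
  using c_cokernel[OF assms] f_Hom[OF assms] c_Hom[OF assms]
  unfolding is_cokernel_def by (elim conjE) (simp add: Hom_def)

text \<open>For the last slot, naturality carries \<open>f\<close> past the earlier quotient maps
  until it meets its own \<open>c\<close>, and c f = 0. Earlier slots are killed already by the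
  shorter quotient map.\<close>

lemma quot_map_ar_Zero:
  assumes "n \<ge> 1" "tgt_fam k a" "i \<in> {1..k}"
  shows "quot_map k a \<cdot>\<^bsub>D\<^esub> ar a i (f i) = Zero D (ob (a(i := A i))) (ob (quot_fam k a))"
  using assms(2,3)
proof (induction k)
  case (Suc k)
  have a: "tgt_fam k a" using tgt_fam_Suc[OF Suc.prems(1)] by simp
  let ?m = "Suc k" and ?e = "quot_fam k a"
  have m: "?m \<in> {1..n}" using Suc.prems by (simp add: tgt_fam_def)
  note q = quot_map_in_Hom[OF assms(1) a] and s = step_Hom[OF Suc.prems(1)] and af = ar_f_in_Hom[OF Suc.prems]
  have obj: "ob (a(i := A i)) \<in> Obj D" "ob (quot_fam ?m a) \<in> Obj D" using D.Hom_Obj[OF af] D.Hom_Obj[OF s] by auto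
  have *: "quot_map ?m a \<cdot>\<^bsub>D\<^esub> ar a i (f i) = ar ?e ?m (c ?m) \<cdot>\<^bsub>D\<^esub> quot_map k a \<cdot>\<^bsub>D\<^esub> ar a i (f i)"
    using D.Comp_assoc[OF af q s] by simp
  show ?case
  proof (cases "i = ?m")
    case False
    then have "i \<in> {1..k}" using Suc.prems by auto
    from * Suc.IH[OF a this] D.Comp_Zero[OF s obj(1)] show ?thesis by (simp add: fun_upd_def)
  next
    case True
    let ?A = "a(?m := A ?m)"
    have fa: "tgt_fam k ?A" using tgt_fam_upd[OF a] m ABC_Obj(1)[OF m] by simp
    have am: "a(?m := B ?m) = a" using tgt_fam_Suc[OF Suc.prems(1)] by simp
    have eA: "ar ?e ?m (f ?m) \<in> Hom D (ob (quot_fam k ?A)) (ob ?e)"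
      using ar_in_Hom[OF tgt_famD(5)[OF a] m f_Hom[OF m]] quot_fam_upd_B[OF Suc.prems(1)] quot_fam_upd[of k ?m a] by simp
    have "quot_map k a \<cdot>\<^bsub>D\<^esub> ar a ?m (f ?m) = ar ?e ?m (f ?m) \<cdot>\<^bsub>D\<^esub> quot_map k ?A"
      using quot_map_natural[OF assms(1) a _ _ f_Hom[OF m]] m am by simp
    then have "quot_map ?m a \<cdot>\<^bsub>D\<^esub> ar a i (f i) = (ar ?e ?m (c ?m) \<cdot>\<^bsub>D\<^esub> ar ?e ?m (f ?m)) \<cdot>\<^bsub>D\<^esub> quot_map k ?A"
      using * True D.Comp_assoc[OF quot_map_in_Hom[OF assms(1) fa] eA s] by simp
    also have "ar ?e ?m (c ?m) \<cdot>\<^bsub>D\<^esub> ar ?e ?m (f ?m) = Zero D (ob (quot_fam k ?A)) (ob (quot_fam ?m a))"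
      using ar_Comp[OF tgt_famD(5)[OF a] m f_Hom[OF m] c_Hom[OF m]] c_f_Zero[OF m]
        ar_Zero[OF tgt_famD(5)[OF a] m ABC_Obj(1)[OF m] ABC_Obj(3)[OF m]] quot_fam_upd[of k ?m a] by (simp add: quot_fam_Suc)
    finally show ?thesis using D.Zero_Comp[OF quot_map_in_Hom[OF assms(1) fa] obj(2)] True by (simp add: fun_upd_def)
  qed
qed simp

text \<open>With \<open>quot_map_epi\<close> and \<open>quot_map_ar_Zero\<close> this makes
  F(\<open>C 1\<close>, ..., \<open>C k\<close>, ...) the joint cokernel of the face maps. One slot
  is peeled off at a time: the vanishing condition descends along the epic quotient map of the
  earlier slots, and right exactness in the new slot applies.\<close>

lemma quot_map_factor:
  assumes "n \<ge> 1" "tgt_fam k a" and d: "d \<in> Hom D (ob a) T"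
    and "\<forall>i\<in>{1..k}. d \<cdot>\<^bsub>D\<^esub> ar a i (f i) = Zero D (ob (a(i := A i))) T"
  shows "\<exists>e\<in>Hom D (ob (quot_fam k a)) T. e \<cdot>\<^bsub>D\<^esub> quot_map k a = d"
  using assms(2,4)
proof (induction k)
  case 0
  then show ?case using d D.Comp_Ide[OF d] by auto
next
  case (Suc k)
  have a: "tgt_fam k a" using tgt_fam_Suc[OF Suc.prems(1)] by simp
  let ?m = "Suc k" and ?e = "quot_fam k a"
  have m: "?m \<in> {1..n}" using Suc.prems by (simp add: tgt_fam_def)
  obtain e where e: "e \<in> Hom D (ob ?e) T" "e \<cdot>\<^bsub>D\<^esub> quot_map k a = d"
    using Suc.IH[OF a] Suc.prems(2) by (auto simp: fun_upd_def)
  let ?A = "a(?m := A ?m)"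
  have fa: "tgt_fam k ?A" using tgt_fam_upd[OF a] m ABC_Obj(1)[OF m] by simp
  have am: "a(?m := B ?m) = a" using tgt_fam_Suc[OF Suc.prems(1)] by simp
  note q = quot_map_in_Hom[OF assms(1) a] and qA = quot_map_in_Hom[OF assms(1) fa] and s = step_Hom[OF Suc.prems(1)]
  have eA: "ar ?e ?m (f ?m) \<in> Hom D (ob (quot_fam k ?A)) (ob ?e)"
    using ar_in_Hom[OF tgt_famD(5)[OF a] m f_Hom[OF m]] quot_fam_upd_B[OF Suc.prems(1)] quot_fam_upd[of k ?m a] by simp
  have nat: "ar ?e ?m (f ?m) \<cdot>\<^bsub>D\<^esub> quot_map k ?A = quot_map k a \<cdot>\<^bsub>D\<^esub> ar a ?m (f ?m)"
    using quot_map_natural[OF assms(1) a _ _ f_Hom[OF m]] m am by simp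
  have af: "ar a ?m (f ?m) \<in> Hom D (ob ?A) (ob a)" using ar_f_in_Hom[OF Suc.prems(1)] m by simp
  have "(e \<cdot>\<^bsub>D\<^esub> ar ?e ?m (f ?m)) \<cdot>\<^bsub>D\<^esub> quot_map k ?A = d \<cdot>\<^bsub>D\<^esub> ar a ?m (f ?m)"
    using D.Comp_assoc[OF qA eA e(1)] D.Comp_assoc[OF af q e(1)] nat e(2) by simp
  also have "\<dots> = Zero D (ob ?A) T" using Suc.prems(2) by (simp add: fun_upd_def)
  finally have "e \<cdot>\<^bsub>D\<^esub> ar ?e ?m (f ?m) = Zero D (ob (quot_fam k ?A)) T"
    using D.epi_Zero[OF quot_map_epi[OF assms(1) fa] qA D.Comp_in_Hom[OF eA e(1)]] by simp
  then obtain e' where e': "e' \<in> Hom D (ob (quot_fam ?m a)) T" "e' \<cdot>\<^bsub>D\<^esub> ar ?e ?m (c ?m) = e"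
    by (rule D.cokernel_factor[OF ar_cokernel[OF tgt_famD(5)[OF a] m c_cokernel[OF m]] eA s e(1)])
  then show ?case using D.Comp_assoc[OF q s e'(1)] e(2) by auto
qed

end

section \<open>Compatible families on the faces and their extension\<close>

context split_cube
begin

text \<open>A cocone on the punctured cube, given by its values on the faces and agreement on
  pairwise intersections.\<close>

definition compatible :: "nat \<Rightarrow> (nat \<Rightarrow> 'o) \<Rightarrow> 'p \<Rightarrow> (nat \<Rightarrow> 'q) \<Rightarrow> bool" where
  "compatible k a T g \<longleftrightarrow> (\<forall>i\<in>{1..k}. g i \<in> Hom D (ob (a(i := A i))) T) \<and>
     (\<forall>i\<in>{1..k}. \<forall>j\<in>{1..k}. i \<noteq> j \<longrightarrow>
        g i \<cdot>\<^bsub>D\<^esub> ar (a(i := A i)) j (f j) = g j \<cdot>\<^bsub>D\<^esub> ar (a(j := A j)) i (f i))"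

definition extends :: "nat \<Rightarrow> (nat \<Rightarrow> 'o) \<Rightarrow> 'p \<Rightarrow> (nat \<Rightarrow> 'q) \<Rightarrow> 'p \<Rightarrow> 'q \<Rightarrow> 'q \<Rightarrow> bool" where
  "extends k a T g T' t h \<longleftrightarrow> t \<in> Hom D T T' \<and> is_mono D t \<and> h \<in> Hom D (ob a) T' \<and>
     (\<forall>i\<in>{1..k}. h \<cdot>\<^bsub>D\<^esub> ar a i (f i) = t \<cdot>\<^bsub>D\<^esub> g i)"

text \<open>
  With \<open>Q\<close> a cofibrant cover of \<open>B\<^sub>j\<close> and \<open>K\<close> its pullback along \<open>f\<^sub>j\<close>, the induction hypothesis gives
  \<open>h1\<close> on \<open>F(\<dots>, Q, \<dots>)\<close>. Its error \<open>d\<close> on \<open>F(\<dots>, K, \<dots>)\<close> factors through the cokernels \<open>C\<^sub>i\<close>, where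
  \<open>K \<rightarrow> Q\<close> induces a monomorphism, so a pushout extends it to \<open>e2\<close>. The corrected map
  \<open>h2\<close> kills the kernel of \<open>Q \<rightarrow> B\<^sub>j\<close> and descends.
\<close>

lemma extend_step:
  assumes n: "n \<ge> 1" and tgt_fam: "tgt_fam (Suc k) a" and cof: "\<forall>i\<in>{Suc k<..n}. a i \<in> \<D> i"
    and comp: "compatible (Suc k) a T g"
    and Q: "Q \<in> \<D> (Suc k)" and p: "p \<in> Hom (M (Suc k)) Q (B (Suc k))" "is_epi (M (Suc k)) p"
    and IH: "compatible k (a(Suc k := Q)) T (\<lambda>i. g i \<cdot>\<^bsub>D\<^esub> ar (a(i := A i)) (Suc k) p)
      \<Longrightarrow> \<exists>T' t h. extends k (a(Suc k := Q)) T (\<lambda>i. g i \<cdot>\<^bsub>D\<^esub> ar (a(i := A i)) (Suc k) p) T' t h"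
  shows "\<exists>T' t h. extends (Suc k) a T g T' t h"
proof -
  let ?j = "Suc k" and ?aQ = "a(Suc k := Q)"
  let ?g' = "\<lambda>i. g i \<cdot>\<^bsub>D\<^esub> ar (a(i := A i)) ?j p"
  have j: "?j \<in> {1..n}" using tgt_fam by (simp add: tgt_fam_def)
  interpret Mj: abelian_category "M ?j" using M_abelian j by blast
  have famk: "tgt_fam k a" and aj: "a(?j := B ?j) = a" "a ?j = B ?j" using tgt_fam_Suc[OF tgt_fam] by auto
  note aobj = tgt_famD(1)[OF tgt_fam]
  have kn: "i \<in> {1..n}" "i \<noteq> ?j" "i \<in> {1..Suc k}" if "i \<in> {1..k}" for i using that j by auto
  have aiB: "a(i := B i) = a" if "i \<in> {1..k}" for i using tgt_famD(4)[OF famk that] .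
  have aAobj: "obj_family n M (a(i := A i))" if "i \<in> {1..k}" for i
    using obj_family_upd[OF aobj ABC_Obj(1)] kn[OF that] by simp
  have gH: "g i \<in> Hom D (ob (a(i := A i))) T" if "i \<in> {1..Suc k}" for i
    using comp that by (simp add: compatible_def)
  have gcomp: "g i \<cdot>\<^bsub>D\<^esub> ar (a(i := A i)) l (f l) = g l \<cdot>\<^bsub>D\<^esub> ar (a(l := A l)) i (f i)"
    if "i \<in> {1..Suc k}" "l \<in> {1..Suc k}" "i \<noteq> l" for i l
    using comp that by (simp add: compatible_def)
  have TO: "T \<in> Obj D" using D.Hom_Obj[OF gH[of ?j]] by simp
  have Hj: "ar a ?j v \<in> Hom D (ob (a(?j := Y))) (ob (a(?j := Y')))" if "v \<in> Hom (M ?j) Y Y'" for v Y Y'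
    using ar_in_Hom[OF aobj j that] .
  have HAj: "ar (a(i := A i)) ?j v \<in> Hom D (ob (a(?j := Y, i := A i))) (ob (a(?j := Y', i := A i)))"
    if "i \<in> {1..k}" "v \<in> Hom (M ?j) Y Y'" for i v Y Y'
    using ar_in_Hom[OF aAobj[OF that(1)] j that(2)] fun_upd_twist[OF kn(2)[OF that(1)], of a] by simp
  have aAB: "a(?j := B ?j, i := A i) = a(i := A i)" for i using aj by simp
  have Hf: "ar (a(?j := Y)) i (f i) \<in> Hom D (ob (a(?j := Y, i := A i))) (ob (a(?j := Y)))"
    if "i \<in> {1..k}" "Y \<in> Obj (M ?j)" for i Y
    using ar_f_in_Hom[OF tgt_fam_upd[OF famk, of ?j Y]] that j by simp
  have nat: "ar a ?j v \<cdot>\<^bsub>D\<^esub> ar (a(?j := Y)) i (f i) = ar (a(?j := Y')) i (f i) \<cdot>\<^bsub>D\<^esub> ar (a(i := A i)) ?j v"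
    if "i \<in> {1..k}" "v \<in> Hom (M ?j) Y Y'" for i v Y Y'
    using ar_interchange[OF aobj kn(1)[OF that(1)] j kn(2)[OF that(1)] f_Hom[OF kn(1)[OF that(1)]] that(2)]
      aiB[OF that(1)] by simp
  have Q': "Q \<in> Obj (M ?j)" using Q \<D>_Obj[OF j] by blast
  have "compatible k ?aQ T ?g'"
    unfolding compatible_def
  proof (intro conjI ballI impI)
    fix i assume i: "i \<in> {1..k}"
    show "?g' i \<in> Hom D (ob (?aQ(i := A i))) T"
      using D.Comp_in_Hom[OF HAj[OF i p(1), unfolded aAB] gH[OF kn(3)[OF i]]] .
    \<comment> \<open>Moving p past \<open>f y\<close> leaves a composite on the double face, and
      there \<open>gcomp\<close> makes the two orders agree.\<close>
    have half: "?g' x \<cdot>\<^bsub>D\<^esub> ar (?aQ(x := A x)) y (f y)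
      = (g x \<cdot>\<^bsub>D\<^esub> ar (a(x := A x)) y (f y)) \<cdot>\<^bsub>D\<^esub> ar (a(x := A x, y := A y)) ?j p"
      if x: "x \<in> {1..k}" and y: "y \<in> {1..k}" and xy: "x \<noteq> y" for x y
    proof -
      let ?a = "a(x := A x)"
      note xo = aAobj[OF x]
      have e1: "?a(y := B y) = ?a" using aiB[OF y] xy by (metis fun_upd_twist)
      have e2: "?a(?j := B ?j) = ?a" using aAB[of x] fun_upd_twist[OF kn(2)[OF x]] by metis
      have e3: "?aQ(x := A x) = ?a(?j := Q)" using fun_upd_twist[OF kn(2)[OF x]] by metis
      have int: "ar ?a ?j p \<cdot>\<^bsub>D\<^esub> ar (?a(?j := Q)) y (f y) = ar ?a y (f y) \<cdot>\<^bsub>D\<^esub> ar (?a(y := A y)) ?j p"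
        using ar_interchange[OF xo kn(1)[OF y] j kn(2)[OF y] f_Hom[OF kn(1)[OF y]] p(1)]
        by (simp only: e1 e2)
      have xoQ: "obj_family n M (?a(?j := Q))" using obj_family_upd[OF xo Q'] .
      have xoA: "obj_family n M (?a(y := A y))" using obj_family_upd[OF xo ABC_Obj(1)[OF kn(1)[OF y]]] .
      have h1: "ar ?a ?j p \<in> Hom D (ob (?a(?j := Q))) (ob ?a)" using ar_in_Hom[OF xo j p(1)] by (simp only: e2)
      have "?a(?j := Q, y := B y) = ?a(?j := Q)" using e1 fun_upd_twist[OF kn(2)[OF y]] by metis
      then have h2: "ar (?a(?j := Q)) y (f y) \<in> Hom D (ob (?a(?j := Q, y := A y))) (ob (?a(?j := Q)))"
        using ar_in_Hom[OF xoQ kn(1)[OF y] f_Hom[OF kn(1)[OF y]]] by simp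
      have h3: "ar ?a y (f y) \<in> Hom D (ob (?a(y := A y))) (ob ?a)"
        using ar_in_Hom[OF xo kn(1)[OF y] f_Hom[OF kn(1)[OF y]]] by (simp only: e1)
      have "?a(y := A y, ?j := B ?j) = ?a(y := A y)" using e2 fun_upd_twist[OF kn(2)[OF y]] by metis
      then have h4: "ar (?a(y := A y)) ?j p \<in> Hom D (ob (?a(y := A y, ?j := Q))) (ob (?a(y := A y)))"
        using ar_in_Hom[OF xoA j p(1)] by simp
      note gx = gH[OF kn(3)[OF x]]
      show ?thesis
        using D.Comp_assoc[OF h2 h1 gx] D.Comp_assoc[OF h4 h3 gx] int by (simp only: e3)
    qed
    fix l assume l: "l \<in> {1..k}" and il: "i \<noteq> l"
    show "?g' i \<cdot>\<^bsub>D\<^esub> ar (?aQ(i := A i)) l (f l) = ?g' l \<cdot>\<^bsub>D\<^esub> ar (?aQ(l := A l)) i (f i)"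
      using half[OF i l il] half[OF l i il[symmetric]] gcomp[OF kn(3)[OF i] kn(3)[OF l] il]
        fun_upd_twist[OF il, of a "A i" "A l"] by simp
  qed
  from IH[OF this] obtain T1 t1 h1 where t1: "t1 \<in> Hom D T T1" "is_mono D t1"
    and h1: "h1 \<in> Hom D (ob ?aQ) T1"
    and h1f: "\<And>i. i \<in> {1..k} \<Longrightarrow> h1 \<cdot>\<^bsub>D\<^esub> ar ?aQ i (f i) = t1 \<cdot>\<^bsub>D\<^esub> g i \<cdot>\<^bsub>D\<^esub> ar (a(i := A i)) ?j p"
    unfolding extends_def by blast
  obtain K r s where r: "r \<in> Hom (M ?j) K Q" and s: "s \<in> Hom (M ?j) K (A ?j)"
    and fs: "f ?j \<cdot>\<^bsub>M ?j\<^esub> s = p \<cdot>\<^bsub>M ?j\<^esub> r" and s_epi: "is_epi (M ?j) s"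
    and ex: "short_exact (M ?j) r (c ?j \<cdot>\<^bsub>M ?j\<^esub> p)"
    by (rule Mj.pullback_short_exact[OF f_Hom[OF j] f_mono[OF j] c_Hom[OF j] c_cokernel[OF j] p])
  have KO: "K \<in> Obj (M ?j)" and AO: "A ?j \<in> Obj (M ?j)" using Mj.Hom_Obj[OF r] ABC_Obj(1)[OF j] by auto
  note Rr = Hj[OF r] and Rs = Hj[OF s] and gj = gH[of ?j, simplified]
  have Rp: "ar a ?j p \<in> Hom D (ob ?aQ) (ob a)" using Hj[OF p(1)] by (simp only: aj)
  have Rf: "ar a ?j (f ?j) \<in> Hom D (ob (a(?j := A ?j))) (ob a)" using Hj[OF f_Hom[OF j]] by (simp only: aj)
  have t1g: "t1 \<cdot>\<^bsub>D\<^esub> g i \<in> Hom D (ob (a(i := A i))) T1" if "i \<in> {1..Suc k}" for i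
    using D.Comp_in_Hom[OF gH[OF that] t1(1)] .
  note t1gj = t1g[of ?j, simplified]
  \<comment> \<open>On K there are two candidates: h1 restricted along r, and the prescribed map on
    the face \<open>A ?j\<close> pulled back along s. Their difference d is the error.\<close>
  define d1 where "d1 = h1 \<cdot>\<^bsub>D\<^esub> ar a ?j r"
  define d2 where "d2 = t1 \<cdot>\<^bsub>D\<^esub> g ?j \<cdot>\<^bsub>D\<^esub> ar a ?j s"
  have d1: "d1 \<in> Hom D (ob (a(?j := K))) T1" using D.Comp_in_Hom[OF Rr h1] by (simp add: d1_def)
  have gs: "g ?j \<cdot>\<^bsub>D\<^esub> ar a ?j s \<in> Hom D (ob (a(?j := K))) T" using D.Comp_in_Hom[OF Rs gj] .
  have d2: "d2 \<in> Hom D (ob (a(?j := K))) T1" using D.Comp_in_Hom[OF gs t1(1)] by (simp add: d2_def)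
  define d where "d = d1 \<ominus>\<^sub>a\<^bsub>D\<^esub> d2"
  have d: "d \<in> Hom D (ob (a(?j := K))) T1" unfolding d_def using D.Minus_in_Hom[OF d1 d2] .
  have famK: "tgt_fam k (a(?j := K))" using tgt_fam_upd[OF famk] j KO by simp
  \<comment> \<open>On the face \<open>A i\<close> the map h1 is given by \<open>g i\<close> through
    p. Since p r = f s, compatibility of \<open>g i\<close> with \<open>g ?j\<close> turns the
    restriction of d1 into that of d2.\<close>
  have "\<forall>i\<in>{1..k}. d \<cdot>\<^bsub>D\<^esub> ar (a(?j := K)) i (f i) = Zero D (ob (a(?j := K, i := A i))) T1"
  proof
    fix i assume i: "i \<in> {1..k}"
    let ?F = "ar (a(?j := K)) i (f i)"
    note F = Hf[OF i KO] and Ar = HAj[OF i r] and As = HAj[OF i s] and gi = gH[OF kn(3)[OF i]]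
    note Ap = HAj[OF i p(1), unfolded aAB] and Af = HAj[OF i f_Hom[OF j], unfolded aAB]
    have "d1 \<cdot>\<^bsub>D\<^esub> ?F = h1 \<cdot>\<^bsub>D\<^esub> ar ?aQ i (f i) \<cdot>\<^bsub>D\<^esub> ar (a(i := A i)) ?j r"
      using D.Comp_assoc[OF F Rr h1] nat[OF i r] by (simp add: d1_def)
    also have "\<dots> = (t1 \<cdot>\<^bsub>D\<^esub> g i \<cdot>\<^bsub>D\<^esub> ar (a(i := A i)) ?j p) \<cdot>\<^bsub>D\<^esub> ar (a(i := A i)) ?j r"
      using D.Comp_assoc[OF Ar Hf[OF i Q'] h1] h1f[OF i] by simp
    also have "\<dots> = t1 \<cdot>\<^bsub>D\<^esub> g i \<cdot>\<^bsub>D\<^esub> ar (a(i := A i)) ?j (p \<cdot>\<^bsub>M ?j\<^esub> r)"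
      using D.Comp_assoc[OF Ar D.Comp_in_Hom[OF Ap gi] t1(1)] D.Comp_assoc[OF Ar Ap gi]
        ar_Comp[OF aAobj[OF i] j r p(1)] by simp
    also have "\<dots> = t1 \<cdot>\<^bsub>D\<^esub> (g i \<cdot>\<^bsub>D\<^esub> ar (a(i := A i)) ?j (f ?j)) \<cdot>\<^bsub>D\<^esub> ar (a(i := A i)) ?j s"
      using D.Comp_assoc[OF As Af gi] ar_Comp[OF aAobj[OF i] j s f_Hom[OF j]] fs by simp
    also have "\<dots> = t1 \<cdot>\<^bsub>D\<^esub> (g ?j \<cdot>\<^bsub>D\<^esub> ar (a(?j := A ?j)) i (f i)) \<cdot>\<^bsub>D\<^esub> ar (a(i := A i)) ?j s"
      using gcomp[of i ?j] kn[OF i] by simp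
    also have "\<dots> = t1 \<cdot>\<^bsub>D\<^esub> (g ?j \<cdot>\<^bsub>D\<^esub> ar a ?j s) \<cdot>\<^bsub>D\<^esub> ?F"
      using D.Comp_assoc[OF As Hf[OF i AO] gj] D.Comp_assoc[OF F Rs gj] nat[OF i s] by simp
    also have "\<dots> = d2 \<cdot>\<^bsub>D\<^esub> ?F" using D.Comp_assoc[OF F gs t1(1)] by (simp add: d2_def)
    finally have "d1 \<cdot>\<^bsub>D\<^esub> ?F = d2 \<cdot>\<^bsub>D\<^esub> ?F" .
    then show "d \<cdot>\<^bsub>D\<^esub> ?F = Zero D (ob (a(?j := K, i := A i))) T1"
      using D.Minus_Comp[OF F d1 d2] D.Minus_self[OF D.Comp_in_Hom[OF F d2]] by (simp add: d_def)
  qed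
  from quot_map_factor[OF n famK d this]
  obtain e where e: "e \<in> Hom D (ob (quot_fam k (a(?j := K)))) T1" "e \<cdot>\<^bsub>D\<^esub> quot_map k (a(?j := K)) = d" by blast
  have famQ: "tgt_fam k ?aQ" using tgt_fam_upd[OF famk] j Q' by simp
  let ?w = "ar (quot_fam k a) ?j r"
  have w: "?w \<in> Hom D (ob (quot_fam k (a(?j := K)))) (ob (quot_fam k ?aQ))"
    using ar_in_Hom[OF tgt_famD(5)[OF famk] j r] by (simp only: quot_fam_upd[of k ?j] lessI)
  have "Cod (M ?j) (c ?j \<cdot>\<^bsub>M ?j\<^esub> p) = C ?j"
    using Mj.Comp_in_Hom[OF p(1) c_Hom[OF j]] by (simp add: Hom_def)
  \<comment> \<open>The only use of \<open>split\<close>: the slots below \<open>?j\<close> hold C,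
    those above are in \<D> by \<open>cof\<close>, and the sequence starting with r ends in
    \<open>C ?j\<close>.\<close>
  then have wmono: "is_mono D ?w"
    using cof C_\<D> C_\<D>[OF j] j by (intro split[OF j _ ex]) (auto simp: quot_fam_def)
  obtain T2 t2 e2 where t2: "t2 \<in> Hom D T1 T2" and e2: "e2 \<in> Hom D (ob (quot_fam k ?aQ)) T2"
    and e2w: "e2 \<cdot>\<^bsub>D\<^esub> ?w = t2 \<cdot>\<^bsub>D\<^esub> e" and t2_mono: "is_mono D t2"
    by (rule D.pushout_of_mono[OF w e(1) wmono])
  note qQ = quot_map_in_Hom[OF n famQ] and qK = quot_map_in_Hom[OF n famK]
  define t where "t = t2 \<cdot>\<^bsub>D\<^esub> t1"
  have t: "t \<in> Hom D T T2" "is_mono D t"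
    using D.Comp_in_Hom[OF t1(1) t2] D.mono_Comp[OF t1(2) t2_mono t1(1) t2] by (simp_all add: t_def)
  note x1 = D.Comp_in_Hom[OF h1 t2] and x2 = D.Comp_in_Hom[OF qQ e2]
  \<comment> \<open>The subtracted term factors through the quotient map, so it vanishes on the
    faces already fitted. On K it equals t2 d, which replaces d1 by d2.\<close>
  define h2 where "h2 = t2 \<cdot>\<^bsub>D\<^esub> h1 \<ominus>\<^sub>a\<^bsub>D\<^esub> e2 \<cdot>\<^bsub>D\<^esub> quot_map k ?aQ"
  have h2: "h2 \<in> Hom D (ob ?aQ) T2" unfolding h2_def using D.Minus_in_Hom[OF x1 x2] .
  have T2O: "T2 \<in> Obj D" using D.Hom_Obj[OF t2] by simp
  have "h2 \<cdot>\<^bsub>D\<^esub> ar a ?j r = t2 \<cdot>\<^bsub>D\<^esub> d2"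
  proof -
    have "(e2 \<cdot>\<^bsub>D\<^esub> quot_map k ?aQ) \<cdot>\<^bsub>D\<^esub> ar a ?j r = e2 \<cdot>\<^bsub>D\<^esub> ?w \<cdot>\<^bsub>D\<^esub> quot_map k (a(?j := K))"
      using D.Comp_assoc[OF Rr qQ e2] quot_map_natural[OF n famk _ _ r] j by simp
    also have "\<dots> = (t2 \<cdot>\<^bsub>D\<^esub> e) \<cdot>\<^bsub>D\<^esub> quot_map k (a(?j := K))" using D.Comp_assoc[OF qK w e2] e2w by simp
    also have "\<dots> = t2 \<cdot>\<^bsub>D\<^esub> d" using D.Comp_assoc[OF qK e(1) t2] e(2) by simp
    also have "\<dots> = t2 \<cdot>\<^bsub>D\<^esub> d1 \<ominus>\<^sub>a\<^bsub>D\<^esub> t2 \<cdot>\<^bsub>D\<^esub> d2" using D.Comp_Minus[OF d1 d2 t2] by (simp add: d_def)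
    finally have "(e2 \<cdot>\<^bsub>D\<^esub> quot_map k ?aQ) \<cdot>\<^bsub>D\<^esub> ar a ?j r = t2 \<cdot>\<^bsub>D\<^esub> d1 \<ominus>\<^sub>a\<^bsub>D\<^esub> t2 \<cdot>\<^bsub>D\<^esub> d2" .
    moreover have "(t2 \<cdot>\<^bsub>D\<^esub> h1) \<cdot>\<^bsub>D\<^esub> ar a ?j r = t2 \<cdot>\<^bsub>D\<^esub> d1"
      using D.Comp_assoc[OF Rr h1 t2] by (simp add: d1_def)
    ultimately show ?thesis
      using D.Minus_Comp[OF Rr x1 x2] D.Minus_Minus_cancel[OF D.Comp_in_Hom[OF d1 t2] D.Comp_in_Hom[OF d2 t2]]
      by (simp add: h2_def)
  qed
  also have "\<dots> = t \<cdot>\<^bsub>D\<^esub> g ?j \<cdot>\<^bsub>D\<^esub> ar a ?j s"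
    using D.Comp_assoc[OF gs t1(1) t2] by (simp add: d2_def t_def)
  finally have h2r: "h2 \<cdot>\<^bsub>D\<^esub> ar a ?j r = t \<cdot>\<^bsub>D\<^esub> g ?j \<cdot>\<^bsub>D\<^esub> ar a ?j s" .
  have h2f: "h2 \<cdot>\<^bsub>D\<^esub> ar ?aQ i (f i) = t \<cdot>\<^bsub>D\<^esub> g i \<cdot>\<^bsub>D\<^esub> ar (a(i := A i)) ?j p" if i: "i \<in> {1..k}" for i
  proof -
    let ?F = "ar ?aQ i (f i)"
    note F = Hf[OF i Q'] and gi = gH[OF kn(3)[OF i]]
    note Ap = HAj[OF i p(1), unfolded aAB]
    have FO: "ob (?aQ(i := A i)) \<in> Obj D" using D.Hom_Obj[OF F] by simp
    have "(e2 \<cdot>\<^bsub>D\<^esub> quot_map k ?aQ) \<cdot>\<^bsub>D\<^esub> ?F = Zero D (ob (?aQ(i := A i))) T2"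
      using D.Comp_assoc[OF F qQ e2] quot_map_ar_Zero[OF n famQ i] D.Comp_Zero[OF e2 FO] by simp
    moreover have "(t2 \<cdot>\<^bsub>D\<^esub> h1) \<cdot>\<^bsub>D\<^esub> ?F = t \<cdot>\<^bsub>D\<^esub> g i \<cdot>\<^bsub>D\<^esub> ar (a(i := A i)) ?j p"
      using D.Comp_assoc[OF F h1 t2] h1f[OF i] D.Comp_assoc[OF D.Comp_in_Hom[OF Ap gi] t1(1) t2]
      by (simp add: t_def)
    ultimately show ?thesis
      using D.Minus_Comp[OF F x1 x2] D.Minus_Zero[OF D.Comp_in_Hom[OF D.Comp_in_Hom[OF Ap gi] t(1)]]
      by (simp add: h2_def)
  qed
  \<comment> \<open>The kernel of p lies in K, since c p kills it, and s vanishes on it because f s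
    = p r and f is monic. On K the map h2 is defined through s, so it kills F(\<nu>), and F(p) is
    the cokernel of F(\<nu>) by right exactness.\<close>
  obtain \<nu> where \<nu>: "is_kernel (M ?j) p \<nu>" using Mj.ex_kernel p(1) unfolding Hom_def by blast
  obtain N where \<nu>h: "\<nu> \<in> Hom (M ?j) N Q" "p \<cdot>\<^bsub>M ?j\<^esub> \<nu> = Zero (M ?j) N (B ?j)" by (rule Mj.kernelE[OF \<nu> p(1)])
  have NO: "N \<in> Obj (M ?j)" using Mj.Hom_Obj[OF \<nu>h(1)] by simp
  have r_ker: "is_kernel (M ?j) (c ?j \<cdot>\<^bsub>M ?j\<^esub> p) r" using ex by (simp add: short_exact_def)
  have "(c ?j \<cdot>\<^bsub>M ?j\<^esub> p) \<cdot>\<^bsub>M ?j\<^esub> \<nu> = Zero (M ?j) N (C ?j)"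
    using Mj.Comp_assoc[OF \<nu>h(1) p(1) c_Hom[OF j]] \<nu>h(2) Mj.Comp_Zero[OF c_Hom[OF j] NO] by simp
  then obtain \<nu>' where \<nu>': "\<nu>' \<in> Hom (M ?j) N K" "r \<cdot>\<^bsub>M ?j\<^esub> \<nu>' = \<nu>"
    by (rule Mj.kernel_factor[OF r_ker Mj.Comp_in_Hom[OF p(1) c_Hom[OF j]] r \<nu>h(1)])
  have "f ?j \<cdot>\<^bsub>M ?j\<^esub> s \<cdot>\<^bsub>M ?j\<^esub> \<nu>' = Zero (M ?j) N (B ?j)"
    using Mj.Comp_assoc[OF \<nu>'(1) s f_Hom[OF j]] Mj.Comp_assoc[OF \<nu>'(1) r p(1)] fs \<nu>'(2) \<nu>h(2) by simp
  then have s\<nu>: "s \<cdot>\<^bsub>M ?j\<^esub> \<nu>' = Zero (M ?j) N (A ?j)"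
    using Mj.mono_Zero[OF f_mono[OF j] f_Hom[OF j] Mj.Comp_in_Hom[OF \<nu>'(1) s]] by simp
  note R\<nu> = Hj[OF \<nu>'(1)]
  have "h2 \<cdot>\<^bsub>D\<^esub> ar a ?j \<nu> = (h2 \<cdot>\<^bsub>D\<^esub> ar a ?j r) \<cdot>\<^bsub>D\<^esub> ar a ?j \<nu>'"
    using D.Comp_assoc[OF R\<nu> Rr h2] ar_Comp[OF aobj j \<nu>'(1) r] \<nu>'(2) by simp
  also have "\<dots> = t \<cdot>\<^bsub>D\<^esub> g ?j \<cdot>\<^bsub>D\<^esub> ar a ?j (s \<cdot>\<^bsub>M ?j\<^esub> \<nu>')"
    using h2r D.Comp_assoc[OF R\<nu> gs t(1)] D.Comp_assoc[OF R\<nu> Rs gj] ar_Comp[OF aobj j \<nu>'(1) s] by simp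
  also have "\<dots> = Zero D (ob (a(?j := N))) T2"
    using s\<nu> ar_Zero[OF aobj j NO AO] D.Comp_Zero[OF gj] D.Comp_Zero[OF t(1)] D.Hom_Obj[OF R\<nu>] by simp
  finally have h2\<nu>: "h2 \<cdot>\<^bsub>D\<^esub> ar a ?j \<nu> = Zero D (ob (a(?j := N))) T2" .
  have p_cok: "is_cokernel D (ar a ?j \<nu>) (ar a ?j p)"
    by (rule ar_cokernel[OF aobj j Mj.epi_cokernel_of_kernel[OF p(2) \<nu>]])
  obtain h where h: "h \<in> Hom D (ob a) T2" and hp: "h \<cdot>\<^bsub>D\<^esub> ar a ?j p = h2"
    by (rule D.cokernel_factor[OF p_cok Hj[OF \<nu>h(1)] Rp h2 h2\<nu>])
  \<comment> \<open>Each equation is tested after an epimorphism: the image of s for the slot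
    \<open>?j\<close>, that of p for the others.\<close>
  have "h \<cdot>\<^bsub>D\<^esub> ar a i (f i) = t \<cdot>\<^bsub>D\<^esub> g i" if "i \<in> {1..Suc k}" for i
  proof (cases "i = ?j")
    case True
    have "(h \<cdot>\<^bsub>D\<^esub> ar a ?j (f ?j)) \<cdot>\<^bsub>D\<^esub> ar a ?j s = (h \<cdot>\<^bsub>D\<^esub> ar a ?j p) \<cdot>\<^bsub>D\<^esub> ar a ?j r"
      using D.Comp_assoc[OF Rs Rf h] D.Comp_assoc[OF Rr Rp h] ar_Comp[OF aobj j s f_Hom[OF j]]
        ar_Comp[OF aobj j r p(1)] fs by simp
    also have "\<dots> = (t \<cdot>\<^bsub>D\<^esub> g ?j) \<cdot>\<^bsub>D\<^esub> ar a ?j s" using hp h2r D.Comp_assoc[OF Rs gj t(1)] by simp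
    finally have eq: "(h \<cdot>\<^bsub>D\<^esub> ar a ?j (f ?j)) \<cdot>\<^bsub>D\<^esub> ar a ?j s = (t \<cdot>\<^bsub>D\<^esub> g ?j) \<cdot>\<^bsub>D\<^esub> ar a ?j s" .
    have "Cod D (ar a ?j s) = ob (a(?j := A ?j))" using Rs by (simp add: Hom_def)
    then show ?thesis
      using D.epiD[OF ar_epi[OF aobj j s_epi] _ _ eq] D.Comp_in_Hom[OF Rf h] D.Comp_in_Hom[OF gj t(1)] True by simp
  next
    case False
    then have i: "i \<in> {1..k}" using that by auto
    note gi = gH[OF kn(3)[OF i]] and Ap = HAj[OF i p(1), unfolded aAB] and F = ar_f_in_Hom[OF famk i]
    have "(h \<cdot>\<^bsub>D\<^esub> ar a i (f i)) \<cdot>\<^bsub>D\<^esub> ar (a(i := A i)) ?j p = (h \<cdot>\<^bsub>D\<^esub> ar a ?j p) \<cdot>\<^bsub>D\<^esub> ar ?aQ i (f i)"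
      using D.Comp_assoc[OF Ap F h] D.Comp_assoc[OF Hf[OF i Q'] Rp h] nat[OF i p(1)] by (simp add: aj)
    also have "\<dots> = (t \<cdot>\<^bsub>D\<^esub> g i) \<cdot>\<^bsub>D\<^esub> ar (a(i := A i)) ?j p"
      using hp h2f[OF i] D.Comp_assoc[OF Ap gi t(1)] by simp
    finally have eq: "(h \<cdot>\<^bsub>D\<^esub> ar a i (f i)) \<cdot>\<^bsub>D\<^esub> ar (a(i := A i)) ?j p = (t \<cdot>\<^bsub>D\<^esub> g i) \<cdot>\<^bsub>D\<^esub> ar (a(i := A i)) ?j p" .
    have "Cod D (ar (a(i := A i)) ?j p) = ob (a(i := A i))" using Ap by (simp add: Hom_def)
    then show ?thesis
      using D.epiD[OF ar_epi[OF aAobj[OF i] j p(2)] _ _ eq] D.Comp_in_Hom[OF F h] D.Comp_in_Hom[OF gi t(1)] by simp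
  qed
  then have "extends (Suc k) a T g T2 t h" using t h by (simp add: extends_def)
  then show ?thesis by blast
qed

lemma extend:
  assumes n: "n \<ge> 1" and "tgt_fam k a" "\<forall>i\<in>{k<..n}. a i \<in> \<D> i" "compatible k a T g" "T \<in> Obj D"
  shows "\<exists>T' t h. extends k a T g T' t h"
  using assms(2-4)
\<comment> \<open>The induction hypothesis is needed for the family with the cover Q in slot k + 1
  and for the maps \<open>g i\<close> pulled back to it.\<close>
proof (induction k arbitrary: a g)
  case 0
  \<comment> \<open>No face is prescribed, so the zero map serves as extension.\<close>
  have "extends 0 a T g T (Ide D T) (Zero D (ob a) T)"
    using assms(5) ob_Obj[OF tgt_famD(1)[OF 0(1)] n] D.Ide_in_Hom D.mono_Ide D.Zero_in_Hom
    by (simp add: extends_def)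
  then show ?case by blast
next
  case (Suc k)
  have j: "Suc k \<in> {1..n}" using Suc.prems by (simp add: tgt_fam_def)
  obtain Q p where Q: "Q \<in> \<D> (Suc k)" and p: "p \<in> Hom (M (Suc k)) Q (B (Suc k))" "is_epi (M (Suc k)) p"
    using cover[OF j ABC_Obj(2)[OF j]] by blast
  have fQ: "tgt_fam k (a(Suc k := Q))"
    using tgt_fam_upd[of k a "Suc k" Q] tgt_fam_Suc[OF Suc.prems(1)] j Q \<D>_Obj[OF j] by auto
  have cQ: "\<forall>i\<in>{k<..n}. (a(Suc k := Q)) i \<in> \<D> i" using Suc.prems(2) Q by auto
  show ?case
    by (rule extend_step[OF n Suc.prems Q p]) (rule Suc.IH[OF fQ cQ])
qed

end

section \<open>Trivial cofibrations and acyclic cokernels\<close>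

context abelian_category
begin

text \<open>The rows L, V, E and L, Y, Q share their first term, so p and the induced p' have the
  same kernel. The map e k is monic because e kills exactly L, on which p is the monomorphism m. A
  map killing e k descends along p and then along q, so p' is its cokernel.\<close>

lemma induced_epi_kernel:
  assumes i: "i \<in> Hom C L V" "is_mono C i" and e: "e \<in> Hom C V E" and e_cok: "is_cokernel C i e"
    and p: "p \<in> Hom C V Y" "is_epi C p" and k: "k \<in> Hom C K V" and k_ker: "is_kernel C p k"
    and m: "m \<in> Hom C L Y" "is_mono C m" and pi: "p \<cdot> i = m"
    and q: "q \<in> Hom C Y Q" and cok: "is_cokernel C m q"
    and p': "p' \<in> Hom C E Q" "p' \<cdot> e = q \<cdot> p"
  shows "is_kernel C p' (e \<cdot> k)" "is_epi C p'"
proof -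
  have obj: "L \<in> Obj C" "V \<in> Obj C" "Y \<in> Obj C" "K \<in> Obj C" "E \<in> Obj C" "Q \<in> Obj C"
    using Hom_Obj[OF i(1)] Hom_Obj[OF p(1)] Hom_Obj[OF k] Hom_Obj[OF p'(1)] by auto
  have pk: "p \<cdot> k = Zero C K Y" using is_kernel_Comp[OF k_ker p(1) k] .
  have ei: "e \<cdot> i = Zero C L E" using is_cokernel_Comp[OF e_cok i(1) e] .
  have e_ker: "is_kernel C e i" using mono_kernel_of_cokernel[OF i(2) e_cok] .
  have e_epi: "is_epi C e" using cokernel_epi[OF e_cok] .
  have "is_epi C (q \<cdot> p)" by (rule epi_Comp[OF p(2) cokernel_epi[OF cok] p(1) q])
  then show p'_epi: "is_epi C p'" using epi_Comp_left[OF _ e p'(1)] p'(2) by simp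
  define \<kappa> where "\<kappa> = e \<cdot> k"
  have \<kappa>: "\<kappa> \<in> Hom C K E" unfolding \<kappa>_def by (rule Comp_in_Hom[OF k e])
  have p'\<kappa>: "p' \<cdot> \<kappa> = Zero C K Q"
    using Comp_assoc[OF k e p'(1)] Comp_assoc[OF k p(1) q] p'(2) pk Comp_Zero[OF q obj(4)] by (simp add: \<kappa>_def)
  have \<kappa>_mono: "is_mono C \<kappa>"
  proof (rule monoI[OF \<kappa>])
    fix U x assume x: "x \<in> Hom C U K" "\<kappa> \<cdot> x = Zero C U E"
    have UO: "U \<in> Obj C" using Hom_Obj[OF x(1)] by simp
    have ekx: "e \<cdot> k \<cdot> x = Zero C U E" using Comp_assoc[OF x(1) k e] x(2) by (simp add: \<kappa>_def)
    obtain y where y: "y \<in> Hom C U L" "i \<cdot> y = k \<cdot> x"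
      by (rule kernel_factor[OF e_ker e i(1) Comp_in_Hom[OF x(1) k] ekx])
    have "m \<cdot> y = (p \<cdot> k) \<cdot> x"
      using Comp_assoc[OF y(1) i(1) p(1)] Comp_assoc[OF x(1) k p(1)] pi y(2) by simp
    also have "\<dots> = Zero C U Y" using pk Zero_Comp[OF x(1) obj(3)] by simp
    finally have "y = Zero C U L" using mono_Zero[OF m(2,1) y(1)] by simp
    then have "k \<cdot> x = Zero C U V" using y(2) Comp_Zero[OF i(1) UO] by simp
    then show "x = Zero C U K" using mono_Zero[OF kernel_mono[OF k_ker] k x(1)] by simp
  qed
  have "is_cokernel C \<kappa> p'"
  proof (rule is_cokernelI[OF \<kappa> p'(1) p'\<kappa> p'_epi])
    fix S w assume w: "w \<in> Hom C E S" "w \<cdot> \<kappa> = Zero C K S"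
    have wek: "(w \<cdot> e) \<cdot> k = Zero C K S" using Comp_assoc[OF k e w(1)] w(2) by (simp add: \<kappa>_def)
    obtain v where v: "v \<in> Hom C Y S" "v \<cdot> p = w \<cdot> e"
      by (rule cokernel_factor[OF epi_cokernel_of_kernel[OF p(2) k_ker] k p(1) Comp_in_Hom[OF e w(1)] wek])
    have "v \<cdot> m = w \<cdot> e \<cdot> i"
      using Comp_assoc[OF i(1) p(1) v(1)] Comp_assoc[OF i(1) e w(1)] pi v(2) by simp
    also have "\<dots> = Zero C L S" using ei Comp_Zero[OF w(1) obj(1)] by simp
    finally obtain v' where v': "v' \<in> Hom C Q S" "v' \<cdot> q = v"
      by (rule cokernel_factor[OF cok m(1) q v(1)])
    have "(v' \<cdot> p') \<cdot> e = w \<cdot> e"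
      using Comp_assoc[OF e p'(1) v'(1)] Comp_assoc[OF p(1) q v'(1)] p'(2) v'(2) v(2) by simp
    moreover have "Cod C e = E" using e by (simp add: Hom_def)
    ultimately have "v' \<cdot> p' = w"
      using epiD[OF e_epi] Comp_in_Hom[OF p'(1) v'(1)] w(1) by simp
    then show "\<exists>u\<in>Hom C Q S. u \<cdot> p' = w" using v'(1) by blast
  qed
  then have "is_kernel C p' \<kappa>" using mono_kernel_of_cokernel[OF \<kappa>_mono] by blast
  then show "is_kernel C p' (e \<cdot> k)" by (simp add: \<kappa>_def)
qed

text \<open>The section \<sigma> of p' yields a retraction of its kernel, hence a retraction \<rho>
  of k that vanishes on L. Then 1 - k \<rho> kills k and fixes i, so it descends along p to the
  section h with h m = i, which is what a retract diagram asks for.\<close>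

lemma induced_epi_splitting:
  assumes i: "i \<in> Hom C L V" "is_mono C i" and e: "e \<in> Hom C V E" and e_cok: "is_cokernel C i e"
    and p: "p \<in> Hom C V Y" "is_epi C p" and k: "k \<in> Hom C K V" and k_ker: "is_kernel C p k"
    and m: "m \<in> Hom C L Y" "is_mono C m" and pi: "p \<cdot> i = m"
    and q: "q \<in> Hom C Y Q" and cok: "is_cokernel C m q"
    and p': "p' \<in> Hom C E Q" "p' \<cdot> e = q \<cdot> p"
    and \<sigma>: "\<sigma> \<in> Hom C Q E" "p' \<cdot> \<sigma> = Ide C Q"
  obtains h where "h \<in> Hom C Y V" "p \<cdot> h = Ide C Y" "h \<cdot> m = i"
proof -
  have obj: "L \<in> Obj C" "V \<in> Obj C" "Y \<in> Obj C" "K \<in> Obj C" "E \<in> Obj C" "Q \<in> Obj C"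
    using Hom_Obj[OF i(1)] Hom_Obj[OF p(1)] Hom_Obj[OF k] Hom_Obj[OF p'(1)] by auto
  have pk: "p \<cdot> k = Zero C K Y" using is_kernel_Comp[OF k_ker p(1) k] .
  have ei: "e \<cdot> i = Zero C L E" using is_cokernel_Comp[OF e_cok i(1) e] .
  define \<kappa> where "\<kappa> = e \<cdot> k"
  have \<kappa>: "\<kappa> \<in> Hom C K E" unfolding \<kappa>_def by (rule Comp_in_Hom[OF k e])
  have \<kappa>_ker: "is_kernel C p' \<kappa>"
    unfolding \<kappa>_def by (rule induced_epi_kernel(1)[OF i e e_cok p k k_ker m pi q cok p'])
  have \<kappa>_mono: "is_mono C \<kappa>" using kernel_mono[OF \<kappa>_ker] .
  have p'\<kappa>: "p' \<cdot> \<kappa> = Zero C K Q" using is_kernel_Comp[OF \<kappa>_ker p'(1) \<kappa>] .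
  have IE: "Ide C E \<in> Hom C E E" and IV: "Ide C V \<in> Hom C V V"
    and IY: "Ide C Y \<in> Hom C Y Y" and IK: "Ide C K \<in> Hom C K K" using Ide_in_Hom obj by auto
  note \<sigma>p' = Comp_in_Hom[OF p'(1) \<sigma>(1)]
  \<comment> \<open>The projector onto the kernel of p' complementary to \<sigma>; factored through
    the kernel it gives the retraction \<pi>.\<close>
  define \<delta> where "\<delta> = Ide C E \<ominus>\<^sub>a \<sigma> \<cdot> p'"
  have \<delta>: "\<delta> \<in> Hom C E E" unfolding \<delta>_def using Minus_in_Hom[OF IE \<sigma>p'] .
  have p'\<delta>: "p' \<cdot> \<delta> = Zero C E Q"
    using Comp_Minus[OF IE \<sigma>p' p'(1)] Comp_Ide[OF p'(1)] Comp_assoc[OF p'(1) \<sigma>(1) p'(1)] \<sigma>(2) Ide_Comp[OF p'(1)]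
      Minus_self[OF p'(1)] by (simp add: \<delta>_def)
  obtain \<pi> where \<pi>: "\<pi> \<in> Hom C E K" "\<kappa> \<cdot> \<pi> = \<delta>"
    by (rule kernel_factor[OF \<kappa>_ker p'(1) \<kappa> \<delta> p'\<delta>])
  have "\<kappa> \<cdot> \<pi> \<cdot> \<kappa> = \<delta> \<cdot> \<kappa>" using Comp_assoc[OF \<kappa> \<pi>(1) \<kappa>] \<pi>(2) by simp
  also have "\<dots> = \<kappa>"
    using Minus_Comp[OF \<kappa> IE \<sigma>p'] Ide_Comp[OF \<kappa>] Comp_assoc[OF \<kappa> p'(1) \<sigma>(1)] p'\<kappa>
      Comp_Zero[OF \<sigma>(1) obj(4)] Minus_Zero[OF \<kappa>] by (simp add: \<delta>_def)
  finally have "\<kappa> \<cdot> \<pi> \<cdot> \<kappa> = \<kappa> \<cdot> Ide C K" using Comp_Ide[OF \<kappa>] by simp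
  moreover have "Dom C \<kappa> = K" using \<kappa> by (simp add: Hom_def)
  ultimately have \<pi>\<kappa>: "\<pi> \<cdot> \<kappa> = Ide C K"
    using monoD[OF \<kappa>_mono] Comp_in_Hom[OF \<kappa> \<pi>(1)] IK by simp
  define \<rho> where "\<rho> = \<pi> \<cdot> e"
  have \<rho>: "\<rho> \<in> Hom C V K" unfolding \<rho>_def by (rule Comp_in_Hom[OF e \<pi>(1)])
  note k\<rho> = Comp_in_Hom[OF \<rho> k]
  have \<rho>k: "\<rho> \<cdot> k = Ide C K" using Comp_assoc[OF k e \<pi>(1)] \<pi>\<kappa> by (simp add: \<rho>_def \<kappa>_def)
  have \<rho>i: "\<rho> \<cdot> i = Zero C L K"
    using Comp_assoc[OF i(1) e \<pi>(1)] ei Comp_Zero[OF \<pi>(1) obj(1)] by (simp add: \<rho>_def)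
  define \<epsilon> where "\<epsilon> = Ide C V \<ominus>\<^sub>a k \<cdot> \<rho>"
  have \<epsilon>: "\<epsilon> \<in> Hom C V V" unfolding \<epsilon>_def using Minus_in_Hom[OF IV k\<rho>] .
  have \<epsilon>k: "\<epsilon> \<cdot> k = Zero C K V"
    using Minus_Comp[OF k IV k\<rho>] Ide_Comp[OF k] Comp_assoc[OF k \<rho> k] \<rho>k Comp_Ide[OF k]
      Minus_self[OF k] by (simp add: \<epsilon>_def)
  have \<epsilon>i: "\<epsilon> \<cdot> i = i"
    using Minus_Comp[OF i(1) IV k\<rho>] Ide_Comp[OF i(1)] Comp_assoc[OF i(1) \<rho> k] \<rho>i
      Comp_Zero[OF k obj(1)] Minus_Zero[OF i(1)] by (simp add: \<epsilon>_def)
  have p\<epsilon>: "p \<cdot> \<epsilon> = p"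
    using Comp_Minus[OF IV k\<rho> p(1)] Comp_Ide[OF p(1)] Comp_assoc[OF \<rho> k p(1)] pk
      Zero_Comp[OF \<rho> obj(3)] Minus_Zero[OF p(1)] by (simp add: \<epsilon>_def)
  obtain h where h: "h \<in> Hom C Y V" "h \<cdot> p = \<epsilon>"
    by (rule cokernel_factor[OF epi_cokernel_of_kernel[OF p(2) k_ker] k p(1) \<epsilon> \<epsilon>k])
  have "(p \<cdot> h) \<cdot> p = Ide C Y \<cdot> p"
    using Comp_assoc[OF p(1) h(1) p(1)] h(2) p\<epsilon> Ide_Comp[OF p(1)] by simp
  moreover have "Cod C p = Y" using p(1) by (simp add: Hom_def)
  ultimately have ph: "p \<cdot> h = Ide C Y"
    using epiD[OF p(2)] Comp_in_Hom[OF h(1) p(1)] IY by simp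
  have hm: "h \<cdot> m = i" using Comp_assoc[OF i(1) p(1) h(1)] pi h(2) \<epsilon>i by simp
  show thesis by (rule that[OF h(1) ph hm])
qed

section \<open>Cohomology of maps out of a zero complex\<close>

lemma cocycles_kernel:
  assumes X: "is_complex C X"
  shows "is_kernel C (diff X n) (cocycles C n X)"
    and "cocycles C n X \<in> Hom C (Dom C (cocycles C n X)) (cobj X n)"
proof -
  have d: "diff X n \<in> Arr C" and D: "Dom C (diff X n) = cobj X n"
    using is_complexD(2)[OF X, of n] by (simp_all add: Hom_def)
  show *: "is_kernel C (diff X n) (cocycles C n X)"
    unfolding cocycles_def by (rule someI_ex[OF ex_kernel[OF d]])
  show "cocycles C n X \<in> Hom C (Dom C (cocycles C n X)) (cobj X n)"
    using * D unfolding is_kernel_def by (elim conjE) (simp add: Hom_def)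
qed

lemma cohom_class_epi:
  assumes X: "is_complex C X"
  shows "is_epi C (cohom_class C n X)"
    and "cohom_class C n X \<in> Hom C (Dom C (cocycles C n X)) (cohom C n X)"
proof -
  let ?k = "cocycles C n X"
  note k = cocycles_kernel[OF X, of n]
  \<comment> \<open>The differential in degree n - 1 is typed with target index n - 1 + 1, while
    \<open>to_cocycles\<close> expects n.\<close>
  have n: "n - 1 + 1 = n" by simp
  have d: "diff X (n - 1) \<in> Hom C (cobj X (n - 1)) (cobj X n)"
    using is_complexD(2)[OF X, of "n - 1"] by (simp only: n)
  have dd: "diff X n \<cdot> diff X (n - 1) = Zero C (cobj X (n - 1)) (cobj X (n + 1))"
    using is_complexD(3)[OF X, of "n - 1"] by (simp only: n)
  have "\<exists>!b. b \<in> Hom C (cobj X (n - 1)) (Dom C ?k) \<and> ?k \<cdot> b = diff X (n - 1)"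
    by (rule kernel_factor_ex1[OF k(1) is_complexD(2)[OF X] k(2) d dd])
  from theI'[OF this] have b: "to_cocycles C n X \<in> Hom C (cobj X (n - 1)) (Dom C ?k)"
    unfolding to_cocycles_def by blast
  then have bA: "to_cocycles C n X \<in> Arr C" by (simp add: Hom_def)
  have q: "is_cokernel C (to_cocycles C n X) (cohom_class C n X)"
    unfolding cohom_class_def by (rule someI_ex[OF ex_cokernel[OF bA]])
  show "is_epi C (cohom_class C n X)" using cokernel_epi[OF q] .
  show "cohom_class C n X \<in> Hom C (Dom C ?k) (cohom C n X)"
    using q b unfolding is_cokernel_def by (elim conjE) (simp add: Hom_def cohom_def)
qed

lemma zero_complex_degreewise:
  assumes "is_zero_object (Ch C) Z"
  shows "is_zero_object C (cobj Z n)"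
proof (rule zero_objectI)
  interpret Ch: abelian_category "Ch C" by (rule abelian_category_Ch)
  have Z: "Z \<in> Obj (Ch C)" using assms by (simp add: is_zero_object_def is_initial_def)
  then show "cobj Z n \<in> Obj C" using is_complexD(1) by (simp add: Ch_simps)
  have "Ide (Ch C) Z = Zero (Ch C) Z Z"
    using Ch.zero_object_Hom(1)[OF assms Z] Ch.Ide_in_Hom[OF Z] by blast
  then show "Ide C (cobj Z n) = Zero C (cobj Z n) (cobj Z n)"
    by (auto simp: Ch_simps dest: fun_cong)
qed

text \<open>The cohomology of a zero complex vanishes, so the induced map is zero, and a zero map
  out of a zero object is invertible iff its target is zero. The chosen cocycles and cohomology
  objects are analysed here alone; acyclicity is otherwise handled through maps 0 \<rightarrow>
  X.\<close>

lemma quasi_iso_from_zero_iff: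
  assumes Z: "is_zero_object (Ch C) Z" and z: "z \<in> Hom (Ch C) Z X"
  shows "quasi_iso C z \<longleftrightarrow> acyclic_complex C X"
proof -
  note ZX = Hom_ChD(3)[OF z] and X = Hom_ChD(4)[OF z]
  have "is_iso C (cohom_map C n z) \<longleftrightarrow> is_zero_object C (cohom C n X)" for n
  proof -
    note kZ = cocycles_kernel[OF ZX, of n] and kX = cocycles_kernel[OF X, of n]
    note qZ = cohom_class_epi[OF ZX, of n] and qX = cohom_class_epi[OF X, of n]
    let ?KZ = "Dom C (cocycles C n Z)" and ?KX = "Dom C (cocycles C n X)"
    let ?HZ = "cohom C n Z" and ?HX = "cohom C n X"
    have KZ: "is_zero_object C ?KZ"
      using zero_object_mono[OF zero_complex_degreewise[OF Z] kernel_mono[OF kZ(1)] kZ(2)] .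
    have HZ: "is_zero_object C ?HZ" using zero_object_epi[OF KZ qZ] .
    have obj: "?KX \<in> Obj C" "?HX \<in> Obj C" "?HZ \<in> Obj C" "?KZ \<in> Obj C" "cobj X n \<in> Obj C"
      using Hom_Obj[OF qX(2)] Hom_Obj[OF qZ(2)] Hom_Obj[OF kX(2)] by auto
    have "cohom_map C n z = Zero C ?HZ ?HX"
      unfolding cohom_map_def Hom_ChD(5,6)[OF z]
    proof (rule the_equality, intro conjI bexI[of _ "Zero C ?KZ ?KX"])
      show "Zero C ?HZ ?HX \<in> Hom C ?HZ ?HX" "Zero C ?KZ ?KX \<in> Hom C ?KZ ?KX"
        using Zero_in_Hom obj by auto
      show "cocycles C n X \<cdot> Zero C ?KZ ?KX = cmor z n \<cdot> cocycles C n Z"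
        using Comp_in_Hom[OF kZ(2) Hom_ChD(1)[OF z]] zero_object_Hom(1)[OF KZ obj(5)]
          Comp_Zero[OF kX(2) obj(4)] by simp
      show "Zero C ?HZ ?HX \<cdot> cohom_class C n Z = cohom_class C n X \<cdot> Zero C ?KZ ?KX"
        using Zero_Comp[OF qZ(2) obj(2)] Comp_Zero[OF qX(2) obj(4)] by simp
    qed (use zero_object_Hom(1)[OF HZ obj(2)] in blast)
    moreover have "is_iso C (Zero C ?HZ ?HX) \<longleftrightarrow> is_zero_object C ?HX"
    proof
      assume "is_iso C (Zero C ?HZ ?HX)"
      then obtain g where g: "g \<in> Hom C ?HX ?HZ" "Zero C ?HZ ?HX \<cdot> g = Ide C ?HX"
        using obj by (auto simp: is_iso_def zero_simps)
      then show "is_zero_object C ?HX"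
        using zero_objectI[OF obj(2)] Zero_Comp[OF g(1) obj(2)] by simp
    next
      assume HX: "is_zero_object C ?HX"
      have I: "Ide C ?HX = Zero C ?HX ?HX" "Ide C ?HZ = Zero C ?HZ ?HZ"
        using zero_object_Hom(1)[OF HX obj(2)] zero_object_Hom(1)[OF HZ obj(3)] Ide_in_Hom obj by auto
      have "Zero C ?HX ?HZ \<in> Hom C ?HX ?HZ" using Zero_in_Hom obj by blast
      moreover have "Zero C ?HX ?HZ \<cdot> Zero C ?HZ ?HX = Ide C ?HZ" "Zero C ?HZ ?HX \<cdot> Zero C ?HX ?HZ = Ide C ?HX"
        using I obj Zero_Comp[OF Zero_in_Hom] by auto
      ultimately show "is_iso C (Zero C ?HZ ?HX)"
        unfolding is_iso_def using Zero_Arr Dom_Zero Cod_Zero obj by auto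
    qed
    ultimately show ?thesis by simp
  qed
  then show ?thesis
    using z X by (simp add: quasi_iso_def acyclic_complex_def Hom_Ch_iff)
qed

end

text \<open>Factor 0 \<rightarrow> Q as a trivial cofibration i followed by a fibration p. Lifting q
  against f and p, with the zero map on X, gives h with h f = 0, so h descends to a section of p.
  This section and p exhibit 0 \<rightarrow> Q as a retract of i.\<close>

lemma trivial_cofibration_cokernel_acyclic:
  assumes "abelian_model_category A W" "f \<in> Cof W" "f \<in> Weq W"
    and q: "q \<in> Hom (Ch A) Y Q" and cok: "is_cokernel (Ch A) f q"
  shows "acyclic_complex A Q"
proof -
  interpret A: abelian_category A using assms(1) by (rule abelian_model_category.axioms)
  interpret Ch: abelian_category "Ch A" by (rule A.abelian_category_Ch)
  interpret Mo: abelian_model_category A W by (rule assms(1))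
  obtain X where f: "f \<in> Hom (Ch A) X Y"
    using cok q unfolding is_cokernel_def Hom_def by auto
  obtain Z where Z: "is_zero_object (Ch A) Z" using Ch.ex_zero_object by blast
  have obj: "Z \<in> Obj (Ch A)" "X \<in> Obj (Ch A)" "Q \<in> Obj (Ch A)"
    using Z Ch.Hom_Obj[OF f] Ch.Hom_Obj[OF q] by (auto simp: is_zero_object_def is_initial_def)
  define z where "z = Zero (Ch A) Z Q"
  have z: "z \<in> Hom (Ch A) Z Q" using Ch.Zero_in_Hom obj by (simp add: z_def)
  obtain V i p where i: "i \<in> Hom (Ch A) Z V" "i \<in> Cof W \<inter> Weq W"
    and p: "p \<in> Hom (Ch A) V Q" "p \<in> Fib W" and pi: "p \<cdot>\<^bsub>Ch A\<^esub> i = z"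
    using Mo.factor_trivial_Cof[OF z] by blast
  have VO: "V \<in> Obj (Ch A)" using Ch.Hom_Obj[OF p(1)] by simp
  have lift: "has_lifting (Ch A) f p" using Mo.lift_trivial_Cof assms(2,3) p(2) by blast
  have qf: "q \<cdot>\<^bsub>Ch A\<^esub> f = Zero (Ch A) X Q"
    using cok f q unfolding is_cokernel_def by (elim conjE) (simp add: Hom_def)
  have dc: "Dom (Ch A) f = X" "Cod (Ch A) f = Y" "Dom (Ch A) p = V" "Cod (Ch A) p = Q"
    using f p(1) by (simp_all add: Hom_def)
  have "p \<cdot>\<^bsub>Ch A\<^esub> Zero (Ch A) X V = q \<cdot>\<^bsub>Ch A\<^esub> f" using qf Ch.Comp_Zero[OF p(1) obj(2)] by simp
  then obtain h where h: "h \<in> Hom (Ch A) Y V" "h \<cdot>\<^bsub>Ch A\<^esub> f = Zero (Ch A) X V" "p \<cdot>\<^bsub>Ch A\<^esub> h = q"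
    using lift[unfolded has_lifting_def dc] q Ch.Zero_in_Hom[OF obj(2) VO] by blast
  obtain h' where h': "h' \<in> Hom (Ch A) Q V" "h' \<cdot>\<^bsub>Ch A\<^esub> q = h"
    by (rule Ch.cokernel_factor[OF cok f q h(1,2)])
  have "(p \<cdot>\<^bsub>Ch A\<^esub> h') \<cdot>\<^bsub>Ch A\<^esub> q = Ide (Ch A) Q \<cdot>\<^bsub>Ch A\<^esub> q"
    using Ch.Comp_assoc[OF q h'(1) p(1)] h'(2) h(3) Ch.Ide_Comp[OF q] by simp
  moreover have "Cod (Ch A) q = Q" using q by (simp add: Hom_def)
  ultimately have ph': "p \<cdot>\<^bsub>Ch A\<^esub> h' = Ide (Ch A) Q"
    using Ch.epiD[OF Ch.cokernel_epi[OF cok]] Ch.Comp_in_Hom[OF h'(1) p(1)] Ch.Ide_in_Hom[OF obj(3)] by simp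
  have "is_retract (Ch A) z i"
  proof -
    have dcz: "Dom (Ch A) z = Z" "Cod (Ch A) z = Q" "Dom (Ch A) i = Z" "Cod (Ch A) i = V"
      and arr: "z \<in> Arr (Ch A)" "i \<in> Arr (Ch A)" using z i(1) by (simp_all add: Hom_def)
    have I: "Ide (Ch A) Z \<in> Hom (Ch A) Z Z" using Ch.Ide_in_Hom obj by blast
    have "i \<cdot>\<^bsub>Ch A\<^esub> Ide (Ch A) Z = h' \<cdot>\<^bsub>Ch A\<^esub> z"
      using Ch.Comp_in_Hom[OF I i(1)] Ch.Comp_in_Hom[OF z h'(1)] Ch.zero_object_Hom(1)[OF Z VO] by simp
    moreover have "z \<cdot>\<^bsub>Ch A\<^esub> Ide (Ch A) Z = p \<cdot>\<^bsub>Ch A\<^esub> i" using Ch.Comp_Ide[OF z] pi by simp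
    ultimately show ?thesis
      unfolding is_retract_def dcz using arr I h'(1) p(1) ph' Ch.Comp_Ide[OF I] by blast
  qed
  then have "z \<in> Weq W" using Mo.Weq_retract i(2) by blast
  then show ?thesis using A.quasi_iso_from_zero_iff[OF Z z] Mo.Weq_iff by blast
qed

text \<open>
  Factor \<open>m = p i\<close> into a trivial cofibration and a fibration. The map \<open>p'\<close> induced by \<open>p\<close> on the
  cokernels of \<open>i\<close> and \<open>m\<close> has the same kernel as \<open>p\<close>, so it is a fibration and splits; the
  splitting lifts to one of \<open>p\<close> that exhibits \<open>m\<close> as a retract of \<open>i\<close>.
\<close>

lemma acyclic_cokernel_Weq:
  assumes "abelian_model_category A W" and m: "m \<in> Hom (Ch A) L Y" "is_mono (Ch A) m"
    and q: "q \<in> Hom (Ch A) Y Q" and cok: "is_cokernel (Ch A) m q"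
    and Q: "Q \<in> cofibrants (Ch A) W" "acyclic_complex A Q"
  shows "m \<in> Weq W"
proof -
  interpret A: abelian_category A using assms(1) by (rule abelian_model_category.axioms)
  interpret Ch: abelian_category "Ch A" by (rule A.abelian_category_Ch)
  interpret Mo: abelian_model_category A W by (rule assms(1))
  obtain Z z where "is_initial (Ch A) Z" and z: "z \<in> Hom (Ch A) Z Q" "z \<in> Cof W"
    using Q(1) by (auto simp: cofibrants_def)
  then have Z: "is_zero_object (Ch A) Z" using Ch.initial_is_zero_object by blast
  have zW: "z \<in> Weq W" using A.quasi_iso_from_zero_iff[OF Z z(1)] Mo.Weq_iff Q(2) by blast
  obtain V i p where i: "i \<in> Hom (Ch A) L V" "i \<in> Cof W \<inter> Weq W"
    and p: "p \<in> Hom (Ch A) V Y" "p \<in> Fib W" and pi: "p \<cdot>\<^bsub>Ch A\<^esub> i = m"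
    using Mo.factor_trivial_Cof[OF m(1)] by blast
  obtain k where p_epi: "is_epi (Ch A) p" and k_ker: "is_kernel (Ch A) p k" and kfib: "src k \<in> fibrants (Ch A) W"
    using p(2) Mo.Fib_iff by blast
  have i_mono: "is_mono (Ch A) i" using i(2) Mo.Cof_iff by blast
  obtain K where k: "k \<in> Hom (Ch A) K V"
    by (rule Ch.kernelE[OF k_ker p(1)])
  have KE: "K \<in> fibrants (Ch A) W" using kfib k by (simp add: Hom_Ch_iff)
  obtain e where e_cok: "is_cokernel (Ch A) i e" using Ch.ex_cokernel i(1) unfolding Hom_def by blast
  obtain E where e: "e \<in> Hom (Ch A) V E"
    by (rule Ch.cokernelE[OF e_cok i(1)])
  have obj: "L \<in> Obj (Ch A)" "E \<in> Obj (Ch A)" "Q \<in> Obj (Ch A)" "Z \<in> Obj (Ch A)"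
    using Ch.Hom_Obj[OF i(1)] Ch.Hom_Obj[OF e] Ch.Hom_Obj[OF z(1)] by auto
  have qpi: "(q \<cdot>\<^bsub>Ch A\<^esub> p) \<cdot>\<^bsub>Ch A\<^esub> i = Zero (Ch A) L Q"
    using Ch.Comp_assoc[OF i(1) p(1) q] pi Ch.is_cokernel_Comp[OF cok m(1) q] by simp
  obtain p' where p': "p' \<in> Hom (Ch A) E Q" "p' \<cdot>\<^bsub>Ch A\<^esub> e = q \<cdot>\<^bsub>Ch A\<^esub> p"
    by (rule Ch.cokernel_factor[OF e_cok i(1) e Ch.Comp_in_Hom[OF p(1) q] qpi])
  note data = i(1) i_mono e e_cok p(1) p_epi k k_ker m pi q cok p'
  have "src (e \<cdot>\<^bsub>Ch A\<^esub> k) = K" using Ch.Comp_in_Hom[OF k e] by (simp add: Hom_Ch_iff)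
  then have "p' \<in> Fib W" using Mo.Fib_iff Ch.induced_epi_kernel[OF data] KE by metis
  \<comment> \<open>As Q is cofibrant and acyclic, 0 \<rightarrow> Q is a trivial cofibration;
    lifting the identity of Q against p' gives the section \<sigma>.\<close>
  then have lift: "has_lifting (Ch A) z p'" using Mo.lift_trivial_Cof z(2) zW by blast
  have dc: "Dom (Ch A) z = Z" "Cod (Ch A) z = Q" "Dom (Ch A) p' = E" "Cod (Ch A) p' = Q"
    using z(1) p'(1) by (simp_all add: Hom_def)
  have IQ: "Ide (Ch A) Q \<in> Hom (Ch A) Q Q" using Ch.Ide_in_Hom[OF obj(3)] .
  have "p' \<cdot>\<^bsub>Ch A\<^esub> Zero (Ch A) Z E = Ide (Ch A) Q \<cdot>\<^bsub>Ch A\<^esub> z"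
    using Ch.Comp_Zero[OF p'(1) obj(4)] Ch.Ide_Comp[OF z(1)] Ch.zero_object_Hom(1)[OF Z obj(3)] z(1) by simp
  then obtain \<sigma> where \<sigma>: "\<sigma> \<in> Hom (Ch A) Q E" "p' \<cdot>\<^bsub>Ch A\<^esub> \<sigma> = Ide (Ch A) Q"
    using lift[unfolded has_lifting_def dc] IQ Ch.Zero_in_Hom[OF obj(4,2)] by blast
  obtain h where h: "h \<in> Hom (Ch A) Y V" "p \<cdot>\<^bsub>Ch A\<^esub> h = Ide (Ch A) Y" "h \<cdot>\<^bsub>Ch A\<^esub> m = i"
    by (rule Ch.induced_epi_splitting[OF data \<sigma>])
  have "is_retract (Ch A) m i"
  proof -
    have dcm: "Dom (Ch A) m = L" "Cod (Ch A) m = Y" "Dom (Ch A) i = L" "Cod (Ch A) i = V"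
      and arr: "m \<in> Arr (Ch A)" "i \<in> Arr (Ch A)" using m(1) i(1) by (simp_all add: Hom_def)
    have I: "Ide (Ch A) L \<in> Hom (Ch A) L L" using Ch.Ide_in_Hom obj by blast
    have "i \<cdot>\<^bsub>Ch A\<^esub> Ide (Ch A) L = h \<cdot>\<^bsub>Ch A\<^esub> m" "m \<cdot>\<^bsub>Ch A\<^esub> Ide (Ch A) L = p \<cdot>\<^bsub>Ch A\<^esub> i"
      using Ch.Comp_Ide[OF i(1)] Ch.Comp_Ide[OF m(1)] h(3) pi by simp_all
    then show ?thesis
      unfolding is_retract_def dcm using arr I h(1,2) p(1) Ch.Comp_Ide[OF I] by blast
  qed
  then show ?thesis using Mo.Weq_retract i(2) by blast
qed

text \<open>In the factorisation of 0 \<rightarrow> X into a cofibration and a trivial fibration,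
  the second map is epic because all fibrations are.\<close>

lemma cofibrant_cover:
  assumes "abelian_model_category A W" "X \<in> Obj (Ch A)"
  shows "\<exists>Q\<in>cofibrants (Ch A) W. \<exists>p\<in>Hom (Ch A) Q X. is_epi (Ch A) p"
proof -
  interpret A: abelian_category A using assms(1) by (rule abelian_model_category.axioms)
  interpret Ch: abelian_category "Ch A" by (rule A.abelian_category_Ch)
  interpret Mo: abelian_model_category A W by (rule assms(1))
  obtain Z where Z: "is_zero_object (Ch A) Z" using Ch.ex_zero_object by blast
  then have "Zero (Ch A) Z X \<in> Hom (Ch A) Z X"
    using Ch.Zero_in_Hom assms(2) by (simp add: is_zero_object_def is_initial_def)
  then obtain Q i p where "i \<in> Hom (Ch A) Z Q" "p \<in> Hom (Ch A) Q X" "i \<in> Cof W" "p \<in> Fib W"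
    using Mo.factor_trivial_Fib by blast
  then show ?thesis
    using Z Mo.Fib_iff Ch.Hom_Obj unfolding cofibrants_def is_zero_object_def by blast
qed

section \<open>Functors of several variables with right adjoints\<close>

text \<open>Families in the argument are unconstrained outside {1..n} and are changed by
  \<open>fun_upd\<close>; \<open>restrict\<close> converts them to the extensional objects of
  \<open>prod_cat\<close>.\<close>

definition multi_ob :: "nat \<Rightarrow> (nat \<Rightarrow> 'o, nat \<Rightarrow> 'm, 'p, 'q) func \<Rightarrow> (nat \<Rightarrow> 'o) \<Rightarrow> 'p" where
  "multi_ob n F a = OMap F (restrict a {1..n})"

definition multi_ar :: "nat \<Rightarrow> (nat \<Rightarrow> ('o, 'm, 'z) cat_scheme) \<Rightarrow> (nat \<Rightarrow> 'o, nat \<Rightarrow> 'm, 'p, 'q) func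
    \<Rightarrow> (nat \<Rightarrow> 'o) \<Rightarrow> nat \<Rightarrow> 'm \<Rightarrow> 'q" where
  "multi_ar n M F a j u = AMap F (\<lambda>i\<in>{1..n}. if i = j then u else Ide (M i) (a i))"

lemma prod_functor_Hom:
  assumes F: "is_functor (prod_cat I M) D F" and u: "\<And>i. i \<in> I \<Longrightarrow> u i \<in> Hom (M i) (a i) (b i)"
  shows "AMap F (restrict u I) \<in> Hom D (OMap F (restrict a I)) (OMap F (restrict b I))"
proof -
  have 1: "restrict u I \<in> Arr (prod_cat I M)" using u by (auto simp: prod_cat_def Hom_def)
  have 2: "Dom (prod_cat I M) (restrict u I) = restrict a I" "Cod (prod_cat I M) (restrict u I) = restrict b I"
    using u by (auto simp: prod_cat_def Hom_def intro!: restrict_ext)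
  have "\<forall>f\<in>Arr (prod_cat I M). AMap F f \<in> Hom D (OMap F (Dom (prod_cat I M) f)) (OMap F (Cod (prod_cat I M) f))"
    using F unfolding is_functor_def by (elim conjE)
  from bspec[OF this 1] show ?thesis by (simp only: 2)
qed

text \<open>The composite w is described slot by slot, so that identity laws can be used in each
  slot separately.\<close>

lemma prod_functor_Comp:
  assumes F: "is_functor (prod_cat I M) D F"
    and u: "\<And>i. i \<in> I \<Longrightarrow> u i \<in> Hom (M i) (a i) (b i)" and v: "\<And>i. i \<in> I \<Longrightarrow> v i \<in> Hom (M i) (b i) (c i)"
    and w: "\<And>i. i \<in> I \<Longrightarrow> w i = v i \<cdot>\<^bsub>M i\<^esub> u i"
  shows "AMap F (restrict w I) = AMap F (restrict v I) \<cdot>\<^bsub>D\<^esub> AMap F (restrict u I)"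
proof -
  let ?P = "prod_cat I M"
  have 1: "restrict u I \<in> Arr ?P" "restrict v I \<in> Arr ?P" using u v by (auto simp: prod_cat_def Hom_def)
  have 2: "Cod ?P (restrict u I) = Dom ?P (restrict v I)"
    using u v by (auto simp: prod_cat_def Hom_def intro!: restrict_ext)
  have 3: "restrict v I \<cdot>\<^bsub>?P\<^esub> restrict u I = restrict w I"
    using w by (auto simp: prod_cat_def intro!: restrict_ext)
  have "\<forall>f\<in>Arr ?P. \<forall>g\<in>Arr ?P. Cod ?P f = Dom ?P g \<longrightarrow> AMap F (g \<cdot>\<^bsub>?P\<^esub> f) = AMap F g \<cdot>\<^bsub>D\<^esub> AMap F f"
    using F unfolding is_functor_def by (elim conjE)
  from this[THEN bspec, OF 1(1), THEN bspec, OF 1(2), THEN mp, OF 2] show ?thesis by (simp only: 3)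
qed

locale multivar_left_adjoint =
  fixes n :: nat and M :: "nat \<Rightarrow> ('o, 'm, 'z) abcat_scheme"
    and F :: "(nat \<Rightarrow> 'o, nat \<Rightarrow> 'm, 'o, 'm) func"
    and G :: "nat \<Rightarrow> (nat \<Rightarrow> 'o, nat \<Rightarrow> 'm, 'o, 'm) func"
    and \<phi> :: "nat \<Rightarrow> (nat \<Rightarrow> 'o) \<Rightarrow> 'm \<Rightarrow> 'm"
  assumes M_abelian: "i \<le> n \<Longrightarrow> abelian_category (M i)"
    and adj: "multivar_adjunction n M F G \<phi>"
begin

lemma F_functor: "is_functor (prod_cat {1..n} M) (M 0) F"
  using adj by (simp add: multivar_adjunction_def)

abbreviation "ob \<equiv> multi_ob n F"
abbreviation "ar \<equiv> multi_ar n M F"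

lemma Ide_Hom: "\<lbrakk>obj_family n M a; i \<in> {1..n}\<rbrakk> \<Longrightarrow> Ide (M i) (a i) \<in> Hom (M i) (a i) (a i)"
  using abelian_category.axioms(1)[OF M_abelian[of i]]
  by (auto simp: obj_family_def preadditive_category_def intro: category.Ide_in_Hom)

lemma cat: "i \<in> {1..n} \<Longrightarrow> category (M i)"
  using abelian_category.axioms(1)[OF M_abelian[of i]] by (simp add: preadditive_category_def)

lemma ar_Hom:
  assumes "obj_family n M a" "j \<in> {1..n}" "u \<in> Hom (M j) X Y"
  shows "ar a j u \<in> Hom (M 0) (ob (a(j := X))) (ob (a(j := Y)))"
  unfolding multi_ar_def multi_ob_def
  by (rule prod_functor_Hom[OF F_functor]) (use assms Ide_Hom[OF assms(1)] in auto)

lemma ar_Comp: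
  assumes a: "obj_family n M a" and "j \<in> {1..n}" and u: "u \<in> Hom (M j) X Y" and v: "v \<in> Hom (M j) Y Z"
  shows "ar a j (v \<cdot>\<^bsub>M j\<^esub> u) = ar a j v \<cdot>\<^bsub>M 0\<^esub> ar a j u"
  unfolding multi_ar_def
  by (rule prod_functor_Comp[OF F_functor, of _ "a(j := X)" "a(j := Y)" _ "a(j := Z)"])
    (use assms Ide_Hom[OF a] category.Comp_Ide[OF cat Ide_Hom[OF a]] in auto)

text \<open>Both sides are F of the single family with u in slot i and v in slot j, factored in the
  two possible orders.\<close>

lemma ar_interchange:
  assumes a: "obj_family n M a" and i: "i \<in> {1..n}" and j: "j \<in> {1..n}" and ij: "i \<noteq> j"
    and u: "u \<in> Hom (M i) X X'" and v: "v \<in> Hom (M j) Y Y'"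
  shows "ar (a(i := X')) j v \<cdot>\<^bsub>M 0\<^esub> ar (a(j := Y)) i u = ar (a(j := Y')) i u \<cdot>\<^bsub>M 0\<^esub> ar (a(i := X)) j v"
proof -
  interpret Mi: category "M i" using cat i .
  interpret Mj: category "M j" using cat j .
  let ?w = "\<lambda>k. if k = i then u else if k = j then v else Ide (M k) (a k)"
  have X: "X \<in> Obj (M i)" "X' \<in> Obj (M i)" and Y: "Y \<in> Obj (M j)" "Y' \<in> Obj (M j)"
    using Mi.Hom_Obj[OF u] Mj.Hom_Obj[OF v] by auto
  note I = Ide_Hom[OF a] category.Comp_Ide[OF cat Ide_Hom[OF a]] Mi.Ide_in_Hom[OF X(1)] Mi.Ide_in_Hom[OF X(2)]
    Mj.Ide_in_Hom[OF Y(1)] Mj.Ide_in_Hom[OF Y(2)] Mi.Comp_Ide[OF u] Mi.Ide_Comp[OF u] Mj.Comp_Ide[OF v] Mj.Ide_Comp[OF v]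
  have "AMap F (restrict ?w {1..n}) = ar (a(i := X')) j v \<cdot>\<^bsub>M 0\<^esub> ar (a(j := Y)) i u"
    unfolding multi_ar_def
    by (rule prod_functor_Comp[OF F_functor, of _ "a(i := X, j := Y)" "a(i := X', j := Y)" _ "a(i := X', j := Y')"])
      (use I ij u v in auto)
  moreover have "AMap F (restrict ?w {1..n}) = ar (a(j := Y')) i u \<cdot>\<^bsub>M 0\<^esub> ar (a(i := X)) j v"
    unfolding multi_ar_def
    by (rule prod_functor_Comp[OF F_functor, of _ "a(i := X, j := Y)" "a(i := X, j := Y')" _ "a(i := X', j := Y')"])
      (use I ij u v in auto)
  ultimately show ?thesis by simp
qed

lemma ar_upd: "ar (a(j := X)) j u = ar a j u"
  unfolding multi_ar_def by (rule arg_cong[of _ _ "AMap F"]) (auto intro!: restrict_ext)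

lemma adjunction:
  assumes a: "obj_family n M a" and j: "j \<in> {1..n}" and T: "T \<in> Obj (M 0)"
  obtains R \<psi> where "R \<in> Obj (M j)"
    "\<And>X. X \<in> Obj (M j) \<Longrightarrow> bij_betw (\<psi> X) (Hom (M 0) (ob (a(j := X))) T) (Hom (M j) X R)"
    "\<And>X Y u g. \<lbrakk>u \<in> Hom (M j) X Y; g \<in> Hom (M 0) (ob (a(j := Y))) T\<rbrakk>
       \<Longrightarrow> \<psi> X (g \<cdot>\<^bsub>M 0\<^esub> ar a j u) = \<psi> Y g \<cdot>\<^bsub>M j\<^esub> u"
proof -
  interpret Mj: category "M j" using cat j .
  interpret M0: abelian_category "M 0" using M_abelian by simp
  have j0: "j \<noteq> 0" "j \<in> {0..n}" using j by auto
  let ?S = "right_adjoint_source n M j" and ?I = "{0..n} - {j}"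
  define \<alpha> where "\<alpha> = (\<lambda>X. \<lambda>i\<in>{0..n}. if i = 0 then T else if i = j then X else a i)"
  define r where "r = (\<lambda>i\<in>?I. if i = 0 then T else a i)"
  define R where "R = OMap (G j) r"
  have \<alpha>1: "restrict (\<alpha> X) {1..n} = restrict (a(j := X)) {1..n}" for X
    by (auto simp: \<alpha>_def intro!: restrict_ext)
  have \<alpha>2: "restrict (\<alpha> X) ?I = r" for X
    by (auto simp: \<alpha>_def r_def intro!: restrict_ext)
  have \<alpha>3: "\<alpha> X 0 = T" "\<alpha> X j = X" for X using j0 by (simp_all add: \<alpha>_def)
  have \<alpha>4: "\<alpha> X \<in> (\<Pi>\<^sub>E i\<in>{0..n}. Obj (M i))" if "X \<in> Obj (M j)" for X
    using that T a by (auto simp: \<alpha>_def obj_family_def)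
  have Gj: "is_functor ?S (M j) (G j)"
    and bij: "\<forall>a \<in> \<Pi>\<^sub>E i\<in>{0..n}. Obj (M i).
           bij_betw (\<phi> j a) (Hom (M 0) (OMap F (restrict a {1..n})) (a 0))
             (Hom (M j) (a j) (OMap (G j) (restrict a ?I)))"
    and nat: "\<forall>a \<in> \<Pi>\<^sub>E i\<in>{0..n}. Obj (M i). \<forall>b \<in> \<Pi>\<^sub>E i\<in>{0..n}. Obj (M i).
         \<forall>u \<in> \<Pi>\<^sub>E i\<in>{0..n}. if i = 0 then Hom (M 0) (a 0) (b 0) else Hom (M i) (b i) (a i).
         \<forall>g \<in> Hom (M 0) (OMap F (restrict a {1..n})) (a 0).
           \<phi> j b (u 0 \<cdot>\<^bsub>M 0\<^esub> g \<cdot>\<^bsub>M 0\<^esub> AMap F (restrict u {1..n})) =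
           AMap (G j) (restrict u ?I) \<cdot>\<^bsub>M j\<^esub> \<phi> j a g \<cdot>\<^bsub>M j\<^esub> u j"
    using adj j unfolding multivar_adjunction_def by blast+
  have r: "r \<in> Obj ?S"
    using T a by (auto simp: r_def right_adjoint_source_def prod_cat_def obj_family_def op_cat_def cat.truncate_def)
  have "\<forall>X\<in>Obj ?S. OMap (G j) X \<in> Obj (M j) \<and> AMap (G j) (Ide ?S X) = Ide (M j) (OMap (G j) X)"
    using Gj unfolding is_functor_def by (elim conjE)
  then have R: "R \<in> Obj (M j)" and GI: "AMap (G j) (Ide ?S r) = Ide (M j) R" using r by (auto simp: R_def)
  have bij': "bij_betw (\<phi> j (\<alpha> X)) (Hom (M 0) (ob (a(j := X))) T) (Hom (M j) X R)"
    if "X \<in> Obj (M j)" for X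
    using bspec[OF bij \<alpha>4[OF that]] by (simp only: \<alpha>1 \<alpha>2 \<alpha>3 R_def multi_ob_def)
  have "\<phi> j (\<alpha> X) (g \<cdot>\<^bsub>M 0\<^esub> ar a j u) = \<phi> j (\<alpha> Y) g \<cdot>\<^bsub>M j\<^esub> u"
    if u: "u \<in> Hom (M j) X Y" and g: "g \<in> Hom (M 0) (ob (a(j := Y))) T" for X Y u g
  proof -
    have XY: "X \<in> Obj (M j)" "Y \<in> Obj (M j)" using Mj.Hom_Obj[OF u] by auto
    \<comment> \<open>Naturality is used for the family with u in slot j and identities elsewhere,
      on which \<open>G j\<close> acts as an identity. By the contravariance in the slots from 1 on,
      it leads from \<alpha> Y to \<alpha> X.\<close>
    define v where "v = (\<lambda>i\<in>{0..n}. if i = 0 then Ide (M 0) T else if i = j then u else Ide (M i) (a i))"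
    have v1: "restrict v {1..n} = (\<lambda>i\<in>{1..n}. if i = j then u else Ide (M i) (a i))"
      by (auto simp: v_def intro!: restrict_ext)
    have v2: "restrict v ?I = Ide ?S r"
      by (auto simp: v_def r_def right_adjoint_source_def prod_cat_def op_cat_def cat.truncate_def intro!: restrict_ext)
    have v3: "v 0 = Ide (M 0) T" "v j = u" using j0 by (simp_all add: v_def)
    have v4: "v \<in> (\<Pi>\<^sub>E i\<in>{0..n}. if i = 0 then Hom (M 0) (\<alpha> Y 0) (\<alpha> X 0) else Hom (M i) (\<alpha> X i) (\<alpha> Y i))"
      using u Ide_Hom[OF a] M0.Ide_in_Hom[OF T] by (auto simp: v_def \<alpha>_def)
    have g': "g \<in> Hom (M 0) (OMap F (restrict (\<alpha> Y) {1..n})) (\<alpha> Y 0)"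
      using g by (simp only: \<alpha>1 \<alpha>3 multi_ob_def)
    have "\<phi> j (\<alpha> X) (Ide (M 0) T \<cdot>\<^bsub>M 0\<^esub> g \<cdot>\<^bsub>M 0\<^esub> ar a j u) = Ide (M j) R \<cdot>\<^bsub>M j\<^esub> \<phi> j (\<alpha> Y) g \<cdot>\<^bsub>M j\<^esub> u"
      using nat[THEN bspec, OF \<alpha>4[OF XY(2)], THEN bspec, OF \<alpha>4[OF XY(1)], THEN bspec, OF v4, THEN bspec, OF g']
      by (simp only: v1 v2 v3 GI multi_ar_def)
    moreover have "g \<cdot>\<^bsub>M 0\<^esub> ar a j u \<in> Hom (M 0) (ob (a(j := X))) T"
      using M0.Comp_in_Hom[OF ar_Hom[OF a j u] g] .
    moreover have "\<phi> j (\<alpha> Y) g \<in> Hom (M j) Y R" using bij_betw_apply[OF bij'[OF XY(2)] g] .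
    ultimately show ?thesis using M0.Ide_Comp Mj.Ide_Comp[OF Mj.Comp_in_Hom[OF u]] by simp
  qed
  with that[of R "\<lambda>X. \<phi> j (\<alpha> X)"] R bij' show thesis by blast
qed

text \<open>The maps out of F(..., Z, ...) into T are in bijection with those from Z to R, so there
  is exactly one, and an initial object is a zero object.\<close>

lemma ob_zero_object:
  assumes a: "obj_family n M a" and j: "j \<in> {1..n}" and Z: "is_zero_object (M j) Z"
  shows "is_zero_object (M 0) (ob (a(j := Z)))"
proof -
  interpret Mj: abelian_category "M j" using M_abelian j by simp
  interpret M0: abelian_category "M 0" using M_abelian by simp
  have ZO: "Z \<in> Obj (M j)" using Z by (simp add: is_zero_object_def is_initial_def)
  have "is_initial (M 0) (ob (a(j := Z)))"
    unfolding is_initial_def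
  proof (intro conjI ballI)
    show "ob (a(j := Z)) \<in> Obj (M 0)" using M0.Hom_Obj[OF ar_Hom[OF a j Mj.Ide_in_Hom[OF ZO]]] by simp
    fix T assume "T \<in> Obj (M 0)"
    from adjunction[OF a j this] obtain R \<psi> where R: "R \<in> Obj (M j)"
      "bij_betw \<psi> (Hom (M 0) (ob (a(j := Z))) T) (Hom (M j) Z R)" using ZO by metis
    have "\<exists>!x. x \<in> Hom (M j) Z R" using Z R(1) by (simp add: is_zero_object_def is_initial_def)
    then obtain x where x: "Hom (M j) Z R = {x}" by blast
    with R(2) have "\<exists>f. Hom (M 0) (ob (a(j := Z))) T = {f}"
      by (metis bij_betw_empty1 bij_betw_imp_inj_on bij_betw_def inj_on_image_set_diff singletonI subset_singletonD
          bij_betw_inv_into image_insert image_empty)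
    then show "\<exists>!f. f \<in> Hom (M 0) (ob (a(j := Z))) T" by auto
  qed
  then show ?thesis by (rule M0.initial_is_zero_object)
qed

text \<open>The zero map factors through a zero object, which F preserves in each slot.\<close>

lemma ar_Zero:
  assumes a: "obj_family n M a" and j: "j \<in> {1..n}" and X: "X \<in> Obj (M j)" and Y: "Y \<in> Obj (M j)"
  shows "ar a j (Zero (M j) X Y) = Zero (M 0) (ob (a(j := X))) (ob (a(j := Y)))"
proof -
  interpret Mj: abelian_category "M j" using M_abelian j by simp
  interpret M0: abelian_category "M 0" using M_abelian by simp
  obtain Z where Z: "is_zero_object (M j) Z" using Mj.ex_zero_object by blast
  then have ZO: "Z \<in> Obj (M j)" by (simp add: is_zero_object_def is_initial_def)
  note XZ = Mj.Zero_in_Hom[OF X ZO] and ZY = Mj.Zero_in_Hom[OF ZO Y]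
  note aXZ = ar_Hom[OF a j XZ] and aZY = ar_Hom[OF a j ZY]
  have XO: "ob (a(j := X)) \<in> Obj (M 0)" using M0.Hom_Obj[OF aXZ] by simp
  have "ar a j (Zero (M j) X Y) = ar a j (Zero (M j) Z Y) \<cdot>\<^bsub>M 0\<^esub> ar a j (Zero (M j) X Z)"
    using ar_Comp[OF a j XZ ZY] Mj.Zero_Comp[OF XZ Y] by simp
  also have "ar a j (Zero (M j) X Z) = Zero (M 0) (ob (a(j := X))) (ob (a(j := Z)))"
    using M0.zero_object_Hom(2)[OF ob_zero_object[OF a j Z] XO] aXZ by blast
  finally show ?thesis using M0.Comp_Zero[OF aZY XO] by simp
qed

text \<open>A left adjoint preserves cokernels: existence and uniqueness of factorisations are
  transported along the bijections \<psi>.\<close>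

lemma ar_cokernel:
  assumes a: "obj_family n M a" and j: "j \<in> {1..n}" and cok: "is_cokernel (M j) u q"
  shows "is_cokernel (M 0) (ar a j u) (ar a j q)"
proof -
  interpret Mj: abelian_category "M j" using M_abelian j by simp
  interpret M0: abelian_category "M 0" using M_abelian by simp
  have "u \<in> Arr (M j)" using cok unfolding is_cokernel_def by (elim conjE)
  then obtain X Y where u: "u \<in> Hom (M j) X Y" unfolding Hom_def by blast
  obtain Q where q: "q \<in> Hom (M j) Y Q" and qu: "q \<cdot>\<^bsub>M j\<^esub> u = Zero (M j) X Q"
    by (rule Mj.cokernelE[OF cok u])
  have obj: "X \<in> Obj (M j)" "Y \<in> Obj (M j)" "Q \<in> Obj (M j)" using Mj.Hom_Obj[OF u] Mj.Hom_Obj[OF q] by auto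
  note au = ar_Hom[OF a j u] and aq = ar_Hom[OF a j q]
  have oX: "ob (a(j := X)) \<in> Obj (M 0)" using M0.Hom_Obj[OF au] by simp
  have q_epi: "is_epi (M j) q" using Mj.cokernel_epi[OF cok] .
  have cq: "Cod (M j) q = Q" using q by (simp add: Hom_def)
  show ?thesis
  proof (rule M0.is_cokernelI[OF au aq])
    show "ar a j q \<cdot>\<^bsub>M 0\<^esub> ar a j u = Zero (M 0) (ob (a(j := X))) (ob (a(j := Q)))"
      using ar_Comp[OF a j u q] qu ar_Zero[OF a j obj(1,3)] by simp
    show "is_epi (M 0) (ar a j q)"
    proof (rule M0.is_epiI[OF aq])
      fix T x y assume x: "x \<in> Hom (M 0) (ob (a(j := Q))) T" and y: "y \<in> Hom (M 0) (ob (a(j := Q))) T"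
        and eq: "x \<cdot>\<^bsub>M 0\<^esub> ar a j q = y \<cdot>\<^bsub>M 0\<^esub> ar a j q"
      have T: "T \<in> Obj (M 0)" using M0.Hom_Obj[OF x] by simp
      obtain R \<psi> where bij: "\<And>X. X \<in> Obj (M j) \<Longrightarrow> bij_betw (\<psi> X) (Hom (M 0) (ob (a(j := X))) T) (Hom (M j) X R)"
        and nat: "\<And>X Y u g. \<lbrakk>u \<in> Hom (M j) X Y; g \<in> Hom (M 0) (ob (a(j := Y))) T\<rbrakk>
          \<Longrightarrow> \<psi> X (g \<cdot>\<^bsub>M 0\<^esub> ar a j u) = \<psi> Y g \<cdot>\<^bsub>M j\<^esub> u"
        by (rule adjunction[OF a j T]) blast
      have "\<psi> Q x \<cdot>\<^bsub>M j\<^esub> q = \<psi> Q y \<cdot>\<^bsub>M j\<^esub> q" using nat[OF q x] nat[OF q y] eq by simp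
      then have "\<psi> Q x = \<psi> Q y"
        using Mj.epiD[OF q_epi] bij_betw_apply[OF bij[OF obj(3)]] x y unfolding cq by blast
      from inj_onD[OF bij_betw_imp_inj_on[OF bij[OF obj(3)]] this x y] show "x = y" .
    qed
    fix T h assume h: "h \<in> Hom (M 0) (ob (a(j := Y))) T" and hu: "h \<cdot>\<^bsub>M 0\<^esub> ar a j u = Zero (M 0) (ob (a(j := X))) T"
    have T: "T \<in> Obj (M 0)" using M0.Hom_Obj[OF h] by simp
    obtain R \<psi> where R: "R \<in> Obj (M j)"
      and bij: "\<And>X. X \<in> Obj (M j) \<Longrightarrow> bij_betw (\<psi> X) (Hom (M 0) (ob (a(j := X))) T) (Hom (M j) X R)"
      and nat: "\<And>X Y u g. \<lbrakk>u \<in> Hom (M j) X Y; g \<in> Hom (M 0) (ob (a(j := Y))) T\<rbrakk>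
        \<Longrightarrow> \<psi> X (g \<cdot>\<^bsub>M 0\<^esub> ar a j u) = \<psi> Y g \<cdot>\<^bsub>M j\<^esub> u"
      by (rule adjunction[OF a j T]) blast
    obtain Z where Z: "is_zero_object (M j) Z" using Mj.ex_zero_object by blast
    then have ZO: "Z \<in> Obj (M j)" by (simp add: is_zero_object_def is_initial_def)
    note XZ = Mj.Zero_in_Hom[OF obj(1) ZO]
    have oZ: "ob (a(j := Z)) \<in> Obj (M 0)" using M0.Hom_Obj[OF ar_Hom[OF a j XZ]] by simp
    note ZT = M0.Zero_in_Hom[OF oZ T]
    \<comment> \<open>The bijection \<psi> is not assumed additive. That it sends zero to zero
      follows from naturality along X \<rightarrow> Z, since the zero map factors through F(..., Z,
      ...).\<close>
    have "\<psi> Y h \<cdot>\<^bsub>M j\<^esub> u = \<psi> X (Zero (M 0) (ob (a(j := X))) T)" using nat[OF u h] hu by simp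
    also have "\<dots> = \<psi> Z (Zero (M 0) (ob (a(j := Z))) T) \<cdot>\<^bsub>M j\<^esub> Zero (M j) X Z"
      using nat[OF XZ ZT] M0.Zero_Comp[OF ar_Hom[OF a j XZ] T] by simp
    also have "\<dots> = Zero (M j) X R" using Mj.Comp_Zero[OF bij_betw_apply[OF bij[OF ZO] ZT] obj(1)] .
    finally obtain w where w: "w \<in> Hom (M j) Q R" "w \<cdot>\<^bsub>M j\<^esub> q = \<psi> Y h"
      by (rule Mj.cokernel_factor[OF cok u q bij_betw_apply[OF bij[OF obj(2)] h]])
    from w(1) have "w \<in> \<psi> Q ` Hom (M 0) (ob (a(j := Q))) T"
      by (simp only: bij_betw_imp_surj_on[OF bij[OF obj(3)]])
    then obtain h' where h': "h' \<in> Hom (M 0) (ob (a(j := Q))) T" "\<psi> Q h' = w" by force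
    have "\<psi> Y (h' \<cdot>\<^bsub>M 0\<^esub> ar a j q) = \<psi> Y h" using nat[OF q h'(1)] h'(2) w(2) by simp
    from inj_onD[OF bij_betw_imp_inj_on[OF bij[OF obj(2)]] this M0.Comp_in_Hom[OF aq h'(1)] h]
    have "h' \<cdot>\<^bsub>M 0\<^esub> ar a j q = h" .
    then show "\<exists>v\<in>Hom (M 0) (ob (a(j := Q))) T. v \<cdot>\<^bsub>M 0\<^esub> ar a j q = h" using h'(1) by blast
  qed
qed

lemma multi_right_exact: "multi_right_exact (M 0) n M ob ar"
  by (intro multi_right_exact.intro multi_right_exact_axioms.intro)
    (auto intro: M_abelian ar_Hom ar_Comp ar_upd ar_interchange ar_cokernel ar_Zero)

end

section \<open>The pushout product\<close>

text \<open>Here F enters as a functor on the product, which the diagram on the cube needs; the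
  consequences of the adjunctions are already part of \<open>split_cube\<close>.\<close>

locale functor_cube = split_cube "M 0" n M "multi_ob n F" "multi_ar n M F" \<D> A B C f c
  for M :: "nat \<Rightarrow> ('o, 'm, 'z) abcat_scheme" and n :: nat
    and F :: "(nat \<Rightarrow> 'o, nat \<Rightarrow> 'm, 'o, 'm) func"
    and \<D> :: "nat \<Rightarrow> 'o set" and A B C :: "nat \<Rightarrow> 'o" and f c :: "nat \<Rightarrow> 'm" +
  assumes n_pos: "n \<ge> 1" and F_functor: "is_functor (prod_cat {1..n} M) (M 0) F"
begin

section \<open>The cube diagram in terms of Boolean vertices\<close>

abbreviation "ob \<equiv> multi_ob n F"
abbreviation "ar \<equiv> multi_ar n M F"
abbreviation "J \<equiv> punctured_cube n"
abbreviation "Dg \<equiv> cube_diagram n M F f"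

definition vertex :: "(nat \<Rightarrow> bool) \<Rightarrow> 'o" where
  "vertex e = ob (\<lambda>i. if e i then B i else A i)"

text \<open>The value for x true and y false is a default that matches \<open>arrow_func\<close>;
  only x \<le> y corresponds to an arrow.\<close>

definition side :: "nat \<Rightarrow> bool \<Rightarrow> bool \<Rightarrow> 'm" where
  "side i x y = (if x then Ide (M i) (B i) else if y then f i else Ide (M i) (A i))"

definition edge :: "(nat \<Rightarrow> bool) \<Rightarrow> (nat \<Rightarrow> bool) \<Rightarrow> 'm" where
  "edge e e' = AMap F (\<lambda>i\<in>{1..n}. side i (e i) (e' i))"

text \<open>The maximal vertices of the punctured cube: exactly coordinate i is 0. Every vertex lies
  below one of them, so a cocone is determined by its legs there.\<close>

definition facet :: "nat \<Rightarrow> nat \<Rightarrow> bool" where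
  "facet i = (\<lambda>k\<in>{1..n}. k \<noteq> i)"

definition ridge :: "nat \<Rightarrow> nat \<Rightarrow> nat \<Rightarrow> bool" where
  "ridge i j = (\<lambda>k\<in>{1..n}. k \<noteq> i \<and> k \<noteq> j)"

abbreviation "vtop \<equiv> cube_top n"

lemma side_Hom:
  assumes "i \<in> {1..n}" "x \<longrightarrow> y"
  shows "side i x y \<in> Hom (M i) (if x then B i else A i) (if y then B i else A i)"
proof -
  interpret Mi: abelian_category "M i" using M_abelian assms(1) .
  show ?thesis using Mi.Ide_in_Hom ABC_Obj[OF assms(1)] f_Hom[OF assms(1)] assms(2) by (simp add: side_def)
qed

lemma side_Comp:
  assumes "i \<in> {1..n}" "x \<longrightarrow> y" "y \<longrightarrow> z"
  shows "side i x z = side i y z \<cdot>\<^bsub>M i\<^esub> side i x y"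
proof -
  interpret Mi: abelian_category "M i" using M_abelian assms(1) .
  have "Ide (M i) V \<cdot>\<^bsub>M i\<^esub> Ide (M i) V = Ide (M i) V" if "V \<in> Obj (M i)" for V
    using Mi.Comp_Ide[OF Mi.Ide_in_Hom[OF that]] .
  with ABC_Obj[OF assms(1)] Mi.Comp_Ide[OF f_Hom[OF assms(1)]] Mi.Ide_Comp[OF f_Hom[OF assms(1)]] assms(2,3)
  show ?thesis by (cases x; cases y; cases z) (simp_all add: side_def)
qed

lemma edge_Hom:
  assumes "\<And>i. i \<in> {1..n} \<Longrightarrow> e i \<longrightarrow> e' i"
  shows "edge e e' \<in> Hom (M 0) (vertex e) (vertex e')"
  unfolding edge_def vertex_def multi_ob_def
  by (rule prod_functor_Hom[OF F_functor]) (rule side_Hom[OF _ assms], assumption+)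

lemma edge_Comp:
  assumes "\<And>i. i \<in> {1..n} \<Longrightarrow> e i \<longrightarrow> e' i" "\<And>i. i \<in> {1..n} \<Longrightarrow> e' i \<longrightarrow> e'' i"
  shows "edge e' e'' \<cdot>\<^bsub>M 0\<^esub> edge e e' = edge e e''"
  unfolding edge_def
  by (rule prod_functor_Comp[OF F_functor, of _ "\<lambda>i. if e i then B i else A i" "\<lambda>i. if e' i then B i else A i"
        _ "\<lambda>i. if e'' i then B i else A i", symmetric])
    (rule side_Hom[OF _ assms(1)] side_Hom[OF _ assms(2)] side_Comp[OF _ assms], assumption+)+

lemma OMap_cube: "OMap Dg e = vertex e"
  unfolding cube_diagram_def comp_func_def prod_func_def vertex_def multi_ob_def arrow_func_def
  using f_Hom by (auto simp: Hom_def intro!: arg_cong[of _ _ "OMap F"] restrict_ext)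

lemma AMap_cube: "AMap Dg v = edge (\<lambda>i. fst (v i)) (\<lambda>i. snd (v i))"
  unfolding cube_diagram_def comp_func_def prod_func_def edge_def arrow_func_def side_def
  using f_Hom by (auto simp: Hom_def split_beta intro!: arg_cong[of _ _ "AMap F"] restrict_ext)

lemma edge_cong:
  "\<lbrakk>\<And>i. i \<in> {1..n} \<Longrightarrow> e i = d i; \<And>i. i \<in> {1..n} \<Longrightarrow> e' i = d' i\<rbrakk> \<Longrightarrow> edge e e' = edge d d'"
  unfolding edge_def by (rule arg_cong[of _ _ "AMap F"]) (auto intro!: restrict_ext)

lemma AMap_cube_restrict: "AMap Dg (\<lambda>i\<in>{1..n}. (e i, e' i)) = edge e e'"
  unfolding AMap_cube by (rule edge_cong) auto

lemma Obj_J: "e \<in> Obj J \<longleftrightarrow> e \<in> extensional {1..n} \<and> (\<exists>i\<in>{1..n}. \<not> e i)"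
proof -
  have "e = vtop \<longleftrightarrow> (\<forall>i\<in>{1..n}. e i)" if "e \<in> extensional {1..n}"
    using that unfolding cube_top_def by (auto intro!: extensionalityI[of _ "{1..n}"])
  then show ?thesis
    by (auto simp: punctured_cube_def full_subcat_def cube_def prod_cat_def delta1_def PiE_def)
qed

lemma Arr_J:
  "v \<in> Arr J \<Longrightarrow> Dom J v \<in> Obj J \<and> Cod J v \<in> Obj J \<and> (\<forall>i\<in>{1..n}. Dom J v i \<longrightarrow> Cod J v i)
     \<and> AMap Dg v = edge (Dom J v) (Cod J v)"
  unfolding AMap_cube
  by (auto simp: punctured_cube_def full_subcat_def cube_def prod_cat_def delta1_def PiE_def Pi_def le_bool_def
      intro!: edge_cong)

lemma Arr_J_intro:
  assumes "e \<in> Obj J" "e' \<in> Obj J" "\<And>i. i \<in> {1..n} \<Longrightarrow> e i \<longrightarrow> e' i"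
  shows "(\<lambda>i\<in>{1..n}. (e i, e' i)) \<in> Arr J" "Dom J (\<lambda>i\<in>{1..n}. (e i, e' i)) = e" "Cod J (\<lambda>i\<in>{1..n}. (e i, e' i)) = e'"
proof -
  have e: "e \<in> extensional {1..n}" "e' \<in> extensional {1..n}" using assms Obj_J by auto
  show D: "Dom J (\<lambda>i\<in>{1..n}. (e i, e' i)) = e" "Cod J (\<lambda>i\<in>{1..n}. (e i, e' i)) = e'"
    using e by (auto simp: punctured_cube_def full_subcat_def cube_def prod_cat_def delta1_def
        intro!: extensionalityI[of _ "{1..n}"])
  have "Dom (cube n) = Dom J" "Cod (cube n) = Cod J" "Obj J = Obj (cube n) - {vtop}" by (simp_all add: punctured_cube_def full_subcat_def)
  then show "(\<lambda>i\<in>{1..n}. (e i, e' i)) \<in> Arr J"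
    using D assms by (auto simp: punctured_cube_def full_subcat_def cube_def prod_cat_def delta1_def le_bool_def)
qed

lemma facet_Obj: "i \<in> {1..n} \<Longrightarrow> facet i \<in> Obj J"
  and ridge_Obj: "i \<in> {1..n} \<Longrightarrow> ridge i j \<in> Obj J"
  by (auto simp: Obj_J facet_def ridge_def)

lemma tgt_fam_B: "tgt_fam n B"
  using ABC_Obj by (auto simp: tgt_fam_def obj_family_def)

lemma vertex_top: "vertex vtop = ob B"
  unfolding vertex_def multi_ob_def cube_top_def by (rule arg_cong[of _ _ "OMap F"]) (auto intro!: restrict_ext)

lemma vertex_facet: "vertex (facet i) = ob (B(i := A i))"
  unfolding vertex_def multi_ob_def facet_def by (rule arg_cong[of _ _ "OMap F"]) (auto intro!: restrict_ext)

lemma edge_facet: "edge (facet i) vtop = ar B i (f i)"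
  unfolding edge_def multi_ar_def side_def facet_def cube_top_def
  by (rule arg_cong[of _ _ "AMap F"]) (auto intro!: restrict_ext)

lemma edge_ridge: "i \<noteq> j \<Longrightarrow> edge (ridge i j) (facet i) = ar (B(i := A i)) j (f j)"
  unfolding edge_def multi_ar_def side_def facet_def ridge_def
  by (rule arg_cong[of _ _ "AMap F"]) (auto intro!: restrict_ext)

lemma top_edge_Hom: "edge e vtop \<in> Hom (M 0) (vertex e) (ob B)"
  unfolding vertex_top[symmetric] by (rule edge_Hom) (simp add: cube_top_def)

lemma facet_edge:
  assumes "i \<in> {1..n}" "\<not> e i"
  shows "edge e (facet i) \<in> Hom (M 0) (vertex e) (ob (B(i := A i)))"
    and "ar B i (f i) \<cdot>\<^bsub>M 0\<^esub> edge e (facet i) = edge e vtop"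
proof -
  have 1: "e k \<longrightarrow> facet i k" "facet i k \<longrightarrow> vtop k" if "k \<in> {1..n}" for k
    using assms that by (auto simp: facet_def cube_top_def)
  show "edge e (facet i) \<in> Hom (M 0) (vertex e) (ob (B(i := A i)))"
    using edge_Hom[of e "facet i"] 1(1) by (simp add: vertex_facet)
  show "ar B i (f i) \<cdot>\<^bsub>M 0\<^esub> edge e (facet i) = edge e vtop"
    using edge_Comp[of e "facet i" vtop] 1 by (simp add: edge_facet)
qed

text \<open>The cube is a poset, so arrows can be replaced by comparable pairs of vertices.\<close>

lemma is_cocone_iff:
  "is_cocone J (M 0) Dg T \<iota> \<longleftrightarrow> T \<in> Obj (M 0) \<and> (\<forall>e\<in>Obj J. \<iota> e \<in> Hom (M 0) (vertex e) T) \<and>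
    (\<forall>e\<in>Obj J. \<forall>e'\<in>Obj J. (\<forall>i\<in>{1..n}. e i \<longrightarrow> e' i) \<longrightarrow> \<iota> e' \<cdot>\<^bsub>M 0\<^esub> edge e e' = \<iota> e)"
  (is "?L \<longleftrightarrow> ?R")
proof
  assume L: ?L
  have "\<iota> e' \<cdot>\<^bsub>M 0\<^esub> edge e e' = \<iota> e"
    if "e \<in> Obj J" "e' \<in> Obj J" "\<forall>i\<in>{1..n}. e i \<longrightarrow> e' i" for e e'
  proof -
    note a = Arr_J_intro[OF that(1,2), OF that(3)[THEN bspec]]
    have "\<forall>u\<in>Arr J. \<iota> (Cod J u) \<cdot>\<^bsub>M 0\<^esub> AMap Dg u = \<iota> (Dom J u)" using L by (simp add: is_cocone_def)
    from bspec[OF this a(1)] show ?thesis by (simp only: a AMap_cube_restrict)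
  qed
  with L show ?R by (simp add: is_cocone_def OMap_cube)
next
  assume ?R then show ?L using Arr_J by (simp add: is_cocone_def OMap_cube)
qed

lemma coconeD:
  assumes "is_cocone J (M 0) Dg T \<iota>"
  shows "T \<in> Obj (M 0)" "e \<in> Obj J \<Longrightarrow> \<iota> e \<in> Hom (M 0) (vertex e) T"
    "\<lbrakk>e \<in> Obj J; e' \<in> Obj J; \<And>i. i \<in> {1..n} \<Longrightarrow> e i \<longrightarrow> e' i\<rbrakk> \<Longrightarrow> \<iota> e' \<cdot>\<^bsub>M 0\<^esub> edge e e' = \<iota> e"
  using assms unfolding is_cocone_iff by auto

lemma cocone_facet:
  assumes "is_cocone J (M 0) Dg T \<iota>" "e \<in> Obj J" "i \<in> {1..n}" "\<not> e i"
  shows "\<iota> (facet i) \<cdot>\<^bsub>M 0\<^esub> edge e (facet i) = \<iota> e"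
  using assms(3,4) by (intro coconeD(3)[OF assms(1,2) facet_Obj]) (auto simp: facet_def)

lemma cocone_facet_Hom:
  assumes "is_cocone J (M 0) Dg T \<iota>" "i \<in> {1..n}"
  shows "\<iota> (facet i) \<in> Hom (M 0) (ob (B(i := A i))) T"
  using coconeD(2)[OF assms(1) facet_Obj[OF assms(2)]] by (simp add: vertex_facet)

text \<open>Both composites equal the leg of the cocone at the vertex
  \<open>ridge i j\<close>.\<close>

lemma cocone_compatible:
  assumes T: "is_cocone J (M 0) Dg T \<iota>"
  shows "compatible n B T (\<lambda>i. \<iota> (facet i))"
  unfolding compatible_def
proof (intro conjI ballI impI)
  fix i assume i: "i \<in> {1..n}"
  show "\<iota> (facet i) \<in> Hom (M 0) (ob (B(i := A i))) T" using cocone_facet_Hom[OF T i] .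
  fix j assume j: "j \<in> {1..n}" and ij: "i \<noteq> j"
  have "\<not> ridge i j i" "\<not> ridge i j j" using i j by (auto simp: ridge_def)
  then have "\<iota> (facet i) \<cdot>\<^bsub>M 0\<^esub> edge (ridge i j) (facet i) = \<iota> (facet j) \<cdot>\<^bsub>M 0\<^esub> edge (ridge i j) (facet j)"
    using cocone_facet[OF T ridge_Obj[OF i]] i j by simp
  moreover have "ridge i j = ridge j i" by (auto simp: ridge_def intro!: restrict_ext)
  ultimately show "\<iota> (facet i) \<cdot>\<^bsub>M 0\<^esub> ar (B(i := A i)) j (f j) = \<iota> (facet j) \<cdot>\<^bsub>M 0\<^esub> ar (B(j := A j)) i (f i)"
    using edge_ridge[OF ij] edge_ridge[OF ij[symmetric]] by simp
qed

section \<open>The colimit over the punctured cube and the cokernel of the pushout product\<close>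

abbreviation "q \<equiv> quot_map n B"

lemma q_Hom: "q \<in> Hom (M 0) (ob B) (ob (quot_fam n B))"
  using quot_map_in_Hom[OF n_pos tgt_fam_B] .

lemma q_ar: "i \<in> {1..n} \<Longrightarrow> q \<cdot>\<^bsub>M 0\<^esub> ar B i (f i) = Zero (M 0) (ob (B(i := A i))) (ob (quot_fam n B))"
  using quot_map_ar_Zero[OF n_pos tgt_fam_B] .

lemma ar_f_Hom: "i \<in> {1..n} \<Longrightarrow> ar B i (f i) \<in> Hom (M 0) (ob (B(i := A i))) (ob B)"
  using ar_f_in_Hom[OF tgt_fam_B] .

lemma q_edge:
  assumes "e \<in> Obj J"
  shows "q \<cdot>\<^bsub>M 0\<^esub> edge e vtop = Zero (M 0) (vertex e) (ob (quot_fam n B))"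
proof -
  obtain i where i: "i \<in> {1..n}" "\<not> e i" using assms Obj_J by blast
  have "q \<cdot>\<^bsub>M 0\<^esub> edge e vtop = (q \<cdot>\<^bsub>M 0\<^esub> ar B i (f i)) \<cdot>\<^bsub>M 0\<^esub> edge e (facet i)"
    using D.Comp_assoc[OF facet_edge(1)[of i e, OF i] ar_f_Hom[OF i(1)] q_Hom] facet_edge(2)[of i e, OF i] by simp
  then show ?thesis using q_ar[OF i(1)] D.Zero_Comp[OF facet_edge(1)[of i e, OF i]] D.Hom_Obj[OF q_Hom] by simp
qed

lemma cocone_extend:
  assumes T: "is_cocone J (M 0) Dg T \<iota>"
  obtains T' t h where "t \<in> Hom (M 0) T T'" "is_mono (M 0) t" "h \<in> Hom (M 0) (ob B) T'"
    "\<And>i. i \<in> {1..n} \<Longrightarrow> h \<cdot>\<^bsub>M 0\<^esub> ar B i (f i) = t \<cdot>\<^bsub>M 0\<^esub> \<iota> (facet i)"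
    "\<And>e. e \<in> Obj J \<Longrightarrow> h \<cdot>\<^bsub>M 0\<^esub> edge e vtop = t \<cdot>\<^bsub>M 0\<^esub> \<iota> e"
proof -
  obtain T' t h where *: "t \<in> Hom (M 0) T T'" "is_mono (M 0) t" "h \<in> Hom (M 0) (ob B) T'"
    "\<And>i. i \<in> {1..n} \<Longrightarrow> h \<cdot>\<^bsub>M 0\<^esub> ar B i (f i) = t \<cdot>\<^bsub>M 0\<^esub> \<iota> (facet i)"
    \<comment> \<open>For k = n the range {n<..n} is empty, so nothing is required of B.\<close>
    using extend[OF n_pos tgt_fam_B _ cocone_compatible[OF T] coconeD(1)[OF T]] unfolding extends_def by auto
  have "h \<cdot>\<^bsub>M 0\<^esub> edge e vtop = t \<cdot>\<^bsub>M 0\<^esub> \<iota> e" if e: "e \<in> Obj J" for e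
  proof -
    obtain i where i: "i \<in> {1..n}" "\<not> e i" using e Obj_J by blast
    show ?thesis
      using D.Comp_assoc[OF facet_edge(1)[of i e, OF i] ar_f_Hom[OF i(1)] *(3)] facet_edge(2)[of i e, OF i] *(4)[OF i(1)]
        D.Comp_assoc[OF facet_edge(1)[of i e, OF i] cocone_facet_Hom[OF T i(1)] *(1)] cocone_facet[OF T, of e i, OF e i] by simp
  qed
  with * that show thesis by blast
qed

lemma factor_through_q:
  assumes d: "d \<in> Hom (M 0) (ob B) T" and 0: "\<And>i. i \<in> {1..n} \<Longrightarrow> d \<cdot>\<^bsub>M 0\<^esub> ar B i (f i) = Zero (M 0) (ob (B(i := A i))) T"
  obtains w where "w \<in> Hom (M 0) (ob (quot_fam n B)) T" "w \<cdot>\<^bsub>M 0\<^esub> q = d"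
  using quot_map_factor[OF n_pos tgt_fam_B d] 0 by blast

text \<open>No construction of finite colimits is needed: the kernel of \<open>q\<close> is one.\<close>

lemma kernel_is_colimit:
  assumes ker: "is_kernel (M 0) q k"
  shows "\<exists>L \<iota>. is_colimit J (M 0) Dg L \<iota>"
proof -
  obtain K where k: "k \<in> Hom (M 0) K (ob B)" and qk: "q \<cdot>\<^bsub>M 0\<^esub> k = Zero (M 0) K (ob (quot_fam n B))"
    by (rule D.kernelE[OF ker q_Hom])
  have KO: "K \<in> Obj (M 0)" using D.Hom_Obj[OF k] by simp
  have k_mono: "is_mono (M 0) k" using D.kernel_mono[OF ker] .
  have dk: "Dom (M 0) k = K" using k by (simp add: Hom_def)
  \<comment> \<open>The legs of the cocone: q kills every edge into the top vertex, so these edges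
    factor through its kernel.\<close>
  have "\<exists>u. u \<in> Hom (M 0) (vertex e) K \<and> k \<cdot>\<^bsub>M 0\<^esub> u = edge e vtop" if "e \<in> Obj J" for e
    using D.kernel_factor[OF ker q_Hom k top_edge_Hom q_edge[OF that]] by metis
  then obtain \<iota> where \<iota>: "\<And>e. e \<in> Obj J \<Longrightarrow> \<iota> e \<in> Hom (M 0) (vertex e) K"
    and k\<iota>: "\<And>e. e \<in> Obj J \<Longrightarrow> k \<cdot>\<^bsub>M 0\<^esub> \<iota> e = edge e vtop" by metis
  have cocone: "is_cocone J (M 0) Dg K \<iota>"
    unfolding is_cocone_iff
  proof (intro conjI ballI impI KO \<iota>)
    fix e e' assume e: "e \<in> Obj J" and e': "e' \<in> Obj J" and le: "\<forall>i\<in>{1..n}. e i \<longrightarrow> e' i"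
    have E: "edge e e' \<in> Hom (M 0) (vertex e) (vertex e')" using edge_Hom le by blast
    have "k \<cdot>\<^bsub>M 0\<^esub> \<iota> e' \<cdot>\<^bsub>M 0\<^esub> edge e e' = edge e' vtop \<cdot>\<^bsub>M 0\<^esub> edge e e'"
      using D.Comp_assoc[OF E \<iota>[OF e'] k] k\<iota>[OF e'] by simp
    also have "\<dots> = edge e vtop" using le by (intro edge_Comp) (auto simp: cube_top_def)
    also have "\<dots> = k \<cdot>\<^bsub>M 0\<^esub> \<iota> e" using k\<iota>[OF e] by simp
    finally show "\<iota> e' \<cdot>\<^bsub>M 0\<^esub> edge e e' = \<iota> e"
      using D.monoD[OF k_mono] D.Comp_in_Hom[OF E \<iota>[OF e']] \<iota>[OF e] unfolding dk by blast
  qed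
  have "\<exists>!m. is_mediating J (M 0) K \<iota> T \<iota>' m" if T: "is_cocone J (M 0) Dg T \<iota>'" for T \<iota>'
  proof -
    have TO: "T \<in> Obj (M 0)" using coconeD(1)[OF T] .
    obtain T' t h where t: "t \<in> Hom (M 0) T T'" "is_mono (M 0) t" and h: "h \<in> Hom (M 0) (ob B) T'"
      and hf: "\<And>i. i \<in> {1..n} \<Longrightarrow> h \<cdot>\<^bsub>M 0\<^esub> ar B i (f i) = t \<cdot>\<^bsub>M 0\<^esub> \<iota>' (facet i)"
      and he: "\<And>e. e \<in> Obj J \<Longrightarrow> h \<cdot>\<^bsub>M 0\<^esub> edge e vtop = t \<cdot>\<^bsub>M 0\<^esub> \<iota>' e"
      by (rule cocone_extend[OF T]) blast
    \<comment> \<open>To bring h k back from T' into T, let s be the cokernel of t. On each face s h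
      = s t \<iota>' = 0, so s h factors through q and s h k = 0; as t is the kernel of s, h k
      factors through t.\<close>
    obtain s where s_cok: "is_cokernel (M 0) t s" using D.ex_cokernel t(1) unfolding Hom_def by blast
    obtain S where s: "s \<in> Hom (M 0) T' S" and st: "s \<cdot>\<^bsub>M 0\<^esub> t = Zero (M 0) T S" by (rule D.cokernelE[OF s_cok t(1)])
    have SO: "S \<in> Obj (M 0)" using D.Hom_Obj[OF s] by simp
    have t_ker: "is_kernel (M 0) s t" using D.mono_kernel_of_cokernel[OF t(2) s_cok] .
    have "(s \<cdot>\<^bsub>M 0\<^esub> h) \<cdot>\<^bsub>M 0\<^esub> ar B i (f i) = Zero (M 0) (ob (B(i := A i))) S" if i: "i \<in> {1..n}" for i
      using D.Comp_assoc[OF ar_f_Hom[OF i] h s] hf[OF i] D.Comp_assoc[OF cocone_facet_Hom[OF T i] t(1) s] st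
        D.Zero_Comp[OF cocone_facet_Hom[OF T i] SO] by simp
    then obtain w where w: "w \<in> Hom (M 0) (ob (quot_fam n B)) S" "w \<cdot>\<^bsub>M 0\<^esub> q = s \<cdot>\<^bsub>M 0\<^esub> h"
      using factor_through_q[OF D.Comp_in_Hom[OF h s]] by metis
    have "s \<cdot>\<^bsub>M 0\<^esub> h \<cdot>\<^bsub>M 0\<^esub> k = Zero (M 0) K S"
      using D.Comp_assoc[OF k h s] w(2) D.Comp_assoc[OF k q_Hom w(1)] qk D.Comp_Zero[OF w(1) KO] by simp
    then obtain m where m: "m \<in> Hom (M 0) K T" "t \<cdot>\<^bsub>M 0\<^esub> m = h \<cdot>\<^bsub>M 0\<^esub> k"
      by (rule D.kernel_factor[OF t_ker s t(1) D.Comp_in_Hom[OF k h]])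
    have dt: "Dom (M 0) t = T" using t by (simp add: Hom_def)
    have med: "m \<cdot>\<^bsub>M 0\<^esub> \<iota> e = \<iota>' e" if e: "e \<in> Obj J" for e
    proof -
      have "t \<cdot>\<^bsub>M 0\<^esub> m \<cdot>\<^bsub>M 0\<^esub> \<iota> e = t \<cdot>\<^bsub>M 0\<^esub> \<iota>' e"
        using D.Comp_assoc[OF \<iota>[OF e] m(1) t(1)] m(2) D.Comp_assoc[OF \<iota>[OF e] k h] k\<iota>[OF e] he[OF e] by simp
      then show ?thesis
        using D.monoD[OF t(2)] D.Comp_in_Hom[OF \<iota>[OF e] m(1)] coconeD(2)[OF T e] unfolding dt by blast
    qed
    \<comment> \<open>The difference x of two mediating maps is extended along k to x' on F(B),
      after a monomorphism t2. Since x kills the legs, x' kills the faces and factors through q, so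
      t2 x = x' k = 0.\<close>
    have uniq: "m' = m" if m': "m' \<in> Hom (M 0) K T" "\<And>e. e \<in> Obj J \<Longrightarrow> m' \<cdot>\<^bsub>M 0\<^esub> \<iota> e = \<iota>' e" for m'
    proof -
      define x where "x = m' \<ominus>\<^sub>a\<^bsub>M 0\<^esub> m"
      have x: "x \<in> Hom (M 0) K T" unfolding x_def using D.Minus_in_Hom[OF m'(1) m(1)] .
      have x\<iota>: "x \<cdot>\<^bsub>M 0\<^esub> \<iota> (facet i) = Zero (M 0) (ob (B(i := A i))) T" if i: "i \<in> {1..n}" for i
        using D.Minus_Comp[OF cocone_facet_Hom[OF cocone i] m'(1) m(1)] m'(2)[OF facet_Obj[OF i]] med[OF facet_Obj[OF i]]
          D.Minus_self[OF cocone_facet_Hom[OF T i]] by (simp add: x_def)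
      obtain T2 t2 x' where t2: "t2 \<in> Hom (M 0) T T2" "is_mono (M 0) t2" and x': "x' \<in> Hom (M 0) (ob B) T2"
        and x'k: "x' \<cdot>\<^bsub>M 0\<^esub> k = t2 \<cdot>\<^bsub>M 0\<^esub> x"
        by (rule D.pushout_of_mono[OF k x k_mono]) blast
      have "x' \<cdot>\<^bsub>M 0\<^esub> ar B i (f i) = Zero (M 0) (ob (B(i := A i))) T2" if i: "i \<in> {1..n}" for i
      proof -
        note \<iota>i = cocone_facet_Hom[OF cocone i]
        have "k \<cdot>\<^bsub>M 0\<^esub> \<iota> (facet i) = ar B i (f i)" using k\<iota>[OF facet_Obj[OF i]] by (simp add: edge_facet)
        then have "x' \<cdot>\<^bsub>M 0\<^esub> ar B i (f i) = t2 \<cdot>\<^bsub>M 0\<^esub> x \<cdot>\<^bsub>M 0\<^esub> \<iota> (facet i)"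
          using D.Comp_assoc[OF \<iota>i k x'] x'k D.Comp_assoc[OF \<iota>i x t2(1)] by simp
        then show ?thesis using x\<iota>[OF i] D.Comp_Zero[OF t2(1)] D.Hom_Obj[OF \<iota>i] by simp
      qed
      then obtain w where w: "w \<in> Hom (M 0) (ob (quot_fam n B)) T2" "w \<cdot>\<^bsub>M 0\<^esub> q = x'"
        using factor_through_q[OF x'] by metis
      have "t2 \<cdot>\<^bsub>M 0\<^esub> x = Zero (M 0) K T2"
        using x'k w(2) D.Comp_assoc[OF k q_Hom w(1)] qk D.Comp_Zero[OF w(1) KO] by simp
      then have "x = Zero (M 0) K T" using D.mono_Zero[OF t2(2,1) x] by simp
      then show ?thesis using D.Minus_eq_Zero_iff[OF m'(1) m(1)] by (simp add: x_def)
    qed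
    show ?thesis
    proof (rule ex1I[of _ m])
      show "is_mediating J (M 0) K \<iota> T \<iota>' m" unfolding is_mediating_def using m(1) med by blast
      fix m' assume "is_mediating J (M 0) K \<iota> T \<iota>' m'"
      then show "m' = m" unfolding is_mediating_def by (elim conjE, intro uniq) (assumption, drule bspec)
    qed
  qed
  with cocone show ?thesis unfolding is_colimit_def by blast
qed

lemma colimit_jointly_epi:
  assumes L: "is_colimit J (M 0) Dg L \<iota>" and x: "x \<in> Hom (M 0) L T" and y: "y \<in> Hom (M 0) L T"
    and eq: "\<And>e. e \<in> Obj J \<Longrightarrow> x \<cdot>\<^bsub>M 0\<^esub> \<iota> e = y \<cdot>\<^bsub>M 0\<^esub> \<iota> e"
  shows "x = y"
proof -
  have c: "is_cocone J (M 0) Dg L \<iota>" using L by (simp add: is_colimit_def)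
  have "is_cocone J (M 0) Dg T (\<lambda>e. x \<cdot>\<^bsub>M 0\<^esub> \<iota> e)"
    unfolding is_cocone_iff
  proof (intro conjI ballI impI)
    show "T \<in> Obj (M 0)" using D.Hom_Obj[OF x] by simp
    fix e assume e: "e \<in> Obj J"
    show "x \<cdot>\<^bsub>M 0\<^esub> \<iota> e \<in> Hom (M 0) (vertex e) T" using D.Comp_in_Hom[OF coconeD(2)[OF c e] x] .
    fix e' assume e': "e' \<in> Obj J" and le: "\<forall>i\<in>{1..n}. e i \<longrightarrow> e' i"
    have E: "edge e e' \<in> Hom (M 0) (vertex e) (vertex e')" using edge_Hom le by blast
    show "(x \<cdot>\<^bsub>M 0\<^esub> \<iota> e') \<cdot>\<^bsub>M 0\<^esub> edge e e' = x \<cdot>\<^bsub>M 0\<^esub> \<iota> e"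
      using D.Comp_assoc[OF E coconeD(2)[OF c e'] x] coconeD(3)[OF c e e'] le by simp
  qed
  then have "\<exists>!m. is_mediating J (M 0) L \<iota> T (\<lambda>e. x \<cdot>\<^bsub>M 0\<^esub> \<iota> e) m" using L unfolding is_colimit_def by blast
  moreover have "is_mediating J (M 0) L \<iota> T (\<lambda>e. x \<cdot>\<^bsub>M 0\<^esub> \<iota> e) x" "is_mediating J (M 0) L \<iota> T (\<lambda>e. x \<cdot>\<^bsub>M 0\<^esub> \<iota> e) y"
    using x y eq by (simp_all add: is_mediating_def)
  ultimately show ?thesis by blast
qed

text \<open>Monicity comes from extending the colimit cocone itself: h m and t agree on all legs, so
  h m = t. A map d with d m = 0 kills every face and therefore factors through q.\<close>

lemma mediating_mono_cokernel:
  assumes L: "is_colimit J (M 0) Dg L \<iota>" and m: "m \<in> Hom (M 0) L (ob B)"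
    and m\<iota>: "\<And>e. e \<in> Obj J \<Longrightarrow> m \<cdot>\<^bsub>M 0\<^esub> \<iota> e = edge e vtop"
  shows "is_mono (M 0) m" "is_cokernel (M 0) m q"
proof -
  have c: "is_cocone J (M 0) Dg L \<iota>" using L by (simp add: is_colimit_def)
  have LO: "L \<in> Obj (M 0)" using D.Hom_Obj[OF m] by simp
  obtain T' t h where t: "t \<in> Hom (M 0) L T'" "is_mono (M 0) t" and h: "h \<in> Hom (M 0) (ob B) T'"
    and he: "\<And>e. e \<in> Obj J \<Longrightarrow> h \<cdot>\<^bsub>M 0\<^esub> edge e vtop = t \<cdot>\<^bsub>M 0\<^esub> \<iota> e"
    by (rule cocone_extend[OF c]) blast
  have "h \<cdot>\<^bsub>M 0\<^esub> m = t"
  proof (rule colimit_jointly_epi[OF L D.Comp_in_Hom[OF m h] t(1)])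
    fix e assume e: "e \<in> Obj J"
    show "(h \<cdot>\<^bsub>M 0\<^esub> m) \<cdot>\<^bsub>M 0\<^esub> \<iota> e = t \<cdot>\<^bsub>M 0\<^esub> \<iota> e"
      using D.Comp_assoc[OF coconeD(2)[OF c e] m h] m\<iota>[OF e] he[OF e] by simp
  qed
  then show "is_mono (M 0) m" using D.mono_Comp_right[OF _ m h] t(2) by simp
  have QO: "ob (quot_fam n B) \<in> Obj (M 0)" using D.Hom_Obj[OF q_Hom] by simp
  show "is_cokernel (M 0) m q"
  proof (rule D.is_cokernelI[OF m q_Hom])
    show "q \<cdot>\<^bsub>M 0\<^esub> m = Zero (M 0) L (ob (quot_fam n B))"
    proof (rule colimit_jointly_epi[OF L D.Comp_in_Hom[OF m q_Hom] D.Zero_in_Hom[OF LO QO]])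
      fix e assume e: "e \<in> Obj J"
      show "(q \<cdot>\<^bsub>M 0\<^esub> m) \<cdot>\<^bsub>M 0\<^esub> \<iota> e = Zero (M 0) L (ob (quot_fam n B)) \<cdot>\<^bsub>M 0\<^esub> \<iota> e"
        using D.Comp_assoc[OF coconeD(2)[OF c e] m q_Hom] m\<iota>[OF e] q_edge[OF e]
          D.Zero_Comp[OF coconeD(2)[OF c e] QO] by simp
    qed
    show "is_epi (M 0) q" using quot_map_epi[OF n_pos tgt_fam_B] .
    fix T d assume d: "d \<in> Hom (M 0) (ob B) T" and dm: "d \<cdot>\<^bsub>M 0\<^esub> m = Zero (M 0) L T"
    have TO: "T \<in> Obj (M 0)" using D.Hom_Obj[OF d] by simp
    have "d \<cdot>\<^bsub>M 0\<^esub> ar B i (f i) = Zero (M 0) (ob (B(i := A i))) T" if i: "i \<in> {1..n}" for i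
      using D.Comp_assoc[OF cocone_facet_Hom[OF c i] m d] m\<iota>[OF facet_Obj[OF i]] edge_facet[of i] dm
        D.Zero_Comp[OF cocone_facet_Hom[OF c i] TO] by simp
    then show "\<exists>w\<in>Hom (M 0) (ob (quot_fam n B)) T. w \<cdot>\<^bsub>M 0\<^esub> q = d"
      using factor_through_q[OF d] by metis
  qed
qed

text \<open>Existence of a colimit makes \<open>SOME\<close> return one, and its universal property
  makes \<open>THE\<close> well defined. The chosen colimit need not be the kernel that proved
  existence, so \<open>mediating_mono_cokernel\<close> treats an arbitrary one.\<close>

lemma pushout_product_mono_cokernel:
  shows "\<exists>L. pushout_product n M F f \<in> Hom (M 0) L (ob B)"
    and "is_mono (M 0) (pushout_product n M F f)" "is_cokernel (M 0) (pushout_product n M F f) q"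
proof -
  obtain k where "is_kernel (M 0) q k" using D.ex_kernel q_Hom unfolding Hom_def by blast
  from kernel_is_colimit[OF this] have ex: "\<exists>P. case P of (L, \<iota>) \<Rightarrow> is_colimit J (M 0) Dg L \<iota>" by auto
  obtain L \<iota> where P: "(SOME (L, \<iota>). is_colimit J (M 0) Dg L \<iota>) = (L, \<iota>)" by (cases "SOME (L, \<iota>). is_colimit J (M 0) Dg L \<iota>")
  have L: "is_colimit J (M 0) Dg L \<iota>" using someI_ex[OF ex] by (simp add: P)
  let ?e = "\<lambda>e. AMap Dg (\<lambda>i\<in>{1..n}. (e i, True))"
  have e: "?e = (\<lambda>e. edge e vtop)"
    unfolding AMap_cube_restrict by (intro ext edge_cong) (simp_all add: cube_top_def)
  have "is_cocone J (M 0) Dg (ob B) (\<lambda>e. edge e vtop)"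
    unfolding is_cocone_iff
  proof (intro conjI ballI impI top_edge_Hom)
    show "ob B \<in> Obj (M 0)" using D.Hom_Obj[OF q_Hom] by simp
    fix e e' assume "\<forall>i\<in>{1..n}. e i \<longrightarrow> e' i"
    then show "edge e' vtop \<cdot>\<^bsub>M 0\<^esub> edge e e' = edge e vtop" by (intro edge_Comp) (auto simp: cube_top_def)
  qed
  then have "\<exists>!m. is_mediating J (M 0) L \<iota> (ob B) (\<lambda>e. edge e vtop) m" using L unfolding is_colimit_def by blast
  from theI'[OF this] have "is_mediating J (M 0) L \<iota> (ob B) (\<lambda>e. edge e vtop) (pushout_product n M F f)"
    unfolding pushout_product_def Let_def P e OMap_cube vertex_top by simp
  then have m: "pushout_product n M F f \<in> Hom (M 0) L (ob B)"
    and m\<iota>: "\<And>e. e \<in> Obj J \<Longrightarrow> pushout_product n M F f \<cdot>\<^bsub>M 0\<^esub> \<iota> e = edge e vtop"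
    by (auto simp: is_mediating_def)
  show "\<exists>L. pushout_product n M F f \<in> Hom (M 0) L (ob B)" using m by blast
  show "is_mono (M 0) (pushout_product n M F f)" "is_cokernel (M 0) (pushout_product n M F f) q"
    using mediating_mono_cokernel[OF L m m\<iota>] by auto
qed

lemma cokernel_Cod: "ob (quot_fam n B) = OMap F (restrict C {1..n})"
  unfolding multi_ob_def quot_fam_def by (rule arg_cong[of _ _ "OMap F"]) (auto intro!: restrict_ext)

end

section \<open>From abelian model categories to the pushout product of cofibrations\<close>

theorem theorem4p20:
  fixes n :: nat
    and A :: "nat \<Rightarrow> ('o, 'm) abcat"
    and W :: "nat \<Rightarrow> ('o, 'm) cmap model_classes"
    and F :: "(nat \<Rightarrow> ('o, 'm) cplx, nat \<Rightarrow> ('o, 'm) cmap, ('o, 'm) cplx, ('o, 'm) cmap) func"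
    and G :: "nat \<Rightarrow> (nat \<Rightarrow> ('o, 'm) cplx, nat \<Rightarrow> ('o, 'm) cmap, ('o, 'm) cplx, ('o, 'm) cmap) func"
    and \<phi> :: "nat \<Rightarrow> (nat \<Rightarrow> ('o, 'm) cplx) \<Rightarrow> ('o, 'm) cmap \<Rightarrow> ('o, 'm) cmap"
  defines "M \<equiv> \<lambda>i. Ch (A i)"
    and "\<D> \<equiv> \<lambda>i. cofibrants (Ch (A i)) (W i)"
  assumes "n \<ge> 2"
    and "\<And>i. i \<le> n \<Longrightarrow> abelian_model_category (A i) (W i)"
    and "multivar_adjunction n M F G \<phi>"
    and "\<And>j D. \<lbrakk>j \<in> {1..n}; \<And>i. i \<in> {1..n} - {j} \<Longrightarrow> D i \<in> \<D> i\<rbrakk>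
           \<Longrightarrow> right_split (M j) (M 0) (partial_func n M F D j) (\<D> j)"
    and "\<And>D. D \<in> (\<Pi>\<^sub>E i\<in>{1..n}. \<D> i) \<Longrightarrow> OMap F D \<in> \<D> 0"
    and "\<And>D. \<lbrakk>D \<in> (\<Pi>\<^sub>E i\<in>{1..n}. \<D> i); \<exists>i\<in>{1..n}. acyclic_complex (A i) (D i)\<rbrakk>
           \<Longrightarrow> acyclic_complex (A 0) (OMap F D)"
  shows "left_quillen n M W F"
  unfolding left_quillen_def
proof (intro allI impI)
  fix f assume f: "\<forall>i\<in>{1..n}. f i \<in> Cof (W i)"
  note amc = assms(4)
  have M_abelian: "abelian_category (M i)" if "i \<le> n" for i
    unfolding M_def using abelian_model_category.axioms(1)[OF amc[OF that]]
    by (rule abelian_category.abelian_category_Ch)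
  interpret mla: multivar_left_adjoint n M F G \<phi>
    using M_abelian assms(5) by (intro multivar_left_adjoint.intro)
  have cof: "is_mono (M i) (f i) \<and> (\<exists>q. is_cokernel (M i) (f i) q \<and> tgt q \<in> \<D> i)" if "i \<in> {1..n}" for i
    using abelian_model_category.Cof_iff[OF amc, of i "f i"] f that unfolding M_def \<D>_def by simp
  then have "\<forall>i\<in>{1..n}. \<exists>q. is_cokernel (M i) (f i) q \<and> tgt q \<in> \<D> i" by blast
  then obtain c where c: "\<And>i. i \<in> {1..n} \<Longrightarrow> is_cokernel (M i) (f i) (c i)"
    "\<And>i. i \<in> {1..n} \<Longrightarrow> tgt (c i) \<in> \<D> i" by metis
  define X Y Z where "X = (\<lambda>i. src (f i))" and "Y = (\<lambda>i. tgt (f i))" and "Z = (\<lambda>i. tgt (c i))"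
  have fH: "f i \<in> Hom (M i) (X i) (Y i)" and cH: "c i \<in> Hom (M i) (Y i) (Z i)" if "i \<in> {1..n}" for i
    using c(1)[OF that] unfolding is_cokernel_def
    by (elim conjE, simp add: M_def Hom_def Ch_simps X_def Y_def Z_def)+
  interpret cube: functor_cube M n F \<D> X Y Z f c
  proof (intro functor_cube.intro split_cube.intro mla.multi_right_exact split_cube_axioms.intro functor_cube_axioms.intro)
    fix i assume i: "i \<in> {1..n}"
    show "\<D> i \<subseteq> Obj (M i)" by (auto simp: \<D>_def M_def cofibrants_def)
    show "f i \<in> Hom (M i) (X i) (Y i)" "c i \<in> Hom (M i) (Y i) (Z i)" using fH cH i by auto
    show "is_mono (M i) (f i)" "is_cokernel (M i) (f i) (c i)" "Z i \<in> \<D> i"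
      using cof[OF i] c[OF i] by (auto simp: Z_def)
    fix V assume "V \<in> Obj (M i)"
    then show "\<exists>Q\<in>\<D> i. \<exists>p\<in>Hom (M i) Q V. is_epi (M i) p"
      using cofibrant_cover[OF amc] i unfolding M_def \<D>_def by simp
  next
    fix j a u v assume j: "j \<in> {1..n}" and a: "\<forall>i\<in>{1..n} - {j}. a i \<in> \<D> i"
      and uv: "short_exact (M j) u v" "Cod (M j) v \<in> \<D> j"
    have "right_split (M j) (M 0) (partial_func n M F a j) (\<D> j)" using assms(6)[OF j] a by blast
    \<comment> \<open>The arrow maps of \<open>partial_func\<close> and \<open>multi_ar\<close>
      coincide on unfolding; the first arrow of the resulting sequence is a kernel, hence
      monic.\<close>
    then have "short_exact (M 0) (multi_ar n M F a j u) (multi_ar n M F a j v)"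
      using uv by (simp add: right_split_def partial_func_def multi_ar_def)
    then show "is_mono (M 0) (multi_ar n M F a j u)"
      using preadditive_category.kernel_mono[OF abelian_category.axioms(1)[OF M_abelian]]
      by (auto simp: short_exact_def)
  qed (use assms(3) mla.F_functor in auto)
  let ?m = "pushout_product n M F f" and ?Q = "OMap F (restrict Z {1..n})"
  obtain L where m: "?m \<in> Hom (Ch (A 0)) L (multi_ob n F Y)"
    using cube.pushout_product_mono_cokernel(1) unfolding M_def by blast
  have mono: "is_mono (Ch (A 0)) ?m" and cok: "is_cokernel (Ch (A 0)) ?m cube.q"
    using cube.pushout_product_mono_cokernel(2,3) unfolding M_def by auto
  have q: "cube.q \<in> Hom (Ch (A 0)) (multi_ob n F Y) ?Q"
    using cube.q_Hom unfolding cube.cokernel_Cod by (simp add: M_def)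
  \<comment> \<open>The hypotheses on F concern extensional families, hence the restriction of
    Z.\<close>
  have ZD: "restrict Z {1..n} \<in> (\<Pi>\<^sub>E i\<in>{1..n}. \<D> i)" using c(2) by (auto simp: Z_def)
  have Q: "?Q \<in> cofibrants (Ch (A 0)) (W 0)" using assms(7)[OF ZD] by (simp add: \<D>_def)
  have amc0: "abelian_model_category (A 0) (W 0)" using amc by simp
  have "?m \<in> Cof (W 0)"
    using abelian_model_category.Cof_iff[OF amc0, of ?m] mono cok Q q by (auto simp: Hom_Ch_iff)
  moreover have "?m \<in> Weq (W 0)" if "\<exists>i\<in>{1..n}. f i \<in> Weq (W i)"
  proof -
    from that obtain i where i: "i \<in> {1..n}" "f i \<in> Weq (W i)" by blast
    \<comment> \<open>Triviality of one \<open>f i\<close> makes its cokernel acyclic, the third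
      hypothesis passes this to the cokernel of the pushout product, and
      \<open>acyclic_cokernel_Weq\<close> converts it back into a weak equivalence.\<close>
    have "acyclic_complex (A i) (Z i)"
      using trivial_cofibration_cokernel_acyclic[of "A i" "W i" "f i" "c i" "Y i" "Z i"] amc i f cH[OF i(1)] c(1)[OF i(1)]
      unfolding M_def by simp
    then have "\<exists>i\<in>{1..n}. acyclic_complex (A i) (restrict Z {1..n} i)"
      using i(1) by (intro bexI[of _ i]) simp_all
    then have "acyclic_complex (A 0) ?Q" by (rule assms(8)[OF ZD])
    then show ?thesis by (rule acyclic_cokernel_Weq[OF amc0 m mono q cok Q])
  qed
  ultimately show "?m \<in> Cof (W 0) \<and> ((\<exists>i\<in>{1..n}. f i \<in> Weq (W i)) \<longrightarrow> ?m \<in> Weq (W 0))" by blast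
qed

end
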